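(* Let $\alpha = 1/\sqrt2$, $\nu_\natural=\pi/4$, and consider the following procedure with parameters $\sigma>0$, $\beta>0$ and integers $T_{\mathrm{rough}}, T_\nu, T_u\ge 1$: set $u_0 = \mathbf{1}_{[-1,1]}$ and $u_{\mathrm{rough}} = \mathsf{P}(T_{\mathrm{rough}}, u_0, 0)$; draw $\nu_0\sim\mathrm{Unif}[0,2\pi]$ and iterate $\nu_{k+1} = \nu_k - \beta\,\nabla_\nu\mathcal{L}^{\sigma}(\nu_k, u_{\mathrm{rough}})$ for $k=0,\dots,T_\nu-1$, setting $\hat\nu = \nu_{T_\nu}$; finally set $\hat u = \mathsf{P}(T_u, u_{\mathrm{rough}}, \hat\nu)$. There are absolute constants $c_1, C_1, C_2>0$ such that if $\sigma^2\le 10^{-4}$, $\beta\le c_1$, $0<\varepsilon\le \frac1{768}$, and $$T_{\mathrm{rough}}\ge -C_1\log(\sigma^2\varepsilon),\qquad T_\nu \ge -\frac{C_2\log(3\varepsilon)}{\beta},\qquad T_u\ge 16,$$ then with probability at least $4/7$ over the draw of $\nu_0$, $$\min\Big\{ |\hat\nu-\nu_\natural| \bmod \tfrac{\pi}{2},\ \tfrac{\pi}{2} - \big(|\hat\nu-\nu_\natural|\bmod\tfrac{\pi}{2}\big)\Big\}\le 3\varepsilon,\qquad \|\hat u - u_\natural\|_{L^2(\mathbb{R})}\le 31\sqrt{\varepsilon}.$$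
   Context: Template: $u_\natural = \mathbf{1}_{[-\alpha,\alpha]}\in L^2(\mathbb{R})$ and $X_\natural(s,t) = u_\natural(s)u_\natural(t)$, the indicator of the square $[-\alpha,\alpha]^2$. For $u\in L^2(\mathbb{R})$, $uu^*$ denotes the function $(s,t)\mapsto u(s)u(t)$ on $\mathbb{R}^2$. For $\nu\in\mathbb{R}$, $\tau_\nu:\mathbb{R}^2\to\mathbb{R}^2$ is $\tau_\nu(\mathbf{x}) = \mathbf{R}_\nu\mathbf{x}$ with $\mathbf{R}_\nu = \begin{bmatrix}\cos\nu&-\sin\nu\\ \sin\nu&\cos\nu\end{bmatrix}$ and $\mathbf{x}=(s,t)$. Let $\varphi^{(2)}_{\sigma^2}(\mathbf{x}) = (2\pi\sigma^2)^{-1}e^{-\|\mathbf{x}\|_2^2/(2\sigma^2)}$ and $\ast$ denote convolution on $\mathbb{R}^2$. The loss is $$\mathcal{L}^\sigma(\nu,u) = \tfrac12\big\|\varphi^{(2)}_{\sigma^2}\ast\big(X_\natural\circ\tau_{\nu-\nu_\natural} - uu^*\big)\big\|_{L^2(\mathbb{R}^2)}^2,$$ and $\nabla_\nu\mathcal{L}^\sigma$ is its derivative in $\nu$. For $f\in L^2(\mathbb{R}^2)$, $\mathcal{T}_f:L^2(\mathbb{R})\to L^2(\mathbb{R})$ is $\mathcal{T}_f[g](s)=\int_{\mathbb{R}} f(s,t)g(t)\,dt$, with adjoint $\mathcal{T}_f^*$. Power method: for $\nu\in\mathbb{R}$ let $A_\nu = \mathcal{T}_{X_\natural\circ\tau_{\nu-\nu_\natural}}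 + \mathcal{T}^*_{X_\natural\circ\tau_{\nu-\nu_\natural}}$; given $w_0\in L^2(\mathbb{R})$ set $w_{j+1} = A_\nu w_j/\|A_\nu w_j\|_{L^2(\mathbb{R})}$, and define $\mathsf{P}(k, w_0, \nu) = \sqrt{\tfrac12\langle w_k, A_\nu w_k\rangle}\; w_k$. *)

theory Defs
  imports "HOL-Analysis.Analysis"
begin

definition alpha :: real where "alpha = 1 / sqrt 2"

definition nu_nat :: real where "nu_nat = pi / 4"

definition u_nat :: "real \<Rightarrow> real" where
  "u_nat = indicator {-alpha..alpha}"

definition outer :: "(real \<Rightarrow> real) \<Rightarrow> real \<times> real \<Rightarrow> real" where
  "outer u = (\<lambda>(s,t). u s * u t)"

definition X_nat :: "real \<times> real \<Rightarrow> real" where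
  "X_nat = outer u_nat"

definition rot :: "real \<Rightarrow> real \<times> real \<Rightarrow> real \<times> real" where
  "rot \<nu> = (\<lambda>(s,t). (cos \<nu> * s - sin \<nu> * t, sin \<nu> * s + cos \<nu> * t))"

definition gauss2 :: "real \<Rightarrow> real \<times> real \<Rightarrow> real" where
  "gauss2 s2 x = 1 / (2 * pi * s2) * exp (- (norm x)\<^sup>2 / (2 * s2))"

definition conv2 :: "(real \<times> real \<Rightarrow> real) \<Rightarrow> (real \<times> real \<Rightarrow> real) \<Rightarrow> real \<times> real \<Rightarrow> real" where
  "conv2 f g x = (\<integral>y. f (x - y) * g y \<partial>lborel)"

definition L2norm2 :: "(real \<times> real \<Rightarrow> real) \<Rightarrow> real" where
  "L2norm2 f = sqrt (\<integral>x. (f x)\<^sup>2 \<partial>lborel)"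

definition L2norm :: "(real \<Rightarrow> real) \<Rightarrow> real" where
  "L2norm f = sqrt (\<integral>x. (f x)\<^sup>2 \<partial>lborel)"

definition inner_L2 :: "(real \<Rightarrow> real) \<Rightarrow> (real \<Rightarrow> real) \<Rightarrow> real" where
  "inner_L2 f g = (\<integral>x. f x * g x \<partial>lborel)"

definition loss :: "real \<Rightarrow> real \<Rightarrow> (real \<Rightarrow> real) \<Rightarrow> real" where
  "loss \<sigma> \<nu> u = 1/2 * (L2norm2 (conv2 (gauss2 (\<sigma>\<^sup>2))
       (\<lambda>x. X_nat (rot (\<nu> - nu_nat) x) - outer u x)))\<^sup>2"

definition Top :: "(real \<times> real \<Rightarrow> real) \<Rightarrow> (real \<Rightarrow> real) \<Rightarrow> real \<Rightarrow> real" where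
  "Top f g s = (\<integral>t. f (s,t) * g t \<partial>lborel)"

definition Top_adj :: "(real \<times> real \<Rightarrow> real) \<Rightarrow> (real \<Rightarrow> real) \<Rightarrow> real \<Rightarrow> real" where
  "Top_adj f g s = (\<integral>t. f (t,s) * g t \<partial>lborel)"

definition Aop :: "real \<Rightarrow> (real \<Rightarrow> real) \<Rightarrow> real \<Rightarrow> real" where
  "Aop \<nu> w = (let f = (\<lambda>x. X_nat (rot (\<nu> - nu_nat) x)) in
     (\<lambda>s. Top f w s + Top_adj f w s))"

fun power_iter :: "nat \<Rightarrow> (real \<Rightarrow> real) \<Rightarrow> real \<Rightarrow> real \<Rightarrow> real" where
  "power_iter 0 w0 \<nu> = w0"
| "power_iter (Suc j) w0 \<nu> =
     (let w = power_iter j w0 \<nu> in (\<lambda>s. Aop \<nu> w s / L2norm (Aop \<nu> w)))"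

definition Pm :: "nat \<Rightarrow> (real \<Rightarrow> real) \<Rightarrow> real \<Rightarrow> real \<Rightarrow> real" where
  "Pm k w0 \<nu> = (let w = power_iter k w0 \<nu> in
     (\<lambda>s. sqrt (1/2 * inner_L2 w (Aop \<nu> w)) * w s))"

fun gd_iter :: "real \<Rightarrow> real \<Rightarrow> (real \<Rightarrow> real) \<Rightarrow> real \<Rightarrow> nat \<Rightarrow> real" where
  "gd_iter \<sigma> \<beta> u \<nu>0 0 = \<nu>0"
| "gd_iter \<sigma> \<beta> u \<nu>0 (Suc k) =
     (let \<nu> = gd_iter \<sigma> \<beta> u \<nu>0 k in \<nu> - \<beta> * deriv (\<lambda>v. loss \<sigma> v u) \<nu>)"

definition rmod :: "real \<Rightarrow> real \<Rightarrow> real" where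
  "rmod x m = x - m * of_int \<lfloor>x / m\<rfloor>"

definition u_rough :: "nat \<Rightarrow> real \<Rightarrow> real" where
  "u_rough Tr = Pm Tr (indicator {-1..1}) 0"

definition nu_hat :: "real \<Rightarrow> real \<Rightarrow> nat \<Rightarrow> nat \<Rightarrow> real \<Rightarrow> real" where
  "nu_hat \<sigma> \<beta> Tr Tn \<nu>0 = gd_iter \<sigma> \<beta> (u_rough Tr) \<nu>0 Tn"

definition u_hat :: "real \<Rightarrow> real \<Rightarrow> nat \<Rightarrow> nat \<Rightarrow> nat \<Rightarrow> real \<Rightarrow> real \<Rightarrow> real" where
  "u_hat \<sigma> \<beta> Tr Tn Tu \<nu>0 = Pm Tu (u_rough Tr) (nu_hat \<sigma> \<beta> Tr Tn \<nu>0)"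

end

theory Submission
  imports Defs "HOL-Probability.Probability"
begin

text \<open>
  At \<open>\<nu> = 0\<close> the template is the diamond \<open>\<bar>s\<bar> + \<bar>t\<bar> \<le> 1\<close>, whose integral operator is positive with
  leading eigenfunction \<open>v s = cos (pi s / 2)\<close> on \<open>[-1, 1]\<close> and eigenvalue \<open>4 / pi\<close>. Two applications
  contract the oscillation of \<open>w / v\<close> by \<open>1 - 2 / pi\<close> (Doeblin), so the rough estimate is
  geometrically close to \<open>sqrt (4 / pi) v\<close>.

  By rotation invariance the loss is a constant minus the overlap of the rotated square with
  \<open>k(s) k(t)\<close>, where \<open>k\<close> is the rough estimate smoothed by a Gaussian of variance \<open>2 \<sigma>\<^sup>2\<close>. The divergence
  theorem turns the derivative of the overlap into an integral over one side of the square, which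
  involves only values of \<open>k\<close>. For \<open>k = cos (pi s / 2)\<close> this integral is elementary and, because
  \<open>1 / b\<^sup>2 - cot b / b\<close> increases at least as fast as \<open>b\<^sup>2 / 45\<close>, it is at least linear in the angle
  \<open>\<theta>\<close> for \<open>0 \<le> \<theta> \<le> pi / 7\<close>; the kinks of \<open>v\<close> at \<open>1\<close> and \<open>- 1\<close> only
  contribute a Gaussian tail. Hence gradient descent contracts on the four intervals of radius \<open>pi / 7\<close> around the symmetric copies of the true angle,
  which fill \<open>4 / 7\<close> of the circle.

  Once the angle is within \<open>3 \<epsilon>\<close>, the operator is a perturbation of the rank-one operator of the
  template of Hilbert--Schmidt norm at most \<open>sqrt (48 \<epsilon>)\<close>, and each power step already lands within a
  multiple of this distance. In particular the first conclusion implies the second, so the event is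
  determined by the final angle, a continuous function of the initial one.
\<close>

subsection \<open>The power method at angle zero\<close>

text \<open>The obstacle is the weakness of the restoring force: the torque of the cosine is only
  shown to exceed \<open>0.0588 * \<theta>\<close>, whereas Lipschitz bounds for the same integral
  are of order \<open>4 * pi * \<theta>\<close>. Near \<open>\<theta> = 0\<close> any error of fixed
  size would swamp it. The smoothing error is therefore bounded linearly in \<open>\<theta>\<close>,
  through variations along the rotation, and a slope of \<open>0.025\<close> survives. Only the
  error \<open>\<delta>\<close> of the rough estimate is not proportional to
  \<open>\<theta>\<close>. It leaves a floor of \<open>640 * \<delta>\<close> in gradient descent,
  and the lower bound on the number of rough iterations pushes this floor below the target: the
  factor \<open>\<sigma>\<^sup>2\<close> inside the logarithm absorbs the 640. The radius
  \<open>pi / 7\<close> is what probability \<open>4 / 7\<close> requires of four equal intervals.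
  It lies below \<open>pi / 4\<close>, where the torque vanishes by symmetry and where the corners
  of the rotated square reach the kinks of the eigenfunction.\<close>

definition hwidth :: "real \<Rightarrow> real" where "hwidth s = max 0 (1 - \<bar>s\<bar>)"

text \<open>Passing through \<open>hwidth\<close> extends the eigenfunction by zero without a case
  distinction. The eigenvalue equation becomes an evaluation, because the integral of
  \<open>cos (pi / 2 * x)\<close> over \<open>{- m..m}\<close> is a multiple of
  \<open>sin (pi / 2 * m)\<close>.\<close>

definition cosine :: "real \<Rightarrow> real" where "cosine s = sin (pi / 2 * hwidth s)"

text \<open>Row \<open>s\<close> of the diamond is the centred interval of half-width
  \<open>hwidth s\<close>. The diamond is a symmetric kernel, so this operator is half of
  \<open>Aop 0\<close>.\<close>

definition diamond_op :: "(real \<Rightarrow> real) \<Rightarrow> real \<Rightarrow> real" where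
  "diamond_op w s = integral {- hwidth s..hwidth s} w"

lemma hwidth_bounds: "0 \<le> hwidth s" "hwidth s \<le> 1" "- 1 \<le> hwidth s"
  by (auto simp: hwidth_def)

lemma hwidth_minus [simp]: "hwidth (- s) = hwidth s"
  by (simp add: hwidth_def)

lemma hwidth_outside: "1 \<le> \<bar>s\<bar> \<Longrightarrow> hwidth s = 0"
  by (simp add: hwidth_def)

lemma continuous_hwidth [continuous_intros]: "continuous_on A hwidth"
  unfolding hwidth_def by (intro continuous_intros)

lemma continuous_cosine: "continuous_on A cosine"
  unfolding cosine_def by (intro continuous_intros)

lemma cosine_minus [simp]: "cosine (- s) = cosine s"
  by (simp add: cosine_def)

lemma cosine_eq_cos: "\<bar>s\<bar> \<le> 1 \<Longrightarrow> cosine s = cos (pi / 2 * s)"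
proof -
  assume "\<bar>s\<bar> \<le> 1"
  then have "cosine s = sin (pi / 2 - pi / 2 * \<bar>s\<bar>)"
    by (simp add: cosine_def hwidth_def algebra_simps diff_divide_distrib)
  also have "\<dots> = cos (pi / 2 * \<bar>s\<bar>)" by (simp add: sin_diff)
  also have "\<dots> = cos (pi / 2 * s)" by (cases "s \<ge> 0") auto
  finally show ?thesis .
qed

lemma cosine_outside: "1 \<le> \<bar>s\<bar> \<Longrightarrow> cosine s = 0"
  by (simp add: cosine_def hwidth_outside)

lemma cosine_nonneg: "0 \<le> cosine s"
proof -
  have "pi / 2 * hwidth s \<le> pi / 2 * 1" using hwidth_bounds by (intro mult_left_mono) auto
  then show ?thesis unfolding cosine_def using hwidth_bounds[of s] by (intro sin_ge_zero) auto
qed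

lemma cosine_le_1: "cosine s \<le> 1"
  by (simp add: cosine_def)

lemma hwidth_ge_cosine: "2 / pi * cosine s \<le> hwidth s"
proof -
  have "cosine s \<le> pi / 2 * hwidth s" unfolding cosine_def
    by (rule sin_x_le_x) (use hwidth_bounds in auto)
  then show ?thesis by (simp add: field_simps)
qed

text \<open>On \<open>[0, pi / 2]\<close> the concave sine lies above its chord. Together with
  \<open>hwidth_ge_cosine\<close> this places the first iterate, a multiple of
  \<open>hwidth\<close>, between two multiples of \<open>cosine\<close>.\<close>

lemma hwidth_le_cosine: "hwidth s \<le> cosine s"
proof -
  have "concave_on {0..pi} sin"
    by (rule f''_le0_imp_concave[where f' = cos and f'' = "\<lambda>x. - sin x"])
       (auto intro!: derivative_eq_intros sin_ge_zero)
  from concave_onD[OF this, of "hwidth s" 0 "pi/2"]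
  show ?thesis using hwidth_bounds[of s] by (simp add: cosine_def field_simps)
qed

lemma integral_cosine:
  assumes "0 \<le> m" "m \<le> 1"
  shows "integral {- m..m} cosine = 4 / pi * sin (pi / 2 * m)"
proof -
  have "((\<lambda>s. cos (pi / 2 * s)) has_integral (2 / pi * sin (pi / 2 * m) - 2 / pi * sin (pi / 2 * (- m)))) {- m..m}"
    by (rule fundamental_theorem_of_calculus)
       (use assms in \<open>auto intro!: derivative_eq_intros simp: has_real_derivative_iff_has_vector_derivative[symmetric]\<close>)
  then have "integral {- m..m} (\<lambda>s. cos (pi / 2 * s)) = 4 / pi * sin (pi / 2 * m)"
    by (simp add: integral_unique)
  moreover have "integral {- m..m} cosine = integral {- m..m} (\<lambda>s. cos (pi / 2 * s))"
    by (rule Henstock_Kurzweil_Integration.integral_cong) (use assms in \<open>auto simp: cosine_eq_cos abs_le_iff\<close>)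
  ultimately show ?thesis by simp
qed

lemma diamond_op_cosine: "diamond_op cosine s = 4 / pi * cosine s"
  unfolding diamond_op_def by (subst integral_cosine) (auto simp: hwidth_bounds cosine_def)

lemma diamond_op_minus [simp]: "diamond_op w (- s) = diamond_op w s"
  by (simp add: diamond_op_def)

lemma diamond_op_mono:
  assumes "continuous_on UNIV f" "continuous_on UNIV g" "\<And>x. f x \<le> g x"
  shows "diamond_op f s \<le> diamond_op g s"
  unfolding diamond_op_def
  by (rule integral_le) (use assms in \<open>auto intro!: integrable_continuous_real intro: continuous_on_subset\<close>)

lemma diamond_op_scale: "diamond_op (\<lambda>x. c * f x) s = c * diamond_op f s"
  unfolding diamond_op_def by simp

lemma diamond_op_diff:
  assumes "continuous_on UNIV f" "continuous_on UNIV g"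
  shows "diamond_op (\<lambda>x. f x - g x) = (\<lambda>s. diamond_op f s - diamond_op g s)"
  unfolding diamond_op_def
  by (intro ext Henstock_Kurzweil_Integration.integral_diff)
     (use assms in \<open>auto intro!: integrable_continuous_real intro: continuous_on_subset\<close>)

lemma continuous_diamond_op:
  assumes "w integrable_on {-1..1}"
  shows "continuous_on UNIV (diamond_op w)"
proof -
  let ?F = "\<lambda>x. integral {-1..x} w"
  have F: "continuous_on {-1..1} ?F"
    by (rule indefinite_integral_continuous_1) (rule assms)
  have "diamond_op w s = ?F (hwidth s) - ?F (- hwidth s)" for s
  proof -
    have "integral {-1..- hwidth s} w + integral {- hwidth s..hwidth s} w = ?F (hwidth s)"
      by (rule Henstock_Kurzweil_Integration.integral_combine)
         (use hwidth_bounds[of s] in \<open>auto intro: integrable_on_subinterval[OF assms]\<close>)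
    then show ?thesis by (simp add: diamond_op_def)
  qed
  moreover have "continuous_on UNIV (\<lambda>s. ?F (hwidth s) - ?F (- hwidth s))"
    by (intro continuous_intros continuous_on_compose2[OF F])
       (use hwidth_bounds in \<open>auto\<close>)
  ultimately show ?thesis by presburger
qed

lemma diamond_op_antimono:
  assumes "continuous_on UNIV g" "\<And>x. 0 \<le> g x" "\<bar>s\<bar> \<le> \<bar>t\<bar>"
  shows "diamond_op g t \<le> diamond_op g s"
  unfolding diamond_op_def
  by (rule integral_subset_le)
     (use assms in \<open>auto intro!: integrable_continuous_real intro: continuous_on_subset simp: hwidth_def\<close>)

text \<open>The average of an even function that decreases in \<open>\<bar>t\<bar>\<close> over a centred interval
  decreases with the interval; this is a Doeblin minorisation for the square of the operator.\<close>

lemma diamond_op_sq_ge: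
  assumes g: "continuous_on UNIV g" "\<And>x. 0 \<le> g x"
  shows "hwidth s * diamond_op (diamond_op g) 0 \<le> diamond_op (diamond_op g) s"
proof (cases "hwidth s = 0")
  case True
  then show ?thesis by (simp add: diamond_op_def[of "diamond_op g" s])
next
  case False
  define m where "m = hwidth s"
  have m: "0 < m" "m \<le> 1" using False hwidth_bounds[of s] by (auto simp: m_def)
  let ?G = "diamond_op g"
  have G: "continuous_on UNIV ?G"
    by (rule continuous_diamond_op) (use g in \<open>auto intro!: integrable_continuous_real intro: continuous_on_subset\<close>)
  have "(?G has_integral integral {-m..m} ?G) (cbox (-m) m)"
    using G by (auto intro!: integrable_integral integrable_continuous_real intro: continuous_on_subset)
  \<comment> \<open>Rescaling to the fixed interval \<open>{-1..1}\<close> turns the comparison of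
    two averages into the pointwise inequality \<open>?G x \<le> ?G (m * x)\<close>.\<close>
  from has_integral_affinity[OF this, of m 0]
  have "((\<lambda>x. ?G (m * x)) has_integral (integral {-m..m} ?G / m)) ((\<lambda>x. x / m) ` cbox (-m) m)"
    using m by (simp add: field_simps)
  moreover have "(\<lambda>x. x / m) ` cbox (-m) m = {-1..1}"
    using m by (simp add: image_divide_atLeastAtMost)
  ultimately have 1: "((\<lambda>x. ?G (m * x)) has_integral (integral {-m..m} ?G / m)) {-1..1}" by simp
  have "integral {-1..1} ?G \<le> integral {-m..m} ?G / m"
  proof (rule has_integral_le[OF integrable_integral 1])
    show "?G integrable_on {-1..1}"
      using G by (auto intro!: integrable_continuous_real intro: continuous_on_subset)
    fix x assume "x \<in> {-1..1::real}"
    then show "?G x \<le> ?G (m * x)" using m g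
      by (intro diamond_op_antimono) (auto simp: abs_mult intro: mult_left_le_one_le)
  qed
  then show ?thesis using m
    by (simp add: diamond_op_def[of ?G] m_def[symmetric] field_simps) (simp add: hwidth_def)
qed

text \<open>\<open>r\<close> bounds the relative oscillation of \<open>w / cosine\<close>. The scale
  \<open>a\<close> is existential, so normalisation preserves the predicate. Evenness is carried
  along because the symmetries of \<open>torque\<close> rest on it.\<close>

definition cone :: "real \<Rightarrow> (real \<Rightarrow> real) \<Rightarrow> bool" where
  "cone r w \<longleftrightarrow> continuous_on UNIV w \<and> (\<forall>s. w (- s) = w s) \<and>
     (\<exists>a>0. \<forall>s. a * cosine s \<le> w s \<and> w s \<le> a * (1 + r) * cosine s)"

lemma integrable_on_Icc: "continuous_on UNIV w \<Longrightarrow> w integrable_on {a..b::real}" for w :: "real \<Rightarrow> real"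
  by (auto intro!: integrable_continuous_real intro: continuous_on_subset)

lemma cone_scale: "cone r w \<Longrightarrow> 0 < c \<Longrightarrow> cone r (\<lambda>s. c * w s)"
  unfolding cone_def
proof (elim conjE exE, intro conjI)
  fix a assume "0 < c" "a > 0" and *: "\<forall>s. a * cosine s \<le> w s \<and> w s \<le> a * (1 + r) * cosine s"
  then show "\<exists>a>0. \<forall>s. a * cosine s \<le> c * w s \<and> c * w s \<le> a * (1 + r) * cosine s"
    by (intro exI[of _ "c * a"]) (auto simp: mult.assoc)
qed (auto intro!: continuous_intros)

lemma cone_diamond_op: "cone r w \<Longrightarrow> cone r (diamond_op w)"
  unfolding cone_def
proof (elim conjE exE, intro conjI)
  fix a assume w: "continuous_on UNIV w" and a: "a > 0"
    and *: "\<forall>s. a * cosine s \<le> w s \<and> w s \<le> a * (1 + r) * cosine s"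
  have "diamond_op (\<lambda>s. a * cosine s) s \<le> diamond_op w s"
       "diamond_op w s \<le> diamond_op (\<lambda>s. a * (1 + r) * cosine s) s" for s
    using * by (auto intro!: diamond_op_mono w continuous_intros continuous_cosine)
  then show "\<exists>a>0. \<forall>s. a * cosine s \<le> diamond_op w s \<and> diamond_op w s \<le> a * (1 + r) * cosine s"
    unfolding diamond_op_scale diamond_op_cosine using a
    by (intro exI[of _ "4 / pi * a"]) (auto simp: mult_ac)
  show "continuous_on UNIV (diamond_op w)"
    by (intro continuous_diamond_op integrable_on_Icc w)
qed auto

text \<open>Write \<open>w\<close> as \<open>a * cosine + g\<close> and as
  \<open>a * (1 + r) * cosine - h\<close> with \<open>g\<close> and \<open>h\<close> nonnegative.
  After two applications each remainder dominates \<open>2 / pi * cosine\<close> times its own value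
  at 0, so the lower constant rises and the upper one falls. Since \<open>g + h\<close> is
  \<open>a * r * cosine\<close>, both gains together remove the share \<open>2 / pi\<close> of the
  gap.\<close>

lemma cone_diamond_op_sq: 
  assumes "cone r w"
  shows "cone ((1 - 2 / pi) * r) (diamond_op (diamond_op w))"
proof -
  let ?S = "\<lambda>w. diamond_op (diamond_op w)"
  from assms obtain a where w: "continuous_on UNIV w" and ev: "\<And>s. w (- s) = w s" and a: "a > 0"
    and *: "\<And>s. a * cosine s \<le> w s" "\<And>s. w s \<le> a * (1 + r) * cosine s"
    by (auto simp: cone_def)
  define g where "g = (\<lambda>s. w s - a * cosine s)"
  define h where "h = (\<lambda>s. a * (1 + r) * cosine s - w s)"
  have cont: "continuous_on UNIV g" "continuous_on UNIV h"
    unfolding g_def h_def by (intro continuous_intros w continuous_cosine)+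
  have cS: "continuous_on UNIV (diamond_op f)" if "continuous_on UNIV f" for f
    by (intro continuous_diamond_op integrable_on_Icc that)
  define l where "l = (4 / pi)\<^sup>2"
  have l: "l > 0" by (simp add: l_def)
  have Sv: "?S (\<lambda>s. c * cosine s) s = c * l * cosine s" for c s
    unfolding diamond_op_scale diamond_op_cosine by (simp add: l_def power2_eq_square)
  have Sg: "?S g s = ?S w s - a * l * cosine s" for s
    unfolding g_def using Sv[of a s]
    by (simp add: diamond_op_diff w continuous_cosine cS continuous_intros)
  have Sh: "?S h s = a * (1 + r) * l * cosine s - ?S w s" for s
    unfolding h_def using Sv[of "a * (1 + r)" s]
    by (simp add: diamond_op_diff w continuous_cosine cS continuous_intros)
  have c0: "cosine 0 = 1" by (simp add: cosine_def hwidth_def)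
  have nn1: "0 \<le> diamond_op f s" if "continuous_on UNIV f" "\<And>x. 0 \<le> f x" for f s
    unfolding diamond_op_def by (intro integral_nonneg integrable_on_Icc that)
  have nn: "0 \<le> ?S f s" if "continuous_on UNIV f" "\<And>x. 0 \<le> f x" for f s
    by (intro nn1 cS that)
  have low: "2 / pi * cosine s * ?S f 0 \<le> ?S f s" if "continuous_on UNIV f" "\<And>x. 0 \<le> f x" for f s
  proof -
    have "2 / pi * cosine s * ?S f 0 \<le> hwidth s * ?S f 0"
      by (intro mult_right_mono hwidth_ge_cosine nn that)
    also have "\<dots> \<le> ?S f s" by (intro diamond_op_sq_ge that)
    finally show ?thesis .
  qed
  define a' where "a' = a * l + 2 / pi * ?S g 0"
  have gp: "0 \<le> g x" and hp: "0 \<le> h x" for x using * by (auto simp: g_def h_def)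
  have a': "a' \<ge> a * l" using nn[OF cont(1) gp] by (simp add: a'_def)
  have r0: "r \<ge> 0"
  proof -
    have "a * 1 \<le> a * (1 + r)" using order_trans[OF *(1)[of 0] *(2)[of 0]] c0 by simp
    then show ?thesis using a by simp
  qed
  show ?thesis unfolding cone_def
  proof (intro conjI exI[of _ a'] allI)
    show "continuous_on UNIV (?S w)" by (intro cS w)
    show "0 < a'" using a' a l by (smt (verit) mult_pos_pos)
    fix s
    show "?S w (- s) = ?S w s" by simp
    show "a' * cosine s \<le> ?S w s"
      using low[OF cont(1) gp, of s] by (simp add: Sg a'_def algebra_simps)
    have "?S w s \<le> (a * (1 + r) * l - 2 / pi * ?S h 0) * cosine s"
      using low[OF cont(2) hp, of s] by (simp add: Sh algebra_simps)
    also have "a * (1 + r) * l - 2 / pi * ?S h 0 = a' + (1 - 2 / pi) * r * (a * l)"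
      by (simp add: Sg Sh a'_def c0) (simp add: algebra_simps add_divide_distrib diff_divide_distrib)
    \<comment> \<open>The gap has to be measured relative to the new lower constant
      \<open>a'\<close>, which is at least \<open>a * l\<close>.\<close>
    also have "\<dots> \<le> a' + (1 - 2 / pi) * r * a'"
      using a' r0 pi_ge_two by (intro add_left_mono mult_left_mono) auto
    finally show "?S w s \<le> a' * (1 + (1 - 2 / pi) * r) * cosine s"
      using cosine_nonneg[of s] by (simp add: algebra_simps mult_right_mono)
  qed
qed

text \<open>Bridge between the Lebesgue integrals of the definitions and the gauge integrals in
  which explicit antiderivatives are evaluated.\<close>

lemma integral_supported:
  fixes f :: "real \<Rightarrow> real"
  assumes "continuous_on UNIV f" "\<And>x. 1 < \<bar>x\<bar> \<Longrightarrow> f x = 0"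
  shows "integrable lborel f" "(\<integral>x. f x \<partial>lborel) = integral {-1..1} f"
proof -
  have eq: "f = (\<lambda>x. indicator {-1..1} x *\<^sub>R f x)"
  proof
    fix x show "f x = indicator {-1..1} x *\<^sub>R f x"
      using assms(2)[of x] by (cases "1 < \<bar>x\<bar>") (auto simp: indicator_def)
  qed
  have si: "set_integrable lborel {-1..1} f"
    by (rule borel_integrable_atLeastAtMost') (use assms(1) in \<open>auto intro: continuous_on_subset\<close>)
  then show "integrable lborel f"
    unfolding set_integrable_def by (subst eq)
  show "(\<integral>x. f x \<partial>lborel) = integral {-1..1} f"
    using set_borel_integral_eq_integral(2)[OF si] unfolding set_lebesgue_integral_def
    by (subst eq)
qed

text \<open>\<open>cosine\<close> is a unit vector, so bounds by multiples of \<open>cosine\<close>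
  translate into bounds for norms and inner products with the same constants.\<close>

lemma integral_cosine_sq: "(\<integral>x. (cosine x)\<^sup>2 \<partial>lborel) = 1" "integrable lborel (\<lambda>x. (cosine x)\<^sup>2)"
proof -
  have *: "(\<integral>x. (cosine x)\<^sup>2 \<partial>lborel) = integral {-1..1} (\<lambda>x. (cosine x)\<^sup>2)"
    by (rule integral_supported) (auto intro!: continuous_intros continuous_cosine simp: cosine_outside)
  have "((\<lambda>s. (cos (pi / 2 * s))\<^sup>2) has_integral ((1 / 2 + sin (pi * 1) / (2 * pi)) - ((- 1) / 2 + sin (pi * (- 1)) / (2 * pi)))) {-1..1}"
    by (rule fundamental_theorem_of_calculus)
       (auto intro!: derivative_eq_intros simp: has_real_derivative_iff_has_vector_derivative[symmetric]
          cos_squared_eq cos_double_sin cos_times_cos power2_eq_square field_simps)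
  then have "integral {-1..1} (\<lambda>s. (cos (pi / 2 * s))\<^sup>2) = 1" by (simp add: integral_unique)
  moreover have "integral {-1..1} (\<lambda>s. (cosine s)\<^sup>2) = integral {-1..1} (\<lambda>s. (cos (pi / 2 * s))\<^sup>2)"
    by (rule Henstock_Kurzweil_Integration.integral_cong) (auto simp: cosine_eq_cos abs_le_iff)
  ultimately show "(\<integral>x. (cosine x)\<^sup>2 \<partial>lborel) = 1" using * by simp
  show "integrable lborel (\<lambda>x. (cosine x)\<^sup>2)"
    by (rule integral_supported) (auto intro!: continuous_intros continuous_cosine simp: cosine_outside)
qed

lemma integral_product_cosine_bounds:
  assumes f: "continuous_on UNIV f" "\<And>s. a * cosine s \<le> f s" "\<And>s. f s \<le> b * cosine s"
    and g: "continuous_on UNIV g" "\<And>s. c * cosine s \<le> g s" "\<And>s. g s \<le> d * cosine s"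
    and nn: "0 \<le> a" "0 \<le> c"
  shows "a * c \<le> (\<integral>x. f x * g x \<partial>lborel)" "(\<integral>x. f x * g x \<partial>lborel) \<le> b * d"
proof -
  have f0: "f x = 0" if "1 < \<bar>x\<bar>" for x
    using f(2)[of x] f(3)[of x] cosine_outside[of x] that by simp
  have i: "integrable lborel (\<lambda>x. f x * g x)"
    by (rule integral_supported) (auto intro!: continuous_intros f g simp: f0)
  have fn: "0 \<le> f x" and gn: "0 \<le> g x" for x
    using nn cosine_nonneg[of x] f(2)[of x] g(2)[of x] by (auto intro: order_trans[rotated])
  have "(\<integral>x. (a * c) * (cosine x)\<^sup>2 \<partial>lborel) \<le> (\<integral>x. f x * g x \<partial>lborel)"
  proof (rule integral_mono)
    fix x
    have "(a * cosine x) * (c * cosine x) \<le> f x * g x"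
      using nn cosine_nonneg[of x] fn gn by (intro mult_mono f g) auto
    then show "(a * c) * (cosine x)\<^sup>2 \<le> f x * g x" by (simp add: power2_eq_square mult_ac)
  qed (use i integral_cosine_sq in auto)
  then show "a * c \<le> (\<integral>x. f x * g x \<partial>lborel)" by (simp add: integral_cosine_sq)
  have "(\<integral>x. f x * g x \<partial>lborel) \<le> (\<integral>x. (b * d) * (cosine x)\<^sup>2 \<partial>lborel)"
  proof (rule integral_mono)
    fix x
    have "f x * g x \<le> (b * cosine x) * (d * cosine x)"
      using fn gn by (intro mult_mono f g order_trans[OF fn f(3)]) auto
    then show "f x * g x \<le> (b * d) * (cosine x)\<^sup>2" by (simp add: power2_eq_square mult_ac)
  qed (use i integral_cosine_sq in auto)
  then show "(\<integral>x. f x * g x \<partial>lborel) \<le> b * d" by (simp add: integral_cosine_sq)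
qed

lemma L2norm_cosine_bounds:
  assumes "continuous_on UNIV f" "\<And>s. a * cosine s \<le> f s" "\<And>s. f s \<le> b * cosine s" "0 \<le> a"
  shows "a \<le> L2norm f" "L2norm f \<le> b"
proof -
  have c0: "cosine 0 = 1" by (simp add: cosine_def hwidth_def)
  have b: "0 \<le> b" using order_trans[OF assms(2) assms(3), of 0] assms(4) c0 by simp
  have "a\<^sup>2 \<le> (\<integral>x. (f x)\<^sup>2 \<partial>lborel)" "(\<integral>x. (f x)\<^sup>2 \<partial>lborel) \<le> b\<^sup>2"
    using integral_product_cosine_bounds[OF assms(1-3) assms(1-3,4,4)] by (simp_all add: power2_eq_square)
  then show "a \<le> L2norm f" "L2norm f \<le> b"
    unfolding L2norm_def using assms(4) b by (auto intro: real_le_rsqrt real_le_lsqrt)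
qed

lemma L2norm_scale: "L2norm (\<lambda>x. c * f x) = \<bar>c\<bar> * L2norm f"
  by (simp add: L2norm_def power_mult_distrib real_sqrt_mult)

text \<open>Rotation by \<open>- pi / 4\<close> makes the coordinates multiples of
  \<open>s + t\<close> and \<open>t - s\<close>, and the larger of \<open>\<bar>s + t\<bar>\<close>
  and \<open>\<bar>t - s\<bar>\<close> is \<open>\<bar>s\<bar> + \<bar>t\<bar>\<close>. The radius
  is 1 because \<open>alpha = cos (pi / 4)\<close>.\<close>

lemma X_nat_diamond: "X_nat (rot (0 - nu_nat) (s, t)) = (if \<bar>s\<bar> + \<bar>t\<bar> \<le> 1 then 1 else 0)"
proof -
  have "\<bar>cos (pi/4) * x\<bar> \<le> alpha \<longleftrightarrow> \<bar>x\<bar> \<le> 1" for x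
    by (simp add: cos_45 alpha_def abs_mult field_simps)
  then have "cos (pi/4) * x \<in> {-alpha..alpha} \<longleftrightarrow> \<bar>x\<bar> \<le> 1" for x
    by (metis abs_le_iff atLeastAtMost_iff minus_le_iff)
  then have u: "u_nat (cos (pi/4) * x) = (if \<bar>x\<bar> \<le> 1 then 1 else 0)" for x
    by (simp add: u_nat_def)
  have "rot (0 - nu_nat) (s, t) = (cos (pi/4) * (s + t), cos (pi/4) * (t - s))"
    by (simp add: rot_def nu_nat_def algebra_simps cos_45 sin_45)
  then show ?thesis by (auto simp: X_nat_def outer_def u)
qed

text \<open>The kernel is symmetric, so operator and adjoint agree. Integrability on
  \<open>{-1..1}\<close> is assumed instead of continuity in order to admit the initial indicator
  function.\<close>

lemma Aop_0:
  assumes "set_integrable lborel {-1..1} w"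
  shows "Aop 0 w s = 2 * diamond_op w s"
proof -
  have "(\<integral>t. (if \<bar>s\<bar> + \<bar>t\<bar> \<le> 1 then 1 else 0) * w t \<partial>lborel) = diamond_op w s"
  proof (cases "\<bar>s\<bar> \<le> 1")
    case True
    have "set_integrable lborel {- hwidth s..hwidth s} w"
      by (rule set_integrable_subset[OF assms]) (use hwidth_bounds[of s] in auto)
    from set_borel_integral_eq_integral(2)[OF this]
    have "diamond_op w s = (\<integral>t. indicator {- hwidth s..hwidth s} t *\<^sub>R w t \<partial>lborel)"
      by (simp add: diamond_op_def set_lebesgue_integral_def)
    also have "\<dots> = (\<integral>t. (if \<bar>s\<bar> + \<bar>t\<bar> \<le> 1 then 1 else 0) * w t \<partial>lborel)"
      by (rule Bochner_Integration.integral_cong) (use True in \<open>auto simp: indicator_def hwidth_def\<close>)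
    finally show ?thesis by simp
  next
    case False
    then have "(\<lambda>t. (if \<bar>s\<bar> + \<bar>t\<bar> \<le> 1 then 1 else 0) * w t) = (\<lambda>t. 0)" by auto
    moreover have "hwidth s = 0" using False by (intro hwidth_outside) auto
    ultimately show ?thesis by (simp add: diamond_op_def)
  qed
  then show ?thesis
    by (simp add: Aop_def Top_def Top_adj_def Let_def X_nat_diamond[simplified] add.commute)
qed

lemma Aop_0_continuous: "continuous_on UNIV w \<Longrightarrow> Aop 0 w = (\<lambda>s. 2 * diamond_op w s)"
  by (intro ext Aop_0 borel_integrable_atLeastAtMost') (auto intro: continuous_on_subset)

lemma cone_L2norm_pos: "cone r w \<Longrightarrow> 0 < L2norm w"
  unfolding cone_def using L2norm_cosine_bounds(1)[of w] by (metis less_le_not_le order.trans less_imp_le)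

lemma normalise_cone:
  assumes "cone r w"
  shows "cone r (\<lambda>s. w s / L2norm w)" "L2norm (\<lambda>s. w s / L2norm w) = 1"
  using cone_scale[OF assms, of "1 / L2norm w"] L2norm_scale[of "1 / L2norm w" w] cone_L2norm_pos[OF assms]
  by simp_all

section \<open>Convergence of the rough iterates\<close>

abbreviation (input) rough_iter :: "nat \<Rightarrow> real \<Rightarrow> real" where
  "rough_iter j \<equiv> power_iter j (indicator {-1..1}) 0"

lemma rough_iter_step:
  assumes "continuous_on UNIV (rough_iter j)" "cone r (diamond_op (rough_iter j))"
  obtains c where "0 < c" "rough_iter (Suc j) = (\<lambda>s. c * diamond_op (rough_iter j) s)"
    "L2norm (rough_iter (Suc j)) = 1"
proof -
  let ?A = "\<lambda>s. 2 * diamond_op (rough_iter j) s"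
  have A: "cone r ?A" by (rule cone_scale) (use assms in auto)
  have eq: "rough_iter (Suc j) = (\<lambda>s. ?A s / L2norm ?A)"
    by (simp add: Let_def Aop_0_continuous[OF assms(1)])
  show ?thesis
    by (rule that[of "2 / L2norm ?A"])
       (use cone_L2norm_pos[OF A] normalise_cone(2)[OF A] eq in auto)
qed

text \<open>The contraction acts on pairs of steps, so odd and even indices are carried in parallel.
  Index 0 is left out: the initial indicator is discontinuous, and at the end points it is 1 where
  \<open>cosine\<close> vanishes, so it belongs to no cone.\<close>

lemma rough_iter_cone:
  "cone ((1 - 2 / pi) ^ n) (rough_iter (2 * n + 1)) \<and> L2norm (rough_iter (2 * n + 1)) = 1 \<and>
   cone ((1 - 2 / pi) ^ n) (rough_iter (2 * n + 2)) \<and> L2norm (rough_iter (2 * n + 2)) = 1"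
proof (induction n)
  case 0
  have d: "diamond_op (indicator {-1..1}) s = 2 * hwidth s" for s
  proof -
    have "diamond_op (indicator {-1..1}) s = integral {- hwidth s..hwidth s} (\<lambda>x. 1)"
      unfolding diamond_op_def by (rule Henstock_Kurzweil_Integration.integral_cong)
        (use hwidth_bounds[of s] in \<open>auto simp: indicator_def\<close>)
    then show ?thesis using hwidth_bounds[of s] by simp
  qed
  have A: "Aop 0 (indicator {-1..1}) = (\<lambda>s. 4 * hwidth s)"
  proof
    fix s :: real
    have "set_integrable lborel {-1..1} (indicator {-1..1} :: real \<Rightarrow> real)"
      by (simp add: set_integrable_def indicator_inter_arith[symmetric])
    then show "Aop 0 (indicator {-1..1}) s = 4 * hwidth s" by (simp add: Aop_0 d)
  qed
  have c: "cone 1 (\<lambda>s. 4 * hwidth s)"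
    unfolding cone_def
  \<comment> \<open>The lower constant comes from \<open>hwidth_ge_cosine\<close>. The upper
    inequality needs \<open>4 \<le> 16 / pi\<close>, that is \<open>pi \<le> 4\<close>.\<close>
  proof (intro conjI exI[of _ "8 / pi"] allI)
    fix s
    show "8 / pi * cosine s \<le> 4 * hwidth s" using hwidth_ge_cosine[of s] by (simp add: field_simps)
    have "4 * hwidth s \<le> 4 * cosine s" using hwidth_le_cosine by simp
    also have "\<dots> \<le> 8 / pi * (1 + 1) * cosine s"
      using pi_less_4 by (intro mult_right_mono cosine_nonneg) (simp add: field_simps)
    finally show "4 * hwidth s \<le> 8 / pi * (1 + 1) * cosine s" .
  qed (auto intro!: continuous_intros)
  have 1: "cone 1 (rough_iter 1)" "L2norm (rough_iter 1) = 1"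
    using normalise_cone[OF c] by (simp_all add: A)
  then have cont: "continuous_on UNIV (rough_iter 1)" by (simp add: cone_def)
  obtain k where "0 < k" "rough_iter (Suc 1) = (\<lambda>s. k * diamond_op (rough_iter 1) s)"
    "L2norm (rough_iter (Suc 1)) = 1"
    using rough_iter_step[OF cont cone_diamond_op[OF 1(1)]] by metis
  then have "cone 1 (rough_iter 2)" "L2norm (rough_iter 2) = 1"
    using cone_scale[OF cone_diamond_op[OF 1(1)]] by (simp_all add: numeral_2_eq_2 del: power_iter.simps)
  with 1 show ?case by (simp add: numeral_2_eq_2 del: power_iter.simps)
next
  case (Suc n)
  let ?q = "(1 - 2 / pi) ^ n"
  have step: "cone ((1 - 2 / pi) * r) (rough_iter (Suc (Suc j))) \<and> L2norm (rough_iter (Suc (Suc j))) = 1"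
    if c: "cone r (rough_iter j)" for r j
  proof -
    have cont: "continuous_on UNIV (rough_iter j)" using c by (simp add: cone_def)
    obtain k where k: "0 < k" "rough_iter (Suc j) = (\<lambda>s. k * diamond_op (rough_iter j) s)"
      using rough_iter_step[OF cont cone_diamond_op[OF c]] by metis
    have c2: "cone r (rough_iter (Suc j))"
      unfolding k(2) by (intro cone_scale cone_diamond_op c k)
    have cont2: "continuous_on UNIV (rough_iter (Suc j))" using c2 unfolding cone_def by blast
    obtain k' where k': "0 < k'" "rough_iter (Suc (Suc j)) = (\<lambda>s. k' * diamond_op (rough_iter (Suc j)) s)"
      "L2norm (rough_iter (Suc (Suc j))) = 1"
      using rough_iter_step[OF cont2 cone_diamond_op[OF c2]] by metis
    have "rough_iter (Suc (Suc j)) = (\<lambda>s. k' * k * diamond_op (diamond_op (rough_iter j)) s)"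
      unfolding k'(2) k(2) diamond_op_scale by (simp add: mult.assoc)
    then have "cone ((1 - 2 / pi) * r) (rough_iter (Suc (Suc j)))"
      using k k' by (auto intro!: cone_scale cone_diamond_op_sq c simp del: power_iter.simps)
    with k' show ?thesis by blast
  qed
  show ?case using step[of ?q "2 * n + 1"] step[of ?q "2 * n + 2"] Suc.IH
    by (simp del: power_iter.simps)
qed

text \<open>Unit norm pins the scale of the iterate between \<open>1 / (1 + r)\<close> and 1, and
  the Rayleigh quotient \<open>mu\<close> lies within a factor \<open>(1 + r)\<^sup>2\<close> of
  \<open>4 / pi\<close>. So the ratio of \<open>u_rough\<close> to
  \<open>sqrt (4 / pi) * cosine\<close> lies within a factor \<open>(1 + r)\<^sup>2\<close> of 1,
  hence within \<open>3 * r\<close> because \<open>r \<le> 1\<close>. The exponent counts pairs of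
  steps after the first iterate.\<close>

lemma u_rough_approx:
  assumes "1 \<le> Tr"
  defines "r \<equiv> (1 - 2 / pi) ^ ((Tr - 1) div 2)"
  shows "continuous_on UNIV (u_rough Tr)" "u_rough Tr (- s) = u_rough Tr s"
    "\<bar>u_rough Tr s - sqrt (4 / pi) * cosine s\<bar> \<le> sqrt (4 / pi) * (3 * r) * cosine s"
proof -
  let ?w = "rough_iter Tr"
  define n where "n = (Tr - 1) div 2"
  have "Tr = 2 * n + 1 \<or> Tr = 2 * n + 2" using assms(1) unfolding n_def by presburger
  then have c: "cone r ?w" and N: "L2norm ?w = 1"
    using rough_iter_cone[of n] unfolding r_def n_def[symmetric] by metis+
  have r: "0 \<le> r" "r \<le> 1"
    unfolding r_def using pi_ge_two by (auto intro!: power_le_one zero_le_power)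
  from c obtain a where w: "continuous_on UNIV ?w" and ev: "\<And>s. ?w (- s) = ?w s" and a: "a > 0"
    and *: "\<And>s. a * cosine s \<le> ?w s" "\<And>s. ?w s \<le> a * (1 + r) * cosine s"
    by (auto simp: cone_def)
  have "a \<le> 1" "1 \<le> a * (1 + r)"
    using L2norm_cosine_bounds[OF w *] a N by auto
  then have a1: "1 / (1 + r) \<le> a" "a * (1 + r) \<le> 1 + r"
    using r a mult_right_mono[of a 1 "1 + r"] by (auto simp: field_simps)
  have w1: "1 / (1 + r) * cosine s \<le> ?w s" for s
    using mult_right_mono[OF a1(1) cosine_nonneg[of s]] *(1)[of s] by linarith
  have w2: "?w s \<le> (1 + r) * cosine s" for s
    using *(2)[of s] mult_right_mono[OF a1(2) cosine_nonneg[of s]] by linarith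
  have dw: "continuous_on UNIV (diamond_op ?w)"
    by (intro continuous_diamond_op integrable_on_Icc w)
  have c: "continuous_on UNIV (\<lambda>s. k * cosine s)" for k by (intro continuous_intros continuous_cosine)
  have "diamond_op (\<lambda>s. 1 / (1 + r) * cosine s) s \<le> diamond_op ?w s"
       "diamond_op ?w s \<le> diamond_op (\<lambda>s. (1 + r) * cosine s) s" for s
    by (rule diamond_op_mono[OF c w w1], rule diamond_op_mono[OF w c w2])
  then have d1: "1 / (1 + r) * (4 / pi) * cosine s \<le> diamond_op ?w s"
    and d2: "diamond_op ?w s \<le> (1 + r) * (4 / pi) * cosine s" for s
    unfolding diamond_op_scale diamond_op_cosine by (simp_all only: mult.assoc)
  define mu where "mu = (\<integral>x. ?w x * diamond_op ?w x \<partial>lborel)"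
  have "1 / (1 + r) * (1 / (1 + r) * (4 / pi)) \<le> mu" "mu \<le> (1 + r) * ((1 + r) * (4 / pi))"
    unfolding mu_def
    by (rule integral_product_cosine_bounds[OF w w1 w2 dw d1 d2]; use r in simp)+
  then have "sqrt ((1 / (1 + r))\<^sup>2 * (4 / pi)) \<le> sqrt mu" "sqrt mu \<le> sqrt ((1 + r)\<^sup>2 * (4 / pi))"
    by (auto simp: power2_eq_square mult.assoc)
  then have mu: "1 / (1 + r) * sqrt (4 / pi) \<le> sqrt mu" "sqrt mu \<le> (1 + r) * sqrt (4 / pi)"
    unfolding real_sqrt_mult real_sqrt_abs using r by simp_all
  have "inner_L2 ?w (Aop 0 ?w) = (\<integral>x. 2 * (?w x * diamond_op ?w x) \<partial>lborel)"
    unfolding inner_L2_def Aop_0_continuous[OF w] by (intro Bochner_Integration.integral_cong) auto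
  then have "1 / 2 * inner_L2 ?w (Aop 0 ?w) = mu" by (simp add: mu_def)
  then have u: "u_rough Tr = (\<lambda>s. sqrt mu * ?w s)"
    unfolding u_rough_def Pm_def Let_def by (simp only:)
  show "continuous_on UNIV (u_rough Tr)" unfolding u by (intro continuous_intros w)
  show "u_rough Tr (- s) = u_rough Tr s" by (simp add: u ev)
  define k where "k = sqrt (4 / pi) * cosine s"
  have k: "0 \<le> k" by (simp add: k_def cosine_nonneg)
  have q: "0 \<le> 1 / (1 + r)" "0 \<le> 1 / (1 + r) * sqrt (4 / pi)" "0 \<le> (1 + r) * sqrt (4 / pi)" using r by auto
  have wn: "0 \<le> ?w s" using mult_nonneg_nonneg[OF q(1) cosine_nonneg] w1 by (rule order_trans)
  have mn: "0 \<le> sqrt mu" using q(2) mu(1) by (rule order_trans)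
  have "(1 / (1 + r) * sqrt (4 / pi)) * (1 / (1 + r) * cosine s) \<le> u_rough Tr s"
    unfolding u by (intro mult_mono mu w1 mn mult_nonneg_nonneg[OF q(1) cosine_nonneg])
  then have lo: "1 / (1 + r) * (1 / (1 + r)) * k \<le> u_rough Tr s" unfolding k_def by (simp only: mult_ac)
  have "u_rough Tr s \<le> ((1 + r) * sqrt (4 / pi)) * ((1 + r) * cosine s)"
    unfolding u by (intro mult_mono mu w2 q wn)
  then have hi: "u_rough Tr s \<le> (1 + r) * (1 + r) * k" unfolding k_def by (simp only: mult_ac)
  have "1 - r \<le> 1 / (1 + r)" using r by (simp add: field_simps)
  then have "(1 - r) * (1 - r) \<le> 1 / (1 + r) * (1 / (1 + r))"
    using r by (intro mult_mono) auto
  moreover have "1 - 3 * r \<le> (1 - r) * (1 - r)" using r by (simp add: algebra_simps)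
  ultimately have "1 - 3 * r \<le> 1 / (1 + r) * (1 / (1 + r))" by linarith
  from mult_right_mono[OF this k] lo have "(1 - 3 * r) * k \<le> u_rough Tr s" by linarith
  moreover have "(1 + r) * (1 + r) \<le> 1 + 3 * r"
    using mult_left_mono[OF r(2) r(1)] by (simp add: algebra_simps)
  from mult_right_mono[OF this k] hi have "u_rough Tr s \<le> (1 + 3 * r) * k" by linarith
  ultimately have "\<bar>u_rough Tr s - k\<bar> \<le> 3 * r * k"
    by (simp add: abs_le_iff algebra_simps)
  then show "\<bar>u_rough Tr s - sqrt (4 / pi) * cosine s\<bar> \<le> sqrt (4 / pi) * (3 * r) * cosine s"
    unfolding k_def by (simp only: mult_ac)
qed

subsection \<open>Rotation invariance of planar Lebesgue measure\<close>

text \<open>By Fubini a shear acts on each horizontal line as a translation.\<close>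

lemma distr_lborel_shear_fst:
  "distr lborel borel (\<lambda>p. (fst p + a * snd p, snd p)) = (lborel :: (real \<times> real) measure)"
proof (rule measure_eqI)
  let ?f = "\<lambda>p::real \<times> real. (fst p + a * snd p, snd p)"
  fix A :: "(real \<times> real) set"
  assume "A \<in> sets (distr lborel borel ?f)"
  then have A[measurable]: "A \<in> sets borel" by simp
  let ?I = "\<lambda>p. indicator A p :: ennreal"
  have m [measurable]: "?f \<in> borel_measurable borel"
    by (intro borel_measurable_continuous_onI continuous_intros)
  have "emeasure (distr lborel borel ?f) A
      = (\<integral>\<^sup>+p. ?I p \<partial>distr lborel borel ?f)" by simp
  also have "\<dots> = (\<integral>\<^sup>+p. ?I (fst p + a * snd p, snd p) \<partial>(lborel \<Otimes>\<^sub>M lborel))"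
    by (subst nn_integral_distr) (auto simp: lborel_prod)
  also have "\<dots> = (\<integral>\<^sup>+t. \<integral>\<^sup>+s. ?I (s + a * t, t) \<partial>lborel \<partial>lborel)"
    by (subst lborel_pair.nn_integral_snd[symmetric]) (simp_all add: lborel_prod)
  also have "\<dots> = (\<integral>\<^sup>+t. \<integral>\<^sup>+s. ?I (s, t) \<partial>lborel \<partial>lborel)"
  proof (rule nn_integral_cong)
    fix t
    have m: "(\<lambda>s. ?I (s, t)) \<in> borel_measurable borel" by measurable
    show "(\<integral>\<^sup>+s. ?I (s + a * t, t) \<partial>lborel) = (\<integral>\<^sup>+s. ?I (s, t) \<partial>lborel)"
      using nn_integral_real_affine[OF m, of 1 "a * t"] by (simp add: add.commute)
  qed
  also have "\<dots> = (\<integral>\<^sup>+p. ?I p \<partial>(lborel \<Otimes>\<^sub>M lborel))"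
    by (rule lborel_pair.nn_integral_snd) (simp add: lborel_prod)
  finally show "emeasure (distr lborel borel ?f) A = emeasure lborel A"
    by (simp add: lborel_prod)
qed simp

lemma distr_lborel_shear_snd:
  "distr lborel borel (\<lambda>p. (fst p, snd p + a * fst p)) = (lborel :: (real \<times> real) measure)"
proof (rule measure_eqI)
  let ?f = "\<lambda>p::real \<times> real. (fst p, snd p + a * fst p)"
  fix A :: "(real \<times> real) set"
  assume "A \<in> sets (distr lborel borel ?f)"
  then have A[measurable]: "A \<in> sets borel" by simp
  let ?I = "\<lambda>p. indicator A p :: ennreal"
  have m [measurable]: "?f \<in> borel_measurable borel"
    by (intro borel_measurable_continuous_onI continuous_intros)
  have "emeasure (distr lborel borel ?f) A
      = (\<integral>\<^sup>+p. ?I p \<partial>distr lborel borel ?f)" by simp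
  also have "\<dots> = (\<integral>\<^sup>+p. ?I (fst p, snd p + a * fst p) \<partial>(lborel \<Otimes>\<^sub>M lborel))"
    by (subst nn_integral_distr) (auto simp: lborel_prod)
  also have "\<dots> = (\<integral>\<^sup>+s. \<integral>\<^sup>+t. ?I (s, t + a * s) \<partial>lborel \<partial>lborel)"
    by (subst lborel.nn_integral_fst[symmetric]) (simp_all add: lborel_prod)
  also have "\<dots> = (\<integral>\<^sup>+s. \<integral>\<^sup>+t. ?I (s, t) \<partial>lborel \<partial>lborel)"
  proof (rule nn_integral_cong)
    fix s
    have m: "(\<lambda>t. ?I (s, t)) \<in> borel_measurable borel" by measurable
    show "(\<integral>\<^sup>+t. ?I (s, t + a * s) \<partial>lborel) = (\<integral>\<^sup>+t. ?I (s, t) \<partial>lborel)"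
      using nn_integral_real_affine[OF m, of 1 "a * s"] by (simp add: add.commute)
  qed
  also have "\<dots> = (\<integral>\<^sup>+p. ?I p \<partial>(lborel \<Otimes>\<^sub>M lborel))"
    by (rule lborel.nn_integral_fst) (simp add: lborel_prod)
  finally show "emeasure (distr lborel borel ?f) A = emeasure lborel A"
    by (simp add: lborel_prod)
qed simp

lemma rot_measurable [measurable]: "rot \<theta> \<in> borel_measurable borel"
  unfolding rot_def case_prod_beta by (intro borel_measurable_continuous_onI continuous_intros)

lemma rot_add: "rot a (rot b p) = rot (a + b) p"
  by (cases p) (simp add: rot_def cos_add sin_add algebra_simps)

lemma rot_0 [simp]: "rot 0 p = p"
  by (cases p) (simp add: rot_def)

lemma rot_diff: "rot a p - rot a q = rot a (p - q)"
  by (cases p; cases q) (simp add: rot_def algebra_simps)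

lemma norm_rot [simp]: "norm (rot a p) = norm p"
proof (cases p)
  case (Pair s t)
  have "(cos a * s - sin a * t)\<^sup>2 + (sin a * s + cos a * t)\<^sup>2 = ((sin a)\<^sup>2 + (cos a)\<^sup>2) * (s\<^sup>2 + t\<^sup>2)"
    by algebra
  then show ?thesis by (simp add: Pair rot_def norm_Pair)
qed

text \<open>If \<open>sin \<theta>\<close> is not zero, the rotation is a product of three shears.
  The outer coefficient \<open>(cos \<theta> - 1) / sin \<theta>\<close> is
  \<open>- tan (\<theta> / 2)\<close>.\<close>

lemma distr_lborel_rot: "distr lborel borel (rot \<theta>) = lborel"
proof -
  have 1: "distr lborel borel (rot \<theta>) = lborel" if "sin \<theta> \<noteq> 0" for \<theta>
  proof -
    let ?f = "\<lambda>p::real \<times> real. (fst p + (cos \<theta> - 1) / sin \<theta> * snd p, snd p)"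
    let ?g = "\<lambda>p::real \<times> real. (fst p, snd p + sin \<theta> * fst p)"
    have m: "?f \<in> borel_measurable borel" "?g \<in> borel_measurable borel"
      by (intro borel_measurable_continuous_onI continuous_intros)+
    have m2: "?f \<circ> ?g \<in> borel_measurable borel"
      using measurable_comp[OF m(2) m(1)] .
    have "rot \<theta> p = (?f \<circ> ?g \<circ> ?f) p" for p
    proof (cases p)
      case (Pair s t)
      let ?a = "(cos \<theta> - 1) / sin \<theta>"
      have a: "?a * sin \<theta> = cos \<theta> - 1" using that by simp
      have b: "?a + ?a * cos \<theta> = - sin \<theta>"
      proof -
        have "?a + ?a * cos \<theta> = ((cos \<theta>)\<^sup>2 - 1) / sin \<theta>"
          by (simp add: power2_eq_square add_divide_distrib[symmetric] algebra_simps)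
        also have "(cos \<theta>)\<^sup>2 - 1 = - (sin \<theta> * sin \<theta>)" by (simp add: cos_squared_eq flip: power2_eq_square)
        also have "\<dots> / sin \<theta> = - sin \<theta>" using that by simp
        finally show ?thesis .
      qed
      have x: "t + sin \<theta> * (s + ?a * t) = sin \<theta> * s + cos \<theta> * t"
      proof -
        have "t + sin \<theta> * (s + ?a * t) = sin \<theta> * s + (1 + ?a * sin \<theta>) * t" by (simp add: algebra_simps)
        then show ?thesis unfolding a by simp
      qed
      have "s + ?a * t + ?a * (sin \<theta> * s + cos \<theta> * t) = (1 + ?a * sin \<theta>) * s + (?a + ?a * cos \<theta>) * t"
        by (simp add: algebra_simps)
      then have y: "s + ?a * t + ?a * (sin \<theta> * s + cos \<theta> * t) = cos \<theta> * s - sin \<theta> * t"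
        unfolding a b by simp
      show ?thesis unfolding Pair o_def rot_def prod.case fst_conv snd_conv x y ..
    qed
    then have "rot \<theta> = ?f \<circ> ?g \<circ> ?f" by (rule ext)
    then have "distr lborel borel (rot \<theta>) = distr (distr (distr lborel borel ?f) borel ?g) borel ?f"
      using m m2 by (simp add: distr_distr o_assoc)
    then show ?thesis by (simp only: distr_lborel_shear_fst distr_lborel_shear_snd)
  qed
  show ?thesis
  proof (cases "sin \<theta> = 0")
    case True
    show ?thesis
    proof (cases "sin (\<theta> / 2) = 0")
      case True
      then have "cos \<theta> = 1" using cos_double_sin[of "\<theta>/2"] by simp
      with \<open>sin \<theta> = 0\<close> have "rot \<theta> = (\<lambda>p. p)" by (auto simp: rot_def)
      then show ?thesis by (simp add: distr_id2)
    next
      \<comment> \<open>Here the rotation is a half turn, and its half is a quarter turn with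
        nonzero sine.\<close>
      case False
      have "rot \<theta> = rot (\<theta>/2) \<circ> rot (\<theta>/2)" by (auto simp: rot_add)
      then have "distr lborel borel (rot \<theta>) = distr (distr lborel borel (rot (\<theta>/2))) borel (rot (\<theta>/2))"
        by (simp add: distr_distr)
      then show ?thesis by (simp add: 1[OF False])
    qed
  qed (rule 1)
qed

lemma integral_rot:
  fixes f :: "real \<times> real \<Rightarrow> real"
  assumes [measurable]: "f \<in> borel_measurable borel"
  shows "(\<integral>p. f (rot \<theta> p) \<partial>lborel) = (\<integral>p. f p \<partial>lborel)"
  by (subst (2) distr_lborel_rot[of \<theta>, symmetric]) (simp add: integral_distr)

subsection \<open>Smoothing by an even probability density\<close>

text \<open>Convolution over any Euclidean space: in the plane it is \<open>conv2\<close>, on the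
  line it is what remains of the planar Gaussian when it acts on one factor of
  \<open>outer u\<close>.\<close>

definition smooth :: "('a::euclidean_space \<Rightarrow> real) \<Rightarrow> ('a \<Rightarrow> real) \<Rightarrow> 'a \<Rightarrow> real" where
  "smooth \<phi> g x = (\<integral>y. \<phi> (x - y) * g y \<partial>lborel)"

locale even_density =
  fixes \<phi> :: "'a::euclidean_space \<Rightarrow> real"
  assumes meas [measurable]: "\<phi> \<in> borel_measurable borel"
    and nonneg: "0 \<le> \<phi> x"
    and even: "\<phi> (- x) = \<phi> x"
    and integrable: "integrable lborel \<phi>"
    and integral_eq_1: "(\<integral>x. \<phi> x \<partial>lborel) = 1"
begin

lemma shifted: "integrable lborel (\<lambda>y. \<phi> (x - y))" "(\<integral>y. \<phi> (x - y) \<partial>lborel) = 1"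
proof -
  have eq: "(\<lambda>y. \<phi> (x - y)) = (\<lambda>y. \<phi> (- x + y))"
    using even by (metis minus_diff_eq uminus_add_conv_diff)
  have "integrable (distr lborel borel ((+) (- x))) \<phi>" "(\<integral>y. \<phi> y \<partial>distr lborel borel ((+) (- x))) = 1"
    by (simp_all only: lborel_distr_plus integrable integral_eq_1)
  then show "integrable lborel (\<lambda>y. \<phi> (x - y))" "(\<integral>y. \<phi> (x - y) \<partial>lborel) = 1"
    unfolding eq by (simp_all add: integrable_distr_eq integral_distr)
qed

lemma smooth_integrable:
  assumes [measurable]: "g \<in> borel_measurable borel" and B: "\<And>y. \<bar>g y\<bar> \<le> B"
  shows "integrable lborel (\<lambda>y. \<phi> (x - y) * g y)"
proof (rule Bochner_Integration.integrable_bound)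
  show "integrable lborel (\<lambda>y. B * \<phi> (x - y))" using shifted by simp
  show "AE y in lborel. norm (\<phi> (x - y) * g y) \<le> norm (B * \<phi> (x - y))"
  proof (rule AE_I2)
    fix y
    have "\<phi> (x - y) * \<bar>g y\<bar> \<le> \<phi> (x - y) * \<bar>B\<bar>" using B[of y] by (intro mult_left_mono nonneg) auto
    then show "norm (\<phi> (x - y) * g y) \<le> norm (B * \<phi> (x - y))"
      by (simp add: abs_mult nonneg abs_of_nonneg mult.commute)
  qed
qed measurable

lemma smooth_bounded:
  assumes [measurable]: "g \<in> borel_measurable borel" and B: "\<And>y. \<bar>g y\<bar> \<le> B"
  shows "\<bar>smooth \<phi> g x\<bar> \<le> B"
proof -
  have "\<bar>smooth \<phi> g x\<bar> \<le> (\<integral>y. \<bar>\<phi> (x - y) * g y\<bar> \<partial>lborel)"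
    unfolding smooth_def by (rule integral_abs_bound)
  also have "\<dots> \<le> (\<integral>y. \<phi> (x - y) * B \<partial>lborel)"
  proof (rule integral_mono)
    show "integrable lborel (\<lambda>y. \<bar>\<phi> (x - y) * g y\<bar>)"
      using smooth_integrable[OF assms] by (rule integrable_abs)
  qed (use shifted in \<open>auto simp: abs_mult nonneg intro!: mult_left_mono B\<close>)
  also have "\<dots> = B" using shifted by simp
  finally show ?thesis .
qed

lemma smooth_measurable:
  assumes [measurable]: "g \<in> borel_measurable borel"
  shows "smooth \<phi> g \<in> borel_measurable borel"
  unfolding smooth_def[abs_def] by measurable

lemma smooth_diff:
  assumes "f \<in> borel_measurable borel" "\<And>y. \<bar>f y\<bar> \<le> A"
    and "g \<in> borel_measurable borel" "\<And>y. \<bar>g y\<bar> \<le> B"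
  shows "smooth \<phi> (\<lambda>y. f y - g y) x = smooth \<phi> f x - smooth \<phi> g x"
  unfolding smooth_def using smooth_integrable[OF assms(1,2)] smooth_integrable[OF assms(3,4)]
  by (simp add: right_diff_distrib)

text \<open>Fubini for \<open>\<phi> (x - y) * f y * g x\<close>, where evenness lets the kernel act
  on either factor. One factor is integrable and the other bounded, so that a smoothed function,
  bounded by \<open>smooth_bounded\<close>, can stand for \<open>g\<close>.\<close>

lemma smooth_self_adjoint:
  assumes f: "integrable lborel f"
    and [measurable]: "g \<in> borel_measurable borel" and B: "\<And>y. \<bar>g y\<bar> \<le> B"
  shows "integrable lborel (\<lambda>x. smooth \<phi> f x * g x)"
    "(\<integral>x. smooth \<phi> f x * g x \<partial>lborel) = (\<integral>y. f y * smooth \<phi> g y \<partial>lborel)"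
proof -
  have [measurable]: "f \<in> borel_measurable borel" using f by auto
  let ?h = "\<lambda>y x. \<phi> (x - y) * f y * g x"
  have i1: "integrable lborel (\<lambda>x. ?h y x)" for y
  proof -
    have "integrable lborel (\<lambda>x. f y * (\<phi> (y - x) * g x))"
      using smooth_integrable[of g B y] B by simp
    also have "(\<lambda>x. f y * (\<phi> (y - x) * g x)) = (\<lambda>x. ?h y x)"
      using even by (auto simp: fun_eq_iff) (metis minus_diff_eq)
    finally show ?thesis .
  qed
  have int: "integrable (lborel \<Otimes>\<^sub>M lborel) (case_prod ?h)"
  proof (rule lborel_pair.Fubini_integrable)
    show "case_prod ?h \<in> borel_measurable (lborel \<Otimes>\<^sub>M lborel)" by measurable
    show "AE y in lborel. integrable lborel (\<lambda>x. case_prod ?h (y, x))" using i1 by simp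
    show "integrable lborel (\<lambda>y. \<integral>x. norm (case_prod ?h (y, x)) \<partial>lborel)"
    proof (rule Bochner_Integration.integrable_bound)
      show "integrable lborel (\<lambda>y. B * f y)" using f by simp
      show "AE y in lborel. norm (\<integral>x. norm (case_prod ?h (y, x)) \<partial>lborel) \<le> norm (B * f y)"
      proof (rule AE_I2)
        fix y
        have "(\<integral>x. norm (?h y x) \<partial>lborel) \<le> (\<integral>x. \<phi> (y - x) * (\<bar>f y\<bar> * B) \<partial>lborel)"
        proof (rule integral_mono)
          show "integrable lborel (\<lambda>x. norm (?h y x))" using i1 by (rule integrable_norm)
          show "integrable lborel (\<lambda>x. \<phi> (y - x) * (\<bar>f y\<bar> * B))" using shifted by simp
          fix x
          have "norm (?h y x) = \<phi> (y - x) * (\<bar>f y\<bar> * \<bar>g x\<bar>)"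
            using even[of "x - y"] nonneg by (simp add: abs_mult mult.assoc)
          also have "\<dots> \<le> \<phi> (y - x) * (\<bar>f y\<bar> * B)" by (intro mult_left_mono nonneg B) auto
          finally show "norm (?h y x) \<le> \<phi> (y - x) * (\<bar>f y\<bar> * B)" .
        qed
        also have "\<dots> = \<bar>f y\<bar> * B" using shifted by simp
        finally have "(\<integral>x. norm (?h y x) \<partial>lborel) \<le> \<bar>f y\<bar> * B" .
        moreover have "0 \<le> B" using B[of 0] by linarith
        ultimately show "norm (\<integral>x. norm (case_prod ?h (y, x)) \<partial>lborel) \<le> norm (B * f y)"
          by (simp add: abs_mult mult.commute)
      qed
    qed measurable
  qed
  have s1: "(\<integral>y. ?h y x \<partial>lborel) = smooth \<phi> f x * g x" for x
    by (simp add: smooth_def)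
  have s2: "(\<integral>x. ?h y x \<partial>lborel) = f y * smooth \<phi> g y" for y
  proof -
    have "(\<integral>x. ?h y x \<partial>lborel) = (\<integral>x. f y * (\<phi> (y - x) * g x) \<partial>lborel)"
      using even by (intro Bochner_Integration.integral_cong) (auto, metis minus_diff_eq)
    then show ?thesis by (simp add: smooth_def)
  qed
  show "integrable lborel (\<lambda>x. smooth \<phi> f x * g x)"
    using lborel_pair.integrable_snd[OF int] unfolding s1 .
  show "(\<integral>x. smooth \<phi> f x * g x \<partial>lborel) = (\<integral>y. f y * smooth \<phi> g y \<partial>lborel)"
    using lborel_pair.Fubini_integral[OF int] unfolding s1 s2 .
qed

end

section \<open>Gaussian densities on the line and in the plane\<close>

lemma even_density_normal: "0 < \<sigma> \<Longrightarrow> even_density (normal_density 0 \<sigma>)"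
proof
  assume "0 < \<sigma>"
  then show "integrable lborel (normal_density 0 \<sigma>)" "(\<integral>x. normal_density 0 \<sigma> x \<partial>lborel) = 1"
    by (rule integrable_normal_density, rule integral_normal_density)
qed (simp_all add: normal_density_def)

lemma gauss2_eq: "gauss2 (\<sigma>\<^sup>2) (s, t) = normal_density 0 \<sigma> s * normal_density 0 \<sigma> t"
proof -
  have "- (norm (s, t))\<^sup>2 / (2 * \<sigma>\<^sup>2) = - s\<^sup>2 / (2 * \<sigma>\<^sup>2) + - t\<^sup>2 / (2 * \<sigma>\<^sup>2)"
    by (simp add: norm_Pair diff_divide_distrib)
  moreover have "sqrt (2 * pi * \<sigma>\<^sup>2) * sqrt (2 * pi * \<sigma>\<^sup>2) = 2 * pi * \<sigma>\<^sup>2" by simp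
  ultimately show ?thesis
    unfolding gauss2_def normal_density_def by (simp only: exp_add) (simp add: field_simps)
qed

lemma integrable_product_lborel:
  fixes f g :: "real \<Rightarrow> real"
  assumes f: "integrable lborel f" and g: "integrable lborel g"
  shows "integrable lborel (\<lambda>p. f (fst p) * g (snd p))"
    "(\<integral>p. f (fst p) * g (snd p) \<partial>lborel) = (\<integral>x. f x \<partial>lborel) * (\<integral>x. g x \<partial>lborel)"
proof -
  have [measurable]: "f \<in> borel_measurable borel" "g \<in> borel_measurable borel" using f g by auto
  have i: "integrable (lborel \<Otimes>\<^sub>M lborel) (\<lambda>p. f (fst p) * g (snd p))"
    by (rule lborel_pair.Fubini_integrable) (use f g in \<open>auto simp: abs_mult\<close>)
  then show "integrable lborel (\<lambda>p. f (fst p) * g (snd p))" by (simp add: lborel_prod)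
  show "(\<integral>p. f (fst p) * g (snd p) \<partial>lborel) = (\<integral>x. f x \<partial>lborel) * (\<integral>x. g x \<partial>lborel)"
    using lborel_pair.integral_fst'[OF i] by (simp add: lborel_prod)
qed

lemma even_density_gauss2: assumes "0 < \<sigma>" shows "even_density (gauss2 (\<sigma>\<^sup>2))"
proof
  have eq: "gauss2 (\<sigma>\<^sup>2) = (\<lambda>p. normal_density 0 \<sigma> (fst p) * normal_density 0 \<sigma> (snd p))"
    using gauss2_eq by (auto simp: fun_eq_iff)
  show "gauss2 (\<sigma>\<^sup>2) \<in> borel_measurable borel" unfolding eq borel_prod[symmetric] by measurable
  show "integrable lborel (gauss2 (\<sigma>\<^sup>2))" "(\<integral>x. gauss2 (\<sigma>\<^sup>2) x \<partial>lborel) = 1"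
    unfolding eq using integrable_product_lborel[of "normal_density 0 \<sigma>" "normal_density 0 \<sigma>"] assms
    by (simp_all add: integrable_normal_density integral_normal_density)
qed (auto simp: gauss2_def)

lemma conv2_eq_smooth: "conv2 = smooth"
  by (intro ext) (simp add: conv2_def smooth_def)

lemma smooth_outer:
  assumes "0 < \<sigma>" and "h \<in> borel_measurable borel" "\<And>y. \<bar>h y\<bar> \<le> B"
  shows "smooth (gauss2 (\<sigma>\<^sup>2)) (outer h) = outer (smooth (normal_density 0 \<sigma>) h)"
proof
  fix p :: "real \<times> real"
  obtain s t where p: "p = (s, t)" by (cases p)
  interpret even_density "normal_density 0 \<sigma>" by (rule even_density_normal) fact
  have "smooth (gauss2 (\<sigma>\<^sup>2)) (outer h) p
      = (\<integral>q. (normal_density 0 \<sigma> (s - fst q) * h (fst q)) * (normal_density 0 \<sigma> (t - snd q) * h (snd q)) \<partial>lborel)"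
    unfolding smooth_def p
    by (intro Bochner_Integration.integral_cong refl)
       (auto simp: gauss2_eq outer_def mult_ac)
  also have "\<dots> = outer (smooth (normal_density 0 \<sigma>) h) p"
    by (subst integrable_product_lborel)
       (use smooth_integrable[OF assms(2,3)] in \<open>auto simp: p outer_def smooth_def\<close>)
  finally show "smooth (gauss2 (\<sigma>\<^sup>2)) (outer h) p = outer (smooth (normal_density 0 \<sigma>) h) p" .
qed

text \<open>Self-adjointness moves the inner smoothing from \<open>u\<close> onto the outer
  Gaussian, and the variances of two convolved Gaussians add.\<close>

lemma smooth_normal_twice:
  assumes "0 < \<sigma>" and u: "integrable lborel u"
  shows "smooth (normal_density 0 \<sigma>) (smooth (normal_density 0 \<sigma>) u)
       = smooth (normal_density 0 (sqrt 2 * \<sigma>)) u"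
proof
  fix s
  interpret even_density "normal_density 0 \<sigma>" by (rule even_density_normal) fact
  let ?n = "normal_density 0 \<sigma>"
  have b: "\<bar>?n (s - z)\<bar> \<le> 1 / sqrt (2 * pi * \<sigma>\<^sup>2)" for z
    by (simp add: normal_density_def divide_right_mono)
  have c: "smooth ?n (\<lambda>z. ?n (s - z)) y = normal_density 0 (sqrt 2 * \<sigma>) (s - y)" for y
  proof -
    have "smooth ?n (\<lambda>z. ?n (s - z)) y = (\<integral>z. ?n (y - (y + 1 * z)) * ?n (s - (y + 1 * z)) \<partial>lborel)"
      unfolding smooth_def by (subst lborel_integral_real_affine[of 1 _ y]) simp_all
    also have "\<dots> = (\<integral>z. ?n ((s - y) - z) * ?n z \<partial>lborel)"
      by (simp add: even diff_diff_eq mult.commute)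
    finally have 1: "smooth ?n (\<lambda>z. ?n (s - z)) y = (\<integral>z. ?n ((s - y) - z) * ?n z \<partial>lborel)" .
    have "(\<integral>\<^sup>+z. ennreal (?n ((s - y) - z) * ?n z) \<partial>lborel) = ennreal (normal_density 0 (sqrt (\<sigma>\<^sup>2 + \<sigma>\<^sup>2)) (s - y))"
      using fun_cong[OF conv_normal_density_zero_mean[OF assms(1) assms(1)], of "s - y"] by simp
    then have "(\<integral>z. ?n ((s - y) - z) * ?n z \<partial>lborel) = normal_density 0 (sqrt (\<sigma>\<^sup>2 + \<sigma>\<^sup>2)) (s - y)"
      by (subst integral_eq_nn_integral) auto
    moreover have "sqrt (\<sigma>\<^sup>2 + \<sigma>\<^sup>2) = sqrt 2 * \<sigma>" using assms(1) by (simp add: real_sqrt_mult[symmetric] flip: mult_2) (simp add: real_sqrt_mult)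
    ultimately show ?thesis using 1 by simp
  qed
  have "smooth ?n (smooth ?n u) s = (\<integral>z. smooth ?n u z * ?n (s - z) \<partial>lborel)"
    by (simp add: smooth_def[of _ "smooth ?n u"] mult.commute)
  also have "\<dots> = (\<integral>y. u y * smooth ?n (\<lambda>z. ?n (s - z)) y \<partial>lborel)"
    by (rule smooth_self_adjoint(2)[OF u _ b]) measurable
  finally show "smooth ?n (smooth ?n u) s = smooth (normal_density 0 (sqrt 2 * \<sigma>)) u s"
    by (simp add: c) (simp add: smooth_def mult.commute)
qed

subsection \<open>The loss as a function of the angle\<close>

lemma X_nat_indicator: "X_nat = indicator (cbox (- alpha, - alpha) (alpha, alpha))"
  by (auto simp: X_nat_def outer_def u_nat_def fun_eq_iff indicator_def cbox_Pair_eq)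

lemma X_nat_measurable [measurable]: "X_nat \<in> borel_measurable borel"
  unfolding X_nat_indicator by (intro borel_measurable_indicator) (simp add: borel_closed closed_cbox)

lemma smooth_gauss2_rot:
  assumes "0 < \<sigma>" "F \<in> borel_measurable borel"
  shows "smooth (gauss2 (\<sigma>\<^sup>2)) (\<lambda>x. F (rot \<theta> x)) x = smooth (gauss2 (\<sigma>\<^sup>2)) F (rot \<theta> x)"
proof -
  interpret even_density "gauss2 (\<sigma>\<^sup>2)" by (rule even_density_gauss2) fact
  note assms(2)[measurable]
  have g: "gauss2 (\<sigma>\<^sup>2) (rot \<theta> p) = gauss2 (\<sigma>\<^sup>2) p" for p by (simp add: gauss2_def)
  have "smooth (gauss2 (\<sigma>\<^sup>2)) F (rot \<theta> x) = (\<integral>y. gauss2 (\<sigma>\<^sup>2) (rot \<theta> x - rot \<theta> y) * F (rot \<theta> y) \<partial>lborel)"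
    unfolding smooth_def by (subst integral_rot) measurable
  then show ?thesis by (simp add: rot_diff g smooth_def)
qed

text \<open>The inner product of the rotated square with \<open>outer k\<close>, with the rotation
  moved onto \<open>outer k\<close>. The domain of integration is then fixed and the angle can be
  differentiated under the integral.\<close>

definition overlap :: "(real \<Rightarrow> real) \<Rightarrow> real \<Rightarrow> real" where
  "overlap k \<theta> = integral (cbox (- alpha, - alpha) (alpha, alpha))
     (\<lambda>p. k (cos \<theta> * fst p + sin \<theta> * snd p) * k (cos \<theta> * snd p - sin \<theta> * fst p))"

text \<open>Expand the square. The two squared norms do not depend on the angle. In the cross term
  self-adjointness moves both Gaussians onto \<open>outer u\<close>, and the product structure
  reduces this to smoothing \<open>u\<close> twice on the line, hence the width
  \<open>sqrt 2 * \<sigma>\<close>.\<close>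

lemma loss_eq_overlap:
  assumes \<sigma>: "0 < \<sigma>" and u: "integrable lborel u" "\<And>x. \<bar>u x\<bar> \<le> B"
    and k: "k = smooth (normal_density 0 (sqrt 2 * \<sigma>)) u" "continuous_on UNIV k"
  shows "\<exists>C. \<forall>\<nu>. loss \<sigma> \<nu> u = C - overlap k (\<nu> - nu_nat)"
proof -
  interpret N: even_density "normal_density 0 \<sigma>" by (rule even_density_normal) fact
  interpret G: even_density "gauss2 (\<sigma>\<^sup>2)" by (rule even_density_gauss2) fact
  let ?S = "smooth (gauss2 (\<sigma>\<^sup>2))"
  have um[measurable]: "u \<in> borel_measurable borel" using u(1) by auto
  have B0: "0 \<le> B" using u(2)[of 0] by linarith
  define X where "X \<theta> = (\<lambda>x. X_nat (rot \<theta> x))" for \<theta>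
  have Xm[measurable]: "X \<theta> \<in> borel_measurable borel" for \<theta> unfolding X_def by measurable
  have Xb: "\<bar>X \<theta> x\<bar> \<le> 1" for \<theta> x by (simp add: X_def X_nat_indicator indicator_def)
  have X0: "integrable lborel X_nat" unfolding X_nat_indicator
    by (simp add: emeasure_lborel_cbox_eq)
  have Xi: "integrable lborel (X \<theta>)" for \<theta>
  proof -
    have "integrable (distr lborel borel (rot \<theta>)) X_nat" by (simp add: distr_lborel_rot X0)
    then show ?thesis unfolding X_def by (simp add: integrable_distr_eq)
  qed
  define U where "U = outer u"
  have Ui: "integrable lborel U" unfolding U_def outer_def case_prod_beta
    by (rule integrable_product_lborel[OF u(1) u(1)])
  then have Um[measurable]: "U \<in> borel_measurable borel" by auto
  have Ub: "\<bar>U x\<bar> \<le> B * B" for x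
    unfolding U_def outer_def case_prod_beta abs_mult using B0 by (intro mult_mono u) auto
  have SXm[measurable]: "?S (X \<theta>) \<in> borel_measurable borel" for \<theta> by (rule G.smooth_measurable) simp
  have SUm[measurable]: "?S U \<in> borel_measurable borel" by (rule G.smooth_measurable) simp
  have SXb: "\<bar>?S (X \<theta>) x\<bar> \<le> 1" for \<theta> x by (rule G.smooth_bounded[OF Xm Xb])
  have SUb: "\<bar>?S U x\<bar> \<le> B * B" for x by (rule G.smooth_bounded[OF Um Ub])
  have iXX: "integrable lborel (\<lambda>x. ?S (X \<theta>) x * ?S (X \<theta>) x)" for \<theta>
    by (rule G.smooth_self_adjoint(1)[OF Xi SXm SXb])
  have iUU: "integrable lborel (\<lambda>x. ?S U x * ?S U x)"
    by (rule G.smooth_self_adjoint(1)[OF Ui SUm SUb])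
  have iXU: "integrable lborel (\<lambda>x. ?S (X \<theta>) x * ?S U x)" for \<theta>
    by (rule G.smooth_self_adjoint(1)[OF Xi SUm SUb])
  \<comment> \<open>The planar Gaussian is radial, so smoothing commutes with the rotation, and
    Lebesgue measure is invariant.\<close>
  have XX: "(\<integral>x. ?S (X \<theta>) x * ?S (X \<theta>) x \<partial>lborel) = (\<integral>x. ?S X_nat x * ?S X_nat x \<partial>lborel)" for \<theta>
  proof -
    have [measurable]: "?S X_nat \<in> borel_measurable borel" by (rule G.smooth_measurable) simp
    have "?S (X \<theta>) x = ?S X_nat (rot \<theta> x)" for x
      unfolding X_def by (rule smooth_gauss2_rot[OF \<sigma>]) simp
    then show ?thesis by (simp add: integral_rot[of "\<lambda>x. ?S X_nat x * ?S X_nat x"])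
  qed
  have SSU: "?S (?S U) = outer k"
  proof -
    have b: "\<bar>smooth (normal_density 0 \<sigma>) u x\<bar> \<le> B" for x by (rule N.smooth_bounded[OF um u(2)])
    show ?thesis unfolding U_def k(1) smooth_outer[OF \<sigma> um u(2)]
      by (subst smooth_outer[OF \<sigma> N.smooth_measurable[OF um] b]) (simp add: smooth_normal_twice[OF \<sigma> u(1)])
  qed
  have km[measurable]: "k \<in> borel_measurable borel"
    using k(2) by (rule borel_measurable_continuous_onI)
  have XU: "(\<integral>x. ?S (X \<theta>) x * ?S U x \<partial>lborel) = overlap k \<theta>" for \<theta>
  proof -
    let ?K = "\<lambda>p. k (cos \<theta> * fst p + sin \<theta> * snd p) * k (cos \<theta> * snd p - sin \<theta> * fst p)"
    let ?Q = "cbox (- alpha, - alpha) (alpha, alpha)"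
    have [measurable]: "outer k \<in> borel_measurable borel"
      unfolding outer_def case_prod_beta borel_prod[symmetric] by measurable
    have "(\<integral>x. ?S (X \<theta>) x * ?S U x \<partial>lborel) = (\<integral>y. X \<theta> y * outer k y \<partial>lborel)"
      unfolding SSU[symmetric] by (rule G.smooth_self_adjoint(2)[OF Xi SUm SUb])
    also have "\<dots> = (\<integral>y. X_nat (rot \<theta> y) * outer k (rot (- \<theta>) (rot \<theta> y)) \<partial>lborel)"
      by (simp add: X_def rot_add)
    also have "\<dots> = (\<integral>y. X_nat y * outer k (rot (- \<theta>) y) \<partial>lborel)"
      by (rule integral_rot) measurable
    also have "\<dots> = (\<integral>y. indicator ?Q y *\<^sub>R ?K y \<partial>lborel)"
      by (rule Bochner_Integration.integral_cong) (auto simp: X_nat_indicator outer_def rot_def split_beta)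
    also have "\<dots> = integral ?Q ?K"
    proof -
      have "continuous_on ?Q ?K"
        by (intro continuous_intros continuous_on_compose2[OF k(2)]) auto
      then have "set_integrable lborel ?Q ?K"
        unfolding set_integrable_def by (intro borel_integrable_compact compact_cbox)
      from set_borel_integral_eq_integral(2)[OF this] show ?thesis
        unfolding set_lebesgue_integral_def .
    qed
    finally show ?thesis unfolding overlap_def .
  qed
  have "loss \<sigma> \<nu> u = (1/2 * (\<integral>x. ?S X_nat x * ?S X_nat x \<partial>lborel)
      + 1/2 * (\<integral>x. ?S U x * ?S U x \<partial>lborel)) - overlap k (\<nu> - nu_nat)" for \<nu>
  proof -
    let ?X = "X (\<nu> - nu_nat)"
    have "loss \<sigma> \<nu> u = 1/2 * (sqrt (\<integral>x. (?S (\<lambda>x. ?X x - U x) x)\<^sup>2 \<partial>lborel))\<^sup>2"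
      by (simp add: loss_def L2norm2_def conv2_eq_smooth X_def U_def)
    also have "\<dots> = 1/2 * (\<integral>x. (?S (\<lambda>x. ?X x - U x) x)\<^sup>2 \<partial>lborel)"
      by simp
    also have "(\<integral>x. (?S (\<lambda>x. ?X x - U x) x)\<^sup>2 \<partial>lborel)
        = (\<integral>x. ?S ?X x * ?S ?X x + ?S U x * ?S U x - 2 * (?S ?X x * ?S U x) \<partial>lborel)"
      unfolding G.smooth_diff[OF Xm Xb Um Ub]
      by (intro Bochner_Integration.integral_cong) (auto simp: power2_eq_square algebra_simps)
    also have "\<dots> = (\<integral>x. ?S X_nat x * ?S X_nat x \<partial>lborel) + (\<integral>x. ?S U x * ?S U x \<partial>lborel) - 2 * overlap k (\<nu> - nu_nat)"
      using iXX iUU iXU by (simp add: XX XU)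
    finally show ?thesis by simp
  qed
  then show ?thesis by blast
qed

subsection \<open>The derivative of the loss as a boundary integral\<close>

text \<open>The derivative of \<open>overlap\<close>, hence minus the derivative of the loss: a
  moment over the side \<open>x = alpha\<close> with lever arm \<open>y\<close>. The factor 4 counts
  the sides, which contribute equally for even \<open>k\<close>. No derivative of \<open>k\<close>
  occurs, so errors of \<open>k\<close> in the sup norm are enough.\<close>

definition torque :: "(real \<Rightarrow> real) \<Rightarrow> real \<Rightarrow> real" where
  "torque k \<theta> = 4 * integral {- alpha..alpha}
     (\<lambda>y. y * (k (alpha * cos \<theta> + y * sin \<theta>) * k (y * cos \<theta> - alpha * sin \<theta>)))"

lemma alpha_bounds: "0 < alpha" "alpha * alpha = 1 / 2" "alpha \<le> 0.7072" "0.7 \<le> alpha"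
proof -
  show "0 < alpha" "alpha * alpha = 1 / 2" by (auto simp: alpha_def)
  show "alpha \<le> 0.7072"
    by (rule power2_le_imp_le) (auto simp: alpha_def power_divide power2_eq_square[of "884 :: real"] power2_eq_square[of "442 :: real"] power2_eq_square)
  show "0.7 \<le> alpha"
    by (rule power2_le_imp_le) (auto simp: alpha_def power_divide power2_eq_square)
qed

lemma continuous_torque:
  assumes "continuous_on UNIV k"
  shows "continuous_on UNIV (torque k)"
proof -
  have "continuous_on UNIV (\<lambda>\<theta>. integral (cbox (- alpha) alpha)
     (\<lambda>y. y * (k (alpha * cos \<theta> + y * sin \<theta>) * k (y * cos \<theta> - alpha * sin \<theta>))))"
    by (rule integral_continuous_on_param)
       (auto simp: split_beta intro!: continuous_intros continuous_on_compose2[OF assms])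
  then show ?thesis unfolding torque_def by (auto intro!: continuous_intros)
qed

text \<open>The angular derivative pairs the gradient of the rotated product with the rotation field
  \<open>(y, - x)\<close>. This field is free of divergence, so only boundary terms remain.\<close>

lemma has_derivative_overlap:
  assumes k: "\<And>x. (k has_real_derivative k' x) (at x)" and k': "continuous_on UNIV k'"
    and ev: "\<And>x. k (- x) = k x"
  shows "(overlap k has_real_derivative torque k \<theta>) (at \<theta>)"
proof -
  let ?Q = "cbox (- alpha, - alpha) (alpha, alpha)"
  have kc: "continuous_on UNIV k" using k by (meson DERIV_isCont continuous_at_imp_continuous_on)
  note ck = continuous_on_compose2[OF kc] continuous_on_compose2[OF k']
  have kD: "((\<lambda>x. k (f x)) has_real_derivative (k' (f x) * f')) (at x within S)"
    if "(f has_real_derivative f') (at x within S)" for f f' x S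
    using DERIV_chain2[OF k that] .
  let ?P = "\<lambda>\<theta> p. cos \<theta> * fst p + sin \<theta> * snd p :: real"
  let ?R = "\<lambda>\<theta> p. cos \<theta> * snd p - sin \<theta> * fst p :: real"
  let ?fx = "\<lambda>\<theta> p. k' (?P \<theta> p) * ?R \<theta> p * k (?R \<theta> p) - k (?P \<theta> p) * (k' (?R \<theta> p) * ?P \<theta> p)"
  have 1: "(overlap k has_real_derivative integral ?Q (?fx \<theta>)) (at \<theta> within UNIV)"
    unfolding overlap_def
  proof (rule leibniz_rule_field_derivative)
    show "continuous_on (UNIV \<times> ?Q) (\<lambda>(\<theta>, p). ?fx \<theta> p)"
      unfolding split_beta by (intro continuous_intros ck) auto
    show "(\<lambda>p. k (?P \<theta> p) * k (?R \<theta> p)) integrable_on ?Q" for \<theta>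
      by (intro integrable_continuous continuous_intros ck) auto
    show "((\<lambda>\<theta>. k (?P \<theta> p) * k (?R \<theta> p)) has_real_derivative ?fx \<theta> p) (at \<theta> within UNIV)" for \<theta> p
      by (auto intro!: derivative_eq_intros kD simp: algebra_simps)
  qed auto
  define c s where "c = cos \<theta>" and "s = sin \<theta>"
  let ?F = "\<lambda>x y. k (c * x + s * y) * k (c * y - s * x)"
  let ?F1 = "\<lambda>x y. y * (c * k' (c * x + s * y) * k (c * y - s * x) - s * (k (c * x + s * y) * k' (c * y - s * x)))"
  let ?F2 = "\<lambda>x y. x * (s * k' (c * x + s * y) * k (c * y - s * x) + c * (k (c * x + s * y) * k' (c * y - s * x)))"
  have c1: "continuous_on ?Q (\<lambda>(x, y). ?F1 x y)" and c2: "continuous_on ?Q (\<lambda>(x, y). ?F2 x y)"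
    unfolding split_beta by (intro continuous_intros ck; auto)+
  \<comment> \<open>\<open>?F1\<close> is \<open>y\<close> times the \<open>x\<close>-derivative of
    \<open>?F\<close>, and \<open>?F2\<close> is \<open>x\<close> times its
    \<open>y\<close>-derivative. Each integrates in closed form along its own coordinate.\<close>
  have "?fx \<theta> = (\<lambda>p. (\<lambda>(x, y). ?F1 x y) p - (\<lambda>(x, y). ?F2 x y) p)"
    by (auto simp: c_def s_def fun_eq_iff algebra_simps)
  then have "integral ?Q (?fx \<theta>) = integral ?Q (\<lambda>(x, y). ?F1 x y) - integral ?Q (\<lambda>(x, y). ?F2 x y)"
    using integral_diff[OF integrable_continuous[OF c1] integrable_continuous[OF c2]] by simp
  also have "integral ?Q (\<lambda>(x, y). ?F1 x y) = integral {-alpha..alpha} (\<lambda>y. y * (?F alpha y - ?F (- alpha) y))"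
  proof -
    have I: "integral {-alpha..alpha} (\<lambda>x. ?F1 x y) = y * (?F alpha y - ?F (- alpha) y)" for y
    proof -
      have "((\<lambda>x. ?F1 x y) has_integral y * ?F alpha y - y * ?F (- alpha) y) {-alpha..alpha}"
        by (rule fundamental_theorem_of_calculus)
           (use alpha_bounds in \<open>auto intro!: derivative_eq_intros kD
              simp: has_real_derivative_iff_has_vector_derivative[symmetric] algebra_simps\<close>)
      from integral_unique[OF this] show ?thesis by (simp only: right_diff_distrib)
    qed
    have "integral ?Q (\<lambda>(x, y). ?F1 x y)
        = integral (cbox (-alpha) alpha) (\<lambda>x. integral (cbox (-alpha) alpha) (\<lambda>y. ?F1 x y))"
      using integral_prod_continuous[OF c1] by (simp only: prod.case)
    also have "\<dots> = integral (cbox (-alpha) alpha) (\<lambda>y. integral (cbox (-alpha) alpha) (\<lambda>x. ?F1 x y))"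
      by (rule integral_swap_continuous[OF c1])
    finally show ?thesis unfolding cbox_interval I .
  qed
  also have "integral ?Q (\<lambda>(x, y). ?F2 x y) = integral {-alpha..alpha} (\<lambda>x. x * (?F x alpha - ?F x (- alpha)))"
  proof -
    have I: "integral {-alpha..alpha} (\<lambda>y. ?F2 x y) = x * (?F x alpha - ?F x (- alpha))" for x
    proof -
      have "((\<lambda>y. ?F2 x y) has_integral x * ?F x alpha - x * ?F x (- alpha)) {-alpha..alpha}"
        by (rule fundamental_theorem_of_calculus)
           (use alpha_bounds in \<open>auto intro!: derivative_eq_intros kD
              simp: has_real_derivative_iff_has_vector_derivative[symmetric] algebra_simps\<close>)
      from integral_unique[OF this] show ?thesis by (simp only: right_diff_distrib)
    qed
    show ?thesis using integral_prod_continuous[OF c2] unfolding prod.case cbox_interval I .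
  qed
  finally have 2: "integral ?Q (?fx \<theta>) = integral {-alpha..alpha} (\<lambda>y. y * (?F alpha y - ?F (- alpha) y))
    - integral {-alpha..alpha} (\<lambda>x. x * (?F x alpha - ?F x (- alpha)))" .
  \<comment> \<open>Since \<open>k\<close> is even, a quarter turn preserves \<open>?F\<close>. All
    four sides therefore carry \<open>g\<close>, up to reflection of the parameter.\<close>
  define g where "g y = k (c * alpha + s * y) * k (c * y - s * alpha)" for y
  have gc: "continuous_on UNIV g" unfolding g_def by (intro continuous_intros ck) auto
  have e1: "?F (- alpha) y = g (- y)" for y
  proof -
    have a: "c * - alpha + s * y = - (c * alpha + s * - y)" "c * y - s * - alpha = - (c * - y - s * alpha)"
      by simp_all
    show ?thesis unfolding g_def a ev ..
  qed
  have e2: "?F x alpha = g (- x)" for x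
  proof -
    have a: "c * - x - s * alpha = - (c * x + s * alpha)" "c * alpha + s * - x = c * alpha - s * x"
      by simp_all
    show ?thesis unfolding g_def a ev by (rule mult.commute)
  qed
  have e3: "?F x (- alpha) = g x" for x
  proof -
    have a: "c * - alpha - s * x = - (c * alpha + s * x)" "c * x + s * - alpha = c * x - s * alpha"
      by simp_all
    show ?thesis unfolding g_def a ev by (rule mult.commute)
  qed
  have i: "(\<lambda>y. y * g y) integrable_on {-alpha..alpha}" "(\<lambda>y. y * g (- y)) integrable_on {-alpha..alpha}"
    by (intro integrable_continuous_real continuous_intros continuous_on_compose2[OF gc]; auto)+
  have r: "integral {-alpha..alpha} (\<lambda>y. y * g (- y)) = - integral {-alpha..alpha} (\<lambda>y. y * g y)"
    using Henstock_Kurzweil_Integration.integral_reflect_real[of alpha "- alpha" "\<lambda>y. - (y * g y)"] by simp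
  have "integral ?Q (?fx \<theta>) = integral {-alpha..alpha} (\<lambda>y. y * g y - y * g (- y))
     - integral {-alpha..alpha} (\<lambda>y. y * g (- y) - y * g y)"
    unfolding 2 e1 e2 e3 by (simp add: g_def right_diff_distrib)
  also have "\<dots> = 4 * integral {-alpha..alpha} (\<lambda>y. y * g y)"
    using i by (simp add: Henstock_Kurzweil_Integration.integral_diff r)
  also have "\<dots> = torque k \<theta>"
    by (simp add: torque_def g_def c_def s_def mult.commute)
  finally show ?thesis using 1 by simp
qed

text \<open>All the differentiability comes from the Gaussian factor. The support of
  \<open>u\<close> reduces the integral to a compact interval, where differentiation under the
  integral sign applies.\<close>

lemma smooth_normal_C1:
  assumes u: "continuous_on UNIV u" "\<And>x. 1 < \<bar>x\<bar> \<Longrightarrow> u x = 0" and "0 < \<tau>"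
  obtains k' where "\<And>x. (smooth (normal_density 0 \<tau>) u has_real_derivative k' x) (at x)" "continuous_on UNIV k'"
proof -
  let ?n = "normal_density 0 \<tau>"
  let ?n' = "\<lambda>x. - x / \<tau>\<^sup>2 * ?n x"
  have nd: "(?n has_real_derivative ?n' x) (at x)" for x
    unfolding normal_density_def using assms(3)
    by (auto intro!: derivative_eq_intros simp: field_simps power2_eq_square)
  have nc: "continuous_on UNIV ?n" using nd by (meson DERIV_isCont continuous_at_imp_continuous_on)
  have nc': "continuous_on UNIV ?n'" using assms(3) by (intro continuous_intros nc) auto
  note cc = continuous_on_compose2[OF nc] continuous_on_compose2[OF nc'] continuous_on_compose2[OF u(1)]
  have eq: "smooth ?n u = (\<lambda>x. integral (cbox (-1) 1) (\<lambda>z. ?n (x - z) * u z))"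
  proof
    fix x
    have "(\<integral>z. ?n (x - z) * u z \<partial>lborel) = integral {-1..1} (\<lambda>z. ?n (x - z) * u z)"
      by (rule integral_supported) (auto intro!: continuous_intros cc simp: u)
    then show "smooth ?n u x = integral (cbox (-1) 1) (\<lambda>z. ?n (x - z) * u z)"
      by (simp add: smooth_def)
  qed
  show ?thesis
  proof
    show "continuous_on UNIV (\<lambda>x. integral (cbox (-1) 1) (\<lambda>z. ?n' (x - z) * u z))"
      by (rule integral_continuous_on_param) (unfold split_beta, intro continuous_intros cc, auto)
    fix x
    have "((\<lambda>x. integral (cbox (-1) 1) (\<lambda>z. ?n (x - z) * u z)) has_real_derivative
        integral (cbox (-1) 1) (\<lambda>z. ?n' (x - z) * u z)) (at x within UNIV)"
    proof (rule leibniz_rule_field_derivative)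
      show "continuous_on (UNIV \<times> cbox (-1) 1) (\<lambda>(x, z). ?n' (x - z) * u z)"
        unfolding split_beta by (intro continuous_intros cc; auto)
      show "(\<lambda>z. ?n (x - z) * u z) integrable_on cbox (- 1) 1" for x
        by (intro integrable_continuous continuous_intros cc) auto
      show "((\<lambda>x. ?n (x - z) * u z) has_real_derivative ?n' (x - z) * u z) (at x within UNIV)" for x z
      proof -
        have "((\<lambda>x. ?n (x - z)) has_real_derivative ?n' (x - z) * 1) (at x within UNIV)"
          by (rule DERIV_chain2[OF nd]) (auto intro!: derivative_eq_intros)
        then show ?thesis using DERIV_cmult_right by fastforce
      qed
    qed auto
    then show "(smooth ?n u has_real_derivative integral (cbox (-1) 1) (\<lambda>z. ?n' (x - z) * u z)) (at x)"
      unfolding eq by simp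
  qed
qed

lemma smooth_normal_alt:
  "smooth (normal_density 0 \<tau>) f s = (\<integral>z. normal_density 0 \<tau> z * f (s - z) \<partial>lborel)"
  unfolding smooth_def
  by (subst lborel_integral_real_affine[of "-1" _ s]) simp_all

lemma smooth_normal_even:
  assumes "\<And>x. f (- x) = f x"
  shows "smooth (normal_density 0 \<tau>) f (- s) = smooth (normal_density 0 \<tau>) f s"
proof -
  have "f (s + z) = f (- s - z)" for z using assms[of "s + z"] by simp
  then show ?thesis unfolding smooth_normal_alt
    by (subst lborel_integral_real_affine[of "-1" _ 0]) (simp_all add: normal_density_def)
qed

text \<open>With this sign a gradient step adds \<open>\<beta> * torque\<close> to the angle, so
  convergence means that the torque pulls the offset from \<open>nu_nat\<close> back to
  zero.\<close>

lemma deriv_loss: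
  assumes \<sigma>: "0 < \<sigma>" and u: "continuous_on UNIV u" "\<And>x. 1 < \<bar>x\<bar> \<Longrightarrow> u x = 0" "\<And>x. u (- x) = u x"
    "\<And>x. \<bar>u x\<bar> \<le> B"
  defines "k \<equiv> smooth (normal_density 0 (sqrt 2 * \<sigma>)) u"
  shows "deriv (\<lambda>v. loss \<sigma> v u) \<nu> = - torque k (\<nu> - nu_nat)" "continuous_on UNIV k"
proof -
  have \<tau>: "0 < sqrt 2 * \<sigma>" using \<sigma> by simp
  obtain k' where k': "\<And>x. (k has_real_derivative k' x) (at x)" "continuous_on UNIV k'"
    using smooth_normal_C1[OF u(1,2) \<tau>] unfolding k_def by blast
  then show kc: "continuous_on UNIV k" by (meson DERIV_isCont continuous_at_imp_continuous_on)
  have ui: "integrable lborel u" by (rule integral_supported(1)[OF u(1,2)])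
  have ev: "k (- x) = k x" for x unfolding k_def by (rule smooth_normal_even) (rule u)
  obtain C where C: "\<And>\<nu>. loss \<sigma> \<nu> u = C - overlap k (\<nu> - nu_nat)"
    using loss_eq_overlap[OF \<sigma> ui u(4) k_def[THEN meta_eq_to_obj_eq] kc] by blast
  have "((\<lambda>v. overlap k (v - nu_nat)) has_real_derivative torque k (\<nu> - nu_nat) * 1) (at \<nu>)"
    by (rule DERIV_chain2[OF has_derivative_overlap[OF k' ev]]) (auto intro!: derivative_eq_intros)
  from DERIV_diff[OF DERIV_const this, of C]
  have "((\<lambda>v. C - overlap k (v - nu_nat)) has_real_derivative - torque k (\<nu> - nu_nat)) (at \<nu>)"
    by simp
  then show "deriv (\<lambda>v. loss \<sigma> v u) \<nu> = - torque k (\<nu> - nu_nat)"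
    unfolding C by (rule DERIV_imp_deriv)
qed

subsection \<open>The torque of the unsmoothed cosine\<close>

lemma nonneg_by_derivative:
  fixes f f' :: "real \<Rightarrow> real"
  assumes "0 \<le> x" "0 \<le> f 0" and "\<And>t. (f has_real_derivative f' t) (at t)"
    and "\<And>t. 0 \<le> t \<Longrightarrow> t \<le> x \<Longrightarrow> 0 \<le> f' t"
  shows "0 \<le> f x"
  using DERIV_nonneg_imp_nondecreasing[OF assms(1), of f] assms by force

lemma cos_ge_taylor2: "0 \<le> x \<Longrightarrow> 1 - x\<^sup>2 / 2 \<le> cos x" for x :: real
  using nonneg_by_derivative[of x "\<lambda>x. cos x - (1 - x\<^sup>2 / 2)" "\<lambda>x. x - sin x"]
  by (force intro!: derivative_eq_intros sin_x_le_x)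

lemma cos_ge_quadratic: "1 - x\<^sup>2 / 2 \<le> cos x" for x :: real
  using cos_ge_taylor2[of "\<bar>x\<bar>"] by simp

lemma sin_ge_taylor3: "0 \<le> x \<Longrightarrow> x - x ^ 3 / 6 \<le> sin x" for x :: real
  using nonneg_by_derivative[of x "\<lambda>x. sin x - (x - x ^ 3 / 6)" "\<lambda>x. cos x - (1 - x\<^sup>2 / 2)"] cos_ge_taylor2
  by (force intro!: derivative_eq_intros)

lemma cos_le_taylor4: "0 \<le> x \<Longrightarrow> cos x \<le> 1 - x\<^sup>2 / 2 + x ^ 4 / 24" for x :: real
  using nonneg_by_derivative[of x "\<lambda>x. 1 - x\<^sup>2 / 2 + x ^ 4 / 24 - cos x" "\<lambda>x. sin x - (x - x ^ 3 / 6)"] sin_ge_taylor3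
  by (force intro!: derivative_eq_intros)

lemma sin_le_taylor5: "0 \<le> x \<Longrightarrow> sin x \<le> x - x ^ 3 / 6 + x ^ 5 / 120" for x :: real
  using nonneg_by_derivative[of x "\<lambda>x. x - x ^ 3 / 6 + x ^ 5 / 120 - sin x"
      "\<lambda>x. 1 - x\<^sup>2 / 2 + x ^ 4 / 24 - cos x"] cos_le_taylor4
  by (force intro!: derivative_eq_intros)

lemma cos_ge_taylor6: "0 \<le> x \<Longrightarrow> 1 - x\<^sup>2 / 2 + x ^ 4 / 24 - x ^ 6 / 720 \<le> cos x" for x :: real
  using nonneg_by_derivative[of x "\<lambda>x. cos x - (1 - x\<^sup>2 / 2 + x ^ 4 / 24 - x ^ 6 / 720)"
      "\<lambda>x. x - x ^ 3 / 6 + x ^ 5 / 120 - sin x"] sin_le_taylor5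
  by (force intro!: derivative_eq_intros)

lemma sin_ge_jordan:
  assumes "0 \<le> b" "b \<le> pi / 2" shows "2 / pi * b \<le> sin b"
proof -
  have "hwidth (1 - 2 / pi * b) = 2 / pi * b" using assms by (simp add: hwidth_def field_simps)
  then show ?thesis using hwidth_le_cosine[of "1 - 2 / pi * b"] by (simp add: cosine_def)
qed

lemma sin_minus_b_cos: "0 \<le> b \<Longrightarrow> b ^ 3 / 3 - b ^ 5 / 30 \<le> sin b - b * cos b" for b :: real
proof -
  assume b: "0 \<le> b"
  have "0 \<le> sin b - b * cos b - (b ^ 3 / 3 - b ^ 5 / 30)"
  proof (rule nonneg_by_derivative[OF b, where f' = "\<lambda>b. b * (sin b - (b - b ^ 3 / 6))"])
    show "((\<lambda>b. sin b - b * cos b - (b ^ 3 / 3 - b ^ 5 / 30)) has_real_derivative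
        t * (sin t - (t - t ^ 3 / 6))) (at t)" for t
      by (auto intro!: derivative_eq_intros simp: field_simps power_numeral_reduce)
    show "0 \<le> t * (sin t - (t - t ^ 3 / 6))" if "0 \<le> t" for t :: real
      using sin_ge_taylor3[OF that] that by (intro mult_nonneg_nonneg) auto
  qed simp
  then show ?thesis by simp
qed

text \<open>The difference of the two sides is the derivative of
  \<open>1 / b\<^sup>2 - cot b / b - b\<^sup>2 / 45\<close> multiplied by
  \<open>b ^ 3 * (sin b)\<^sup>2\<close>. A polynomial is inserted between the sides.\<close>

lemma cot_numerator_bound:
  fixes b :: real
  assumes b: "0 \<le> b" "b \<le> pi / 2"
  shows "2 / 45 * b ^ 4 * (sin b)\<^sup>2 \<le> b\<^sup>2 + b * sin b * cos b - 2 * (sin b)\<^sup>2"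
proof -
  have b2: "b\<^sup>2 \<le> 2.5" if "0 \<le> b" "b \<le> pi / 2" for b :: real
  proof -
    have "b \<le> 1.571" using that pi_approx by simp
    then have "b\<^sup>2 \<le> 1.571\<^sup>2" using that by (intro power_mono) auto
    then show ?thesis by (simp add: power2_eq_square)
  qed
  \<comment> \<open>The subtracted polynomial is the Taylor polynomial of order 8 of the right-hand
    side. \<open>?Q1\<close> and \<open>?Q2\<close> are the first and second derivatives of
    \<open>?Q\<close>.\<close>
  let ?Q = "\<lambda>b::real. b\<^sup>2 + b * sin b * cos b - 2 * (sin b)\<^sup>2 - (2 / 45 * b ^ 6 - 2 / 315 * b ^ 8)"
  let ?Q1 = "\<lambda>b::real. 2 * b + b * ((cos b)\<^sup>2 - (sin b)\<^sup>2) - 3 * sin b * cos b - (12 / 45 * b ^ 5 - 16 / 315 * b ^ 7)"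
  let ?Q2 = "\<lambda>b::real. 4 * (sin b * (sin b - b * cos b)) - (4 / 3 * b ^ 4 - 16 / 45 * b ^ 6)"
  have sc: "(cos t)\<^sup>2 = 1 - (sin t)\<^sup>2" for t :: real by (rule cos_squared_eq)
  have Q1: "0 \<le> ?Q1 t" if t: "0 \<le> t" "t \<le> pi / 2" for t
  proof (rule nonneg_by_derivative[OF t(1), where f' = ?Q2])
    show "(?Q1 has_real_derivative ?Q2 x) (at x)" for x
    proof -
      have "(?Q1 has_real_derivative 2 + ((cos x)\<^sup>2 - (sin x)\<^sup>2) + x * (- 4 * sin x * cos x)
          - 3 * ((cos x)\<^sup>2 - (sin x)\<^sup>2) - (60 / 45 * x ^ 4 - 112 / 315 * x ^ 6)) (at x)"
        by (auto intro!: derivative_eq_intros simp: algebra_simps power2_eq_square)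
      moreover have "2 + ((cos x)\<^sup>2 - (sin x)\<^sup>2) + x * (- 4 * sin x * cos x)
          - 3 * ((cos x)\<^sup>2 - (sin x)\<^sup>2) - (60 / 45 * x ^ 4 - 112 / 315 * x ^ 6) = ?Q2 x"
        unfolding sc by (simp add: algebra_simps power2_eq_square)
      ultimately show ?thesis by (rule DERIV_cong)
    qed
    fix x assume "0 \<le> x" "x \<le> t"
    then have x: "0 \<le> x" "x \<le> pi / 2" using t by auto
    have x2: "x\<^sup>2 \<le> 2.5" using b2[OF x] .
    have p: "0 \<le> x - x ^ 3 / 6" "0 \<le> x ^ 3 / 3 - x ^ 5 / 30"
    proof -
      have "x - x ^ 3 / 6 = x * (1 - x\<^sup>2 / 6)" "x ^ 3 / 3 - x ^ 5 / 30 = x ^ 3 * (1 / 3 - x\<^sup>2 / 30)"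
        by (simp_all add: algebra_simps power_numeral_reduce)
      then show "0 \<le> x - x ^ 3 / 6" "0 \<le> x ^ 3 / 3 - x ^ 5 / 30" using x x2 by auto
    qed
    have "(x - x ^ 3 / 6) * (x ^ 3 / 3 - x ^ 5 / 30) \<le> sin x * (sin x - x * cos x)"
      using sin_ge_taylor3[OF x(1)] sin_minus_b_cos[OF x(1)] p by (intro mult_mono) auto
    moreover have "(x - x ^ 3 / 6) * (x ^ 3 / 3 - x ^ 5 / 30) = x ^ 4 / 3 - 4 / 45 * x ^ 6 + x ^ 8 / 180"
      by (simp add: field_simps power_numeral_reduce)
    moreover have "0 \<le> x ^ 8 / 180" by simp
    ultimately show "0 \<le> ?Q2 x" by linarith
  qed simp
  have "0 \<le> ?Q b"
  proof (rule nonneg_by_derivative[OF b(1), where f' = ?Q1])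
    show "(?Q has_real_derivative ?Q1 x) (at x)" for x
      by (auto intro!: derivative_eq_intros simp: algebra_simps power2_eq_square)
    show "0 \<le> ?Q1 t" if "0 \<le> t" "t \<le> b" for t using Q1[of t] that b by auto
  qed simp
  moreover have "2 / 45 * b ^ 4 * (sin b)\<^sup>2 \<le> 2 / 45 * b ^ 6 - 2 / 315 * b ^ 8"
  proof -
    have "1 - (2 * b)\<^sup>2 / 2 + (2 * b) ^ 4 / 24 - (2 * b) ^ 6 / 720 \<le> 1 - 2 * (sin b)\<^sup>2"
      using cos_ge_taylor6[of "2 * b"] b cos_double_sin[of b] by simp
    then have "(sin b)\<^sup>2 \<le> b\<^sup>2 - b ^ 4 / 3 + 2 / 45 * b ^ 6"
      by (simp add: power_mult_distrib)
    \<comment> \<open>The coefficient \<open>1 / 7\<close> is chosen so that multiplication by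
      \<open>2 / 45 * b ^ 4\<close> reproduces exactly the polynomial in \<open>?Q\<close>.\<close>
    also have "\<dots> \<le> b\<^sup>2 - b ^ 4 / 7"
    proof -
      have "b ^ 4 * b\<^sup>2 \<le> b ^ 4 * 2.5" using b2[OF b] by (intro mult_left_mono) auto
      moreover have "b ^ 6 = b ^ 4 * b\<^sup>2" by (simp add: power_add[symmetric])
      moreover have "0 \<le> b ^ 4" by simp
      ultimately show ?thesis by linarith
    qed
    finally have "2 / 45 * b ^ 4 * (sin b)\<^sup>2 \<le> 2 / 45 * b ^ 4 * (b\<^sup>2 - b ^ 4 / 7)"
      by (intro mult_left_mono) auto
    also have "\<dots> = 2 / 45 * b ^ 6 - 2 / 315 * b ^ 8"
    proof -
      have p: "b ^ 6 = b ^ 4 * b\<^sup>2" "b ^ 8 = b ^ 4 * b ^ 4" by (simp_all add: power_add[symmetric])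
      show ?thesis unfolding p by (simp add: field_simps)
    qed
    finally show ?thesis .
  qed
  ultimately show ?thesis by linarith
qed

text \<open>The expansion \<open>1 / b\<^sup>2 - cot b / b = 1 / 3 + b\<^sup>2 / 45 + ...\<close>
  explains the constant. What is left after subtracting \<open>b\<^sup>2 / 45\<close> is
  nondecreasing.\<close>

lemma cot_difference_bound:
  assumes "0 < b2" "b2 \<le> b1" "b1 \<le> pi / 2"
  shows "(b1\<^sup>2 - b2\<^sup>2) / 45 \<le>
    (1 / b1\<^sup>2 - cos b1 / (b1 * sin b1)) - (1 / b2\<^sup>2 - cos b2 / (b2 * sin b2))"
proof -
  let ?g = "\<lambda>b. 1 / b\<^sup>2 - cos b / (b * sin b) - b\<^sup>2 / 45"
  let ?g' = "\<lambda>b. (b\<^sup>2 + b * sin b * cos b - 2 * (sin b)\<^sup>2 - 2 / 45 * b ^ 4 * (sin b)\<^sup>2) / (b ^ 3 * (sin b)\<^sup>2)"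
  have "?g b2 \<le> ?g b1"
  proof (rule DERIV_nonneg_imp_nondecreasing[OF assms(2)])
    fix x assume x: "b2 \<le> x" "x \<le> b1"
    then have x0: "0 < x" "x \<le> pi / 2" using assms by auto
    have s0: "0 < sin x" using x0 by (intro sin_gt_zero) auto
    have dA: "(?g has_real_derivative - 2 / x ^ 3 + (x + sin x * cos x) / (x\<^sup>2 * (sin x)\<^sup>2) - 2 * x / 45) (at x)"
    proof -
      have A: "(?g has_real_derivative (0 * x\<^sup>2 - 1 * (2 * x)) / (x\<^sup>2 * x\<^sup>2)
          - ((- sin x) * (x * sin x) - cos x * (1 * sin x + cos x * x)) / ((x * sin x) * (x * sin x)) - 2 * x / 45) (at x)"
        using x0 s0 by (auto intro!: derivative_eq_intros)
      have B: "(0 * x\<^sup>2 - 1 * (2 * x)) / (x\<^sup>2 * x\<^sup>2) = - 2 / x ^ 3"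
        using x0 by (simp add: field_simps power_numeral_reduce)
      have C: "(- sin x) * (x * sin x) - cos x * (1 * sin x + cos x * x) = - (x + sin x * cos x)"
      proof -
        have "x * (cos x * cos x) + x * (sin x * sin x) = x" by (simp flip: distrib_left)
        then show ?thesis by (simp add: algebra_simps)
      qed
      have D: "(x * sin x) * (x * sin x) = x\<^sup>2 * (sin x)\<^sup>2" by (simp add: power2_eq_square)
      show ?thesis by (rule DERIV_cong[OF A]) (unfold B C D, simp only: minus_divide_left[symmetric] diff_minus_eq_add)
    qed
    have dE: "- 2 / x ^ 3 + (x + sin x * cos x) / (x\<^sup>2 * (sin x)\<^sup>2) - 2 * x / 45 = ?g' x"
      using x0 s0 by (simp add: field_simps power_numeral_reduce)
    have dN: "0 \<le> ?g' x"
      using cot_numerator_bound[of x] x0 s0 by (intro divide_nonneg_pos) auto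
    show "\<exists>y. (?g has_real_derivative y) (at x) \<and> 0 \<le> y"
      by (intro exI conjI, rule DERIV_cong[OF dA dE], rule dN)
  qed
  then show ?thesis unfolding diff_divide_distrib by linarith
qed

section \<open>Exact evaluation and lower bound for the torque of the cosine\<close>

lemma integral_x_cos:
  assumes "b \<noteq> 0"
  shows "((\<lambda>x. x * cos (a + b * x)) has_integral (2 * sin a * cos b / b - 2 * sin a * sin b / b\<^sup>2)) {-1..1::real}"
proof -
  let ?G = "\<lambda>x. x * sin (a + b * x) / b + cos (a + b * x) / b\<^sup>2"
  have "((\<lambda>x. x * cos (a + b * x)) has_integral (?G 1 - ?G (-1))) {-1..1::real}"
    by (rule fundamental_theorem_of_calculus)
       (use assms in \<open>auto intro!: derivative_eq_intros
          simp: has_real_derivative_iff_has_vector_derivative[symmetric] field_simps power2_eq_square\<close>)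
  moreover have "?G 1 - ?G (-1) = 2 * sin a * cos b / b - 2 * sin a * sin b / b\<^sup>2"
    by (simp add: sin_add sin_diff cos_add cos_diff) (simp add: add_divide_distrib diff_divide_distrib mult_ac)
  ultimately show ?thesis by simp
qed

text \<open>The product of cosines splits into two waves in \<open>x = y / alpha\<close>, one with
  frequency \<open>b1\<close> and phase \<open>b2\<close>, the other with the roles exchanged and
  the sign of the frequency reversed. Their moments combine into a difference of values of one
  function, which vanishes at \<open>\<theta> = 0\<close> where \<open>b1 = b2\<close>.\<close>

lemma torque_cos:
  assumes "0 < cos \<theta> - sin \<theta>" "0 < cos \<theta> + sin \<theta>"
  defines "b1 \<equiv> pi / 2 * alpha * (cos \<theta> + sin \<theta>)" and "b2 \<equiv> pi / 2 * alpha * (cos \<theta> - sin \<theta>)"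
  shows "torque (\<lambda>x. cos (pi / 2 * x)) \<theta> = - 2 * sin b1 * sin b2 *
    ((1 / b1\<^sup>2 - cos b1 / (b1 * sin b1)) - (1 / b2\<^sup>2 - cos b2 / (b2 * sin b2)))"
proof -
  let ?f = "\<lambda>y. y * (cos (pi / 2 * (alpha * cos \<theta> + y * sin \<theta>)) * cos (pi / 2 * (y * cos \<theta> - alpha * sin \<theta>)))"
  have b: "0 < b1" "0 < b2" using assms(1,2) alpha_bounds(1) by (auto simp: b1_def b2_def)
  have bpi: "b1 < pi" "b2 < pi"
  proof -
    have *: "pi / 2 * alpha * x < pi" if "x \<le> 2" for x
    proof -
      have "alpha * x \<le> alpha * 2" using that alpha_bounds(1) by (intro mult_left_mono) auto
      also have "\<dots> < 2" using alpha_bounds(3) by simp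
      finally show ?thesis by simp
    qed
    have le: "cos \<theta> + sin \<theta> \<le> 2" "cos \<theta> - sin \<theta> \<le> 2"
      using sin_le_one[of \<theta>] cos_le_one[of \<theta>] sin_ge_minus_one[of \<theta>] by linarith+
    show "b1 < pi" "b2 < pi" unfolding b1_def b2_def by (rule *[OF le(1)], rule *[OF le(2)])
  qed
  have s: "sin b1 \<noteq> 0" "sin b2 \<noteq> 0" using sin_gt_zero[of b1] sin_gt_zero[of b2] b bpi by auto
  have "(?f has_integral integral {-alpha..alpha} ?f) (cbox (-alpha) alpha)"
    unfolding cbox_interval by (intro integrable_integral integrable_continuous_real continuous_intros)
  from has_integral_affinity[OF this, of alpha 0]
  have "((\<lambda>x. ?f (alpha * x)) has_integral (integral {-alpha..alpha} ?f / alpha)) ((\<lambda>x. x / alpha) ` cbox (-alpha) alpha)"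
    using alpha_bounds(1) by (simp add: field_simps)
  moreover have "(\<lambda>x. x / alpha) ` cbox (-alpha) alpha = {-1..1}"
    using alpha_bounds(1) by (simp add: image_divide_atLeastAtMost)
  ultimately have 1: "((\<lambda>x. ?f (alpha * x)) has_integral (integral {-alpha..alpha} ?f / alpha)) {-1..1}" by simp
  have eq: "?f (alpha * x) = alpha / 2 * (x * cos (b2 + b1 * x) + x * cos (b1 + (- b2) * x))" for x
  proof -
    have a1: "pi / 2 * (alpha * cos \<theta> + alpha * x * sin \<theta>) + pi / 2 * (alpha * x * cos \<theta> - alpha * sin \<theta>) = b2 + b1 * x"
      and a2: "pi / 2 * (alpha * cos \<theta> + alpha * x * sin \<theta>) - pi / 2 * (alpha * x * cos \<theta> - alpha * sin \<theta>) = b1 + (- b2) * x"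
      unfolding b1_def b2_def by (simp_all add: field_simps)
    show ?thesis unfolding cos_times_cos a1 a2 by (simp add: algebra_simps)
  qed
  let ?J1 = "2 * sin b2 * cos b1 / b1 - 2 * sin b2 * sin b1 / b1\<^sup>2"
  let ?J2 = "2 * sin b1 * cos (- b2) / (- b2) - 2 * sin b1 * sin (- b2) / (- b2)\<^sup>2"
  have "((\<lambda>x. ?f (alpha * x)) has_integral (alpha / 2 * (?J1 + ?J2))) {-1..1}"
    unfolding eq using b
    by (intro has_integral_mult_right has_integral_add integral_x_cos) auto
  from has_integral_unique[OF 1 this]
  have "integral {-alpha..alpha} ?f = alpha * (alpha / 2 * (?J1 + ?J2))"
    using alpha_bounds(1) by (simp add: field_simps)
  also have "\<dots> = (alpha * alpha) / 2 * (?J1 + ?J2)" by simp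
  also have "\<dots> = (?J1 + ?J2) / 4" unfolding alpha_bounds(2) by simp
  finally have "torque (\<lambda>x. cos (pi / 2 * x)) \<theta> = ?J1 + ?J2" by (simp add: torque_def)
  also have "\<dots> = - 2 * sin b1 * sin b2 *
    ((1 / b1\<^sup>2 - cos b1 / (b1 * sin b1)) - (1 / b2\<^sup>2 - cos b2 / (b2 * sin b2)))"
    using b s by (simp add: field_simps power2_eq_square)
  finally show ?thesis .
qed

text \<open>Chord of the concave sine from 0 to \<open>4 * pi / 7\<close>. Its slope in
  \<open>\<theta>\<close> is \<open>7 / pi * cos (pi / 14)\<close>, just above
  \<open>2.15\<close>.\<close>

lemma sin_4_ge: "0 \<le> \<theta> \<Longrightarrow> \<theta> \<le> pi / 7 \<Longrightarrow> 2.15 * \<theta> \<le> sin (4 * \<theta>)"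
proof -
  assume t: "0 \<le> \<theta>" "\<theta> \<le> pi / 7"
  have "concave_on {0..pi} sin"
    by (rule f''_le0_imp_concave[where f' = cos and f'' = "\<lambda>x. - sin x"])
       (auto intro!: derivative_eq_intros sin_ge_zero)
  from concave_onD[OF this, of "7 * \<theta> / pi" 0 "4 * pi / 7"]
  have 1: "7 * \<theta> / pi * sin (4 * pi / 7) \<le> sin (4 * \<theta>)" using t by (simp add: field_simps)
  have "sin (4 * pi / 7) = cos (pi / 14)"
    using cos_sin_eq[of "pi / 14"] sin_cos_eq[of "4 * pi / 7"] cos_minus[of "pi/14"] by (simp add: field_simps)
  moreover have "0.97 \<le> cos (pi / 14)"
  proof -
    have "pi / 14 \<le> 0.2245" using pi_approx by simp
    then have "(pi / 14)\<^sup>2 \<le> 0.2245\<^sup>2" by (intro power_mono) auto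
    then have "0.97 \<le> 1 - (pi / 14)\<^sup>2 / 2" by (simp add: power2_eq_square)
    also have "\<dots> \<le> cos (pi / 14)" by (rule cos_ge_taylor2) simp
    finally show ?thesis .
  qed
  ultimately have "7 * \<theta> / pi * 0.97 \<le> 7 * \<theta> / pi * sin (4 * pi / 7)"
    using t by (intro mult_left_mono) auto
  moreover have "2.15 * \<theta> \<le> 7 * \<theta> / pi * 0.97"
  proof -
    have "pi * 2.15 \<le> 7 * 0.97" using pi_approx by simp
    from mult_left_mono[OF this t(1)] show ?thesis by (simp add: field_simps)
  qed
  ultimately show ?thesis using 1 by linarith
qed

text \<open>Jordan's inequality gives \<open>sin b1 * sin b2 \<ge> cos (2 * \<theta>) / 2\<close>,
  and \<open>b1\<^sup>2 - b2\<^sup>2\<close> equals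
  \<open>pi\<^sup>2 / 4 * sin (2 * \<theta>)\<close>. The product is a multiple of
  \<open>sin (4 * \<theta>)\<close>, which degenerates at \<open>pi / 4\<close> but has a linear
  lower bound up to \<open>pi / 7\<close>.\<close>

lemma torque_cos_bound:
  assumes "0 \<le> \<theta>" "\<theta> \<le> pi / 7"
  shows "0.0588 * \<theta> \<le> - torque (\<lambda>x. cos (pi / 2 * x)) \<theta>"
proof -
  let ?c = "cos \<theta>" and ?s = "sin \<theta>"
  have t: "\<theta> < pi / 4" using assms pi_gt_zero by linarith
  have c: "0 < ?c" using assms t by (intro cos_gt_zero_pi) auto
  have s: "0 \<le> ?s" using assms t by (intro sin_ge_zero) auto
  have sc: "?s < ?c"
  proof -
    have "?s \<le> sin (pi / 4)" "cos (pi / 4) < ?c"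
      using assms t by (auto intro!: sin_monotone_2pi_le cos_monotone_0_pi)
    then show ?thesis by (simp add: sin_45 cos_45)
  qed
  define b1 b2 where "b1 = pi / 2 * alpha * (?c + ?s)" and "b2 = pi / 2 * alpha * (?c - ?s)"
  have cs: "?c * ?c + ?s * ?s = 1" using sin_cos_squared_add3 by blast
  have b1: "b1 \<le> pi / 2"
  proof -
    have "(alpha * (?c + ?s))\<^sup>2 \<le> 1\<^sup>2"
    proof -
      have "(alpha * (?c + ?s))\<^sup>2 = (alpha * alpha) * (?c * ?c + ?s * ?s + 2 * ?c * ?s)"
        by algebra
      also have "\<dots> = 1 / 2 * (1 + sin (2 * \<theta>))" unfolding alpha_bounds(2) cs by (simp add: sin_double)
      also have "\<dots> \<le> 1" using sin_le_one[of "2 * \<theta>"] by simp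
      finally show ?thesis by simp
    qed
    then have "alpha * (?c + ?s) \<le> 1" by (rule power2_le_imp_le) simp
    then have "pi / 2 * (alpha * (?c + ?s)) \<le> pi / 2 * 1" by (intro mult_left_mono) auto
    then show ?thesis by (simp add: b1_def mult.assoc)
  qed
  have b2: "0 < b2" using sc alpha_bounds(1) by (simp add: b2_def)
  have b12: "b2 \<le> b1" using s alpha_bounds(1) by (simp add: b1_def b2_def)
  have sq: "b1\<^sup>2 - b2\<^sup>2 = pi\<^sup>2 / 4 * sin (2 * \<theta>)"
  proof -
    have "(a * (?c + ?s))\<^sup>2 - (a * (?c - ?s))\<^sup>2 = 4 * (a * a) * (?s * ?c)" for a by algebra
    from this[of "pi / 2 * alpha"] have "b1\<^sup>2 - b2\<^sup>2 = pi\<^sup>2 * (alpha * alpha) * (?s * ?c)"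
      unfolding b1_def b2_def by (simp only:) (simp add: power2_eq_square)
    then show ?thesis unfolding alpha_bounds(2) by (simp add: sin_double)
  qed
  have pr: "b1 * b2 = pi\<^sup>2 / 8 * cos (2 * \<theta>)"
  proof -
    have "b1 * b2 = pi\<^sup>2 / 4 * (alpha * alpha) * (?c\<^sup>2 - ?s\<^sup>2)"
      by (simp add: b1_def b2_def power2_eq_square algebra_simps)
    then show ?thesis unfolding alpha_bounds(2) by (simp add: cos_double)
  qed
  have "(2 / pi * b1) * (2 / pi * b2) \<le> sin b1 * sin b2"
    using b1 b2 b12 by (intro mult_mono sin_ge_jordan) (auto intro: sin_ge_zero)
  moreover have "(2 / pi * b1) * (2 / pi * b2) = 4 / pi\<^sup>2 * (b1 * b2)" by (simp add: power2_eq_square)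
  ultimately have ss: "cos (2 * \<theta>) / 2 \<le> sin b1 * sin b2" unfolding pr by simp
  have s2: "0 \<le> sin (2 * \<theta>)" using assms t by (intro sin_ge_zero) auto
  have c2: "0 \<le> cos (2 * \<theta>)" using assms t by (intro cos_ge_zero) auto
  let ?d = "(1 / b1\<^sup>2 - cos b1 / (b1 * sin b1)) - (1 / b2\<^sup>2 - cos b2 / (b2 * sin b2))"
  have d: "pi\<^sup>2 / 180 * sin (2 * \<theta>) \<le> ?d"
    using cot_difference_bound[OF b2 b12 b1] unfolding sq by (simp add: field_simps)
  have "cos (2 * \<theta>) / 2 * (pi\<^sup>2 / 180 * sin (2 * \<theta>)) \<le> sin b1 * sin b2 * ?d"
    using ss d c2 s2 by (intro mult_mono) auto
  moreover have "pi\<^sup>2 / 360 * sin (4 * \<theta>) = 2 * (cos (2 * \<theta>) / 2 * (pi\<^sup>2 / 180 * sin (2 * \<theta>)))"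
    using sin_double[of "2 * \<theta>"] by simp
  ultimately have "pi\<^sup>2 / 360 * sin (4 * \<theta>) \<le> 2 * (sin b1 * sin b2 * ?d)"
    by linarith
  moreover have "- torque (\<lambda>x. cos (pi / 2 * x)) \<theta> = 2 * (sin b1 * sin b2 * ?d)"
    using torque_cos[of \<theta>] sc s c unfolding b1_def[symmetric] b2_def[symmetric] by simp
  moreover have "0.02737 * (2.15 * \<theta>) \<le> pi\<^sup>2 / 360 * sin (4 * \<theta>)"
  proof (rule mult_mono)
    have "3.141\<^sup>2 \<le> pi\<^sup>2" using pi_approx by (intro power_mono) auto
    then show "0.02737 \<le> pi\<^sup>2 / 360" by (simp add: power2_eq_square)
  qed (use assms sin_4_ge in auto)
  moreover have "0.0588 * \<theta> \<le> 0.02737 * (2.15 * \<theta>)" using assms by simp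
  ultimately show ?thesis by linarith
qed

subsection \<open>Smoothing and truncation errors in the torque\<close>

text \<open>The side has length \<open>2 * alpha\<close> and the lever arm is at most
  \<open>alpha\<close>; since \<open>2 * alpha * alpha = 1\<close>, the weight contributes the
  factor 1.\<close>

lemma torque_integrand_bound:
  assumes "continuous_on {- alpha..alpha} f" "\<And>y. \<bar>y\<bar> \<le> alpha \<Longrightarrow> \<bar>f y\<bar> \<le> M"
  shows "\<bar>4 * integral {- alpha..alpha} (\<lambda>y. y * f y)\<bar> \<le> 4 * M"
proof -
  have "norm (integral {- alpha..alpha} (\<lambda>y. y * f y)) \<le> (alpha * M) * (alpha - - alpha)"
  proof (rule integral_bound)
    fix y assume "y \<in> {- alpha..alpha}"
    then have y: "\<bar>y\<bar> \<le> alpha" by auto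
    have "\<bar>y\<bar> * \<bar>f y\<bar> \<le> alpha * M" using y assms(2)[OF y] alpha_bounds(1) by (intro mult_mono) auto
    then show "norm (y * f y) \<le> alpha * M" by (simp add: abs_mult)
  qed (use alpha_bounds(1) in \<open>auto intro!: continuous_intros assms\<close>)
  also have "\<dots> = 2 * (alpha * alpha) * M" by simp
  also have "\<dots> = M" unfolding alpha_bounds(2) by simp
  finally show ?thesis by simp
qed

text \<open>At angle \<open>0\<close> the integrand is odd, so only the variation of \<open>E\<close> along the rotation matters.\<close>

lemma torque_variation_bound:
  fixes E :: "real \<Rightarrow> real \<Rightarrow> real"
  assumes E: "continuous_on UNIV (\<lambda>(x, y). E x y)" "\<And>y. E alpha (- y) = E alpha y"
    and M: "\<And>y. \<bar>y\<bar> \<le> alpha \<Longrightarrow> \<bar>E (alpha * cos \<theta> + y * sin \<theta>) (y * cos \<theta> - alpha * sin \<theta>) - E alpha y\<bar> \<le> M"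
  shows "\<bar>4 * integral {- alpha..alpha} (\<lambda>y. y * E (alpha * cos \<theta> + y * sin \<theta>) (y * cos \<theta> - alpha * sin \<theta>))\<bar> \<le> 4 * M"
proof -
  let ?I = "\<lambda>f. integral {- alpha..alpha} (\<lambda>y. y * f y)"
  let ?E = "\<lambda>y. E (alpha * cos \<theta> + y * sin \<theta>) (y * cos \<theta> - alpha * sin \<theta>)"
  have cE: "continuous_on A (\<lambda>y. E (f y) (g y))" if "continuous_on A f" "continuous_on A g" for A :: "real set" and f g
    using continuous_on_compose2[OF E(1) continuous_on_Pair[OF that]] by simp
  have c1: "continuous_on {-alpha..alpha} ?E" and c2: "continuous_on {-alpha..alpha} (E alpha)"
    by (intro cE continuous_intros)+
  have "?I (E alpha) = - ?I (E alpha)"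
    using Henstock_Kurzweil_Integration.integral_reflect_real[of alpha "- alpha" "\<lambda>y. - (y * E alpha y)"] E(2) by simp
  then have z: "?I (E alpha) = 0" by simp
  have "?I ?E = ?I (\<lambda>y. ?E y - E alpha y)"
  proof -
    have "?I (\<lambda>y. ?E y - E alpha y) = integral {- alpha..alpha} (\<lambda>y. y * ?E y - y * E alpha y)"
      by (simp add: right_diff_distrib)
    also have "\<dots> = ?I ?E - ?I (E alpha)"
      by (intro Henstock_Kurzweil_Integration.integral_diff integrable_continuous_real continuous_intros c1 c2)
    finally show ?thesis using z by simp
  qed
  moreover have "\<bar>4 * ?I (\<lambda>y. ?E y - E alpha y)\<bar> \<le> 4 * M"
    by (rule torque_integrand_bound) (auto intro!: continuous_intros c1 c2 M)
  ultimately show ?thesis by simp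
qed

text \<open>For \<open>\<theta> \<le> 0.8\<close> one has
  \<open>1 - cos \<theta> \<le> 0.4 * \<theta>\<close>, and \<open>0.7072 * 1.4 < 1\<close>. So each
  coordinate moves at unit rate at most.\<close>

lemma rotation_displacement:
  assumes "0 \<le> \<theta>" "\<theta> \<le> 0.8" "\<bar>y\<bar> \<le> alpha"
  shows "\<bar>alpha * cos \<theta> + y * sin \<theta> - alpha\<bar> \<le> \<theta>" "\<bar>y * cos \<theta> - alpha * sin \<theta> - y\<bar> \<le> \<theta>"
proof -
  have "\<theta> * \<theta> \<le> 0.8 * \<theta>" using assms by (intro mult_right_mono) auto
  then have c: "0 \<le> 1 - cos \<theta>" "1 - cos \<theta> \<le> 0.4 * \<theta>"
    using cos_ge_taylor2[of \<theta>] assms by (auto simp: power2_eq_square)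
  have s: "\<bar>sin \<theta>\<bar> \<le> \<theta>" using abs_sin_x_le_abs_x[of \<theta>] assms by simp
  have *: "\<bar>a\<bar> * (1 - cos \<theta>) + \<bar>b\<bar> * \<bar>sin \<theta>\<bar> \<le> \<theta>" if "\<bar>a\<bar> \<le> alpha" "\<bar>b\<bar> \<le> alpha" for a b
  proof -
    have "\<bar>a\<bar> * (1 - cos \<theta>) + \<bar>b\<bar> * \<bar>sin \<theta>\<bar> \<le> 0.7072 * (0.4 * \<theta>) + 0.7072 * \<theta>"
      using that c s alpha_bounds(3) by (intro add_mono mult_mono) auto
    then show ?thesis using assms by simp
  qed
  have "alpha * cos \<theta> + y * sin \<theta> - alpha = - (alpha * (1 - cos \<theta>)) + y * sin \<theta>" by (simp add: algebra_simps)
  then have "\<bar>alpha * cos \<theta> + y * sin \<theta> - alpha\<bar> \<le> \<bar>alpha\<bar> * (1 - cos \<theta>) + \<bar>y\<bar> * \<bar>sin \<theta>\<bar>"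
    using abs_triangle_ineq[of "- (alpha * (1 - cos \<theta>))" "y * sin \<theta>"] c by (simp add: abs_mult)
  with *[of alpha y] show "\<bar>alpha * cos \<theta> + y * sin \<theta> - alpha\<bar> \<le> \<theta>" using assms alpha_bounds(1) by simp
  have "y * cos \<theta> - alpha * sin \<theta> - y = - (y * (1 - cos \<theta>)) + - (alpha * sin \<theta>)" by (simp add: algebra_simps)
  then have "\<bar>y * cos \<theta> - alpha * sin \<theta> - y\<bar> \<le> \<bar>y\<bar> * (1 - cos \<theta>) + \<bar>alpha\<bar> * \<bar>sin \<theta>\<bar>"
    using abs_triangle_ineq[of "- (y * (1 - cos \<theta>))" "- (alpha * sin \<theta>)"] c by (simp add: abs_mult)
  with *[of y alpha] show "\<bar>y * cos \<theta> - alpha * sin \<theta> - y\<bar> \<le> \<theta>" using assms alpha_bounds(1) by simp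
qed

text \<open>For angles up to \<open>pi / 7\<close> the rotated side stays at distance \<open>0.055\<close> from the kinks of
  \<^const>\<open>cosine\<close> at \<open>1\<close> and \<open>- 1\<close>.\<close>

lemma rotation_range:
  assumes "0 \<le> \<theta>" "\<theta> \<le> pi / 7" "\<bar>y\<bar> \<le> alpha"
  shows "\<bar>alpha * cos \<theta> + y * sin \<theta>\<bar> \<le> 0.945" "\<bar>y * cos \<theta> - alpha * sin \<theta>\<bar> \<le> 0.945"
proof -
  have c: "0 \<le> cos \<theta>" using assms by (intro cos_ge_zero) auto
  have s: "0 \<le> sin \<theta>" using assms pi_gt_zero by (intro sin_ge_zero) linarith+
  have "alpha * (cos \<theta> + sin \<theta>) = cos (pi / 4 - \<theta>)"
  proof -
    have "alpha = sqrt 2 / 2" by (simp add: alpha_def field_simps)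
    then show ?thesis unfolding cos_diff cos_45 sin_45 by (simp only: distrib_left)
  qed
  \<comment> \<open>\<open>3 * pi / 28\<close> is \<open>pi / 4 - pi / 7\<close>: the corner reaches
    farthest at the largest admissible angle.\<close>
  also have "\<dots> \<le> cos (3 * pi / 28)"
    using assms by (intro cos_monotone_0_pi_le) auto
  also have "\<dots> \<le> 1 - (3 * pi / 28)\<^sup>2 / 2 + (3 * pi / 28) ^ 4 / 24" by (rule cos_le_taylor4) simp
  also have "\<dots> \<le> 0.945"
  proof -
    have b: "0.3364 \<le> 3 * pi / 28" "3 * pi / 28 \<le> 0.337" using pi_approx by auto
    have "0.3364\<^sup>2 \<le> (3 * pi / 28)\<^sup>2" "(3 * pi / 28) ^ 4 \<le> 0.337 ^ 4"
      using b by (auto intro!: power_mono)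
    then show ?thesis by (simp add: power_numeral_reduce)
  qed
  finally have *: "alpha * cos \<theta> + alpha * sin \<theta> \<le> 0.945" by (simp add: algebra_simps)
  have "\<bar>a * cos \<theta> + b * sin \<theta>\<bar> \<le> 0.945" if "\<bar>a\<bar> \<le> alpha" "\<bar>b\<bar> \<le> alpha" for a b
  proof -
    have "\<bar>a * cos \<theta> + b * sin \<theta>\<bar> \<le> \<bar>a\<bar> * cos \<theta> + \<bar>b\<bar> * sin \<theta>"
      using abs_triangle_ineq[of "a * cos \<theta>" "b * sin \<theta>"] c s by (simp add: abs_mult)
    also have "\<dots> \<le> alpha * cos \<theta> + alpha * sin \<theta>"
      using that c s by (intro add_mono mult_right_mono) auto
    finally show ?thesis using * by linarith
  qed
  from this[of alpha y] this[of y "- alpha"] assms alpha_bounds(1)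
  show "\<bar>alpha * cos \<theta> + y * sin \<theta>\<bar> \<le> 0.945" "\<bar>y * cos \<theta> - alpha * sin \<theta>\<bar> \<le> 0.945" by auto
qed

section \<open>Lipschitz bounds and perturbation of the torque integrand\<close>

lemma sin_lipschitz: "\<bar>sin a - sin b\<bar> \<le> \<bar>a - b\<bar>" for a b :: real
proof -
  have "\<bar>sin a - sin b\<bar> = 2 * \<bar>sin ((a - b) / 2)\<bar> * \<bar>cos ((a + b) / 2)\<bar>"
    by (simp add: sin_diff_sin abs_mult)
  also have "\<dots> \<le> 2 * \<bar>(a - b) / 2\<bar> * 1"
    by (intro mult_mono abs_sin_x_le_abs_x) auto
  finally show ?thesis by simp
qed

lemma cosine_lipschitz: "\<bar>cosine a - cosine b\<bar> \<le> pi / 2 * \<bar>a - b\<bar>"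
proof -
  have "\<bar>cosine a - cosine b\<bar> \<le> \<bar>pi / 2 * hwidth a - pi / 2 * hwidth b\<bar>"
    unfolding cosine_def by (rule sin_lipschitz)
  also have "\<dots> = pi / 2 * \<bar>hwidth a - hwidth b\<bar>" unfolding right_diff_distrib[symmetric] abs_mult by simp
  also have "\<dots> \<le> pi / 2 * \<bar>a - b\<bar>" by (intro mult_left_mono) (auto simp: hwidth_def)
  finally show ?thesis .
qed

lemma cos_half_pi_lipschitz: "\<bar>cos (pi / 2 * a) - cos (pi / 2 * b)\<bar> \<le> pi / 2 * \<bar>a - b\<bar>"
proof -
  have e: "cos x = sin (pi / 2 - x)" for x :: real by (simp add: cos_sin_eq)
  have "\<bar>cos (pi / 2 * a) - cos (pi / 2 * b)\<bar> \<le> \<bar>(pi / 2 - pi / 2 * a) - (pi / 2 - pi / 2 * b)\<bar>"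
    unfolding e by (rule sin_lipschitz)
  also have "\<dots> = \<bar>pi / 2 * (b - a)\<bar>" by (simp only: right_diff_distrib)
  also have "\<dots> = pi / 2 * \<bar>b - a\<bar>" unfolding abs_mult by simp
  finally show ?thesis by (simp add: abs_minus_commute)
qed

lemma product_difference:
  fixes a b a' b' :: real
  shows "\<bar>a * b - a' * b'\<bar> \<le> \<bar>a - a'\<bar> * \<bar>b\<bar> + \<bar>a'\<bar> * \<bar>b - b'\<bar>"
proof -
  have "a * b - a' * b' = (a - a') * b + a' * (b - b')" by (simp add: algebra_simps)
  then show ?thesis by (metis abs_mult abs_triangle_ineq)
qed

lemma torque_scale: "torque (\<lambda>x. c * f x) \<theta> = c * c * torque f \<theta>"
proof -
  have "(\<lambda>y. y * (c * f (alpha * cos \<theta> + y * sin \<theta>) * (c * f (y * cos \<theta> - alpha * sin \<theta>))))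
    = (\<lambda>y. c * c * (y * (f (alpha * cos \<theta> + y * sin \<theta>) * f (y * cos \<theta> - alpha * sin \<theta>))))"
    by (auto simp: mult_ac)
  then show ?thesis unfolding torque_def by simp
qed

lemma torque_integrand_diff:
  assumes "continuous_on UNIV f1" "continuous_on UNIV f2"
  shows "torque f1 \<theta> - torque f2 \<theta> = 4 * integral {- alpha..alpha} (\<lambda>y. y *
     (f1 (alpha * cos \<theta> + y * sin \<theta>) * f1 (y * cos \<theta> - alpha * sin \<theta>)
      - f2 (alpha * cos \<theta> + y * sin \<theta>) * f2 (y * cos \<theta> - alpha * sin \<theta>)))"
  unfolding torque_def right_diff_distrib
  by (subst Henstock_Kurzweil_Integration.integral_diff)
     (auto intro!: integrable_continuous_real continuous_intros continuous_on_compose2[OF assms(1)]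
        continuous_on_compose2[OF assms(2)])

text \<open>\<open>\<tau>\<close> stands for \<open>sqrt 2 * \<sigma>\<close>, so the assumption is
  \<open>\<sigma>\<^sup>2 \<le> 1 / 10 ^ 4\<close> in another form.\<close>

locale gaussian_width =
  fixes \<tau> :: real
  assumes \<tau>: "0 < \<tau>" "\<tau>\<^sup>2 \<le> 2 / 10 ^ 4"
begin

sublocale even_density "normal_density 0 \<tau>"
  by (rule even_density_normal) (rule \<tau>)

abbreviation gauss where "gauss \<equiv> normal_density 0 \<tau>"

lemma integrable_weighted:
  assumes "f \<in> borel_measurable borel" "\<And>x. \<bar>f x\<bar> \<le> B"
  shows "integrable lborel (\<lambda>z. gauss z * f (s - z))"
proof -
  have "integrable lborel (\<lambda>z. gauss (0 - z) * f (s - z))"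
  proof (rule smooth_integrable)
    note assms(1)[measurable]
    show "(\<lambda>z. f (s - z)) \<in> borel_measurable borel" by measurable
  qed (rule assms(2))
  then show ?thesis by (simp add: even)
qed

text \<open>Markov's inequality for the twelfth moment.\<close>

lemma gaussian_tail:
  assumes f: "integrable lborel (\<lambda>z. gauss z * f z)" and C: "0 \<le> C"
    and "\<And>z. \<bar>z\<bar> \<le> 0.055 \<Longrightarrow> f z = 0" "\<And>z. \<bar>f z\<bar> \<le> C"
  shows "\<bar>\<integral>z. gauss z * f z \<partial>lborel\<bar> \<le> 0.00088 * C"
proof -
  have m: "integrable lborel (\<lambda>z. gauss z * z ^ 12)" "(\<integral>z. gauss z * z ^ 12 \<partial>lborel) = 10395 * (\<tau>\<^sup>2) ^ 6"
    using integrable_normal_moment[OF \<tau>(1), of 0 12] integral_normal_moment_even[OF \<tau>(1), of 0 6]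
    by (simp_all add: fact_numeral power_divide)
  have "\<bar>\<integral>z. gauss z * f z \<partial>lborel\<bar> \<le> (\<integral>z. \<bar>gauss z * f z\<bar> \<partial>lborel)" by (rule integral_abs_bound)
  also have "\<dots> \<le> (\<integral>z. (C / 0.055 ^ 12) * (gauss z * z ^ 12) \<partial>lborel)"
  proof (rule integral_mono)
    fix z
    have "\<bar>f z\<bar> \<le> C / 0.055 ^ 12 * z ^ 12"
    proof (cases "\<bar>z\<bar> \<le> 0.055")
      case True
      then show ?thesis using assms(3)[of z] C by (simp add: zero_le_even_power)
    next
      case False
      then have "0.055 ^ 12 \<le> \<bar>z\<bar> ^ 12" by (intro power_mono) auto
      then have "C * 0.055 ^ 12 \<le> C * z ^ 12" using C by (intro mult_left_mono) (auto simp: power_even_abs)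
      then have "C \<le> C / 0.055 ^ 12 * z ^ 12" by (simp add: field_simps)
      then show ?thesis using assms(4)[of z] by linarith
    qed
    from mult_left_mono[OF this nonneg[of z]]
    show "\<bar>gauss z * f z\<bar> \<le> (C / 0.055 ^ 12) * (gauss z * z ^ 12)" by (simp add: abs_mult nonneg mult_ac)
  qed (use f m in auto)
  also have "\<dots> = C * (10395 * (\<tau>\<^sup>2) ^ 6 / 0.055 ^ 12)" by (simp add: m)
  also have "\<dots> \<le> C * 0.00088"
  proof (rule mult_left_mono[OF _ C])
    \<comment> \<open>10395 is \<open>11!!\<close>, the twelfth moment of a standard normal
      variable. The quotient is about \<open>8.7 / 10 ^ 4\<close>.\<close>
    have "(\<tau>\<^sup>2) ^ 6 \<le> (2 / 10 ^ 4) ^ 6" using \<tau>(2) by (intro power_mono) auto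
    then show "10395 * (\<tau>\<^sup>2) ^ 6 / 0.055 ^ 12 \<le> 0.00088" by (simp add: power_divide)
  qed
  finally show ?thesis by (simp add: mult.commute)
qed

abbreviation vsmooth where "vsmooth \<equiv> smooth gauss cosine"

text \<open>The eigenvalue of Gaussian smoothing on \<open>cos (pi / 2 * x)\<close>, in closed form
  \<open>exp (- pi\<^sup>2 * \<tau>\<^sup>2 / 8)\<close>.\<close>

definition cos_damping where "cos_damping = (\<integral>z. gauss z * cos (pi / 2 * z) \<partial>lborel)"

abbreviation damped_cos where "damped_cos x \<equiv> cos_damping * cos (pi / 2 * x)"

lemma cosine_measurable: "cosine \<in> borel_measurable borel"
  by (rule borel_measurable_continuous_onI[OF continuous_cosine])

lemma cosine_abs: "\<bar>cosine x\<bar> \<le> 1"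
  using cosine_nonneg[of x] cosine_le_1[of x] by simp

lemma vsmooth_bound: "\<bar>vsmooth x\<bar> \<le> 1"
  by (rule smooth_bounded[OF cosine_measurable cosine_abs])

lemma vsmooth_lipschitz: "\<bar>vsmooth x - vsmooth y\<bar> \<le> pi / 2 * \<bar>x - y\<bar>"
proof -
  note i = integrable_weighted[OF cosine_measurable cosine_abs]
  have "vsmooth x - vsmooth y = (\<integral>z. gauss z * (cosine (x - z) - cosine (y - z)) \<partial>lborel)"
    unfolding smooth_normal_alt using i by (simp add: right_diff_distrib)
  also have "\<bar>\<dots>\<bar> \<le> (\<integral>z. \<bar>gauss z * (cosine (x - z) - cosine (y - z))\<bar> \<partial>lborel)" by (rule integral_abs_bound)
  also have "\<dots> \<le> (\<integral>z. gauss z * (pi / 2 * \<bar>x - y\<bar>) \<partial>lborel)"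
  proof (rule integral_mono)
    show "integrable lborel (\<lambda>z. \<bar>gauss z * (cosine (x - z) - cosine (y - z))\<bar>)"
      using i[of x] i[of y] by (intro integrable_abs) (simp add: right_diff_distrib)
    show "\<bar>gauss z * (cosine (x - z) - cosine (y - z))\<bar> \<le> gauss z * (pi / 2 * \<bar>x - y\<bar>)" for z
      using mult_left_mono[OF cosine_lipschitz[of "x - z" "y - z"] nonneg[of z]] nonneg[of z] by (simp add: abs_mult)
  qed (use integrable in auto)
  also have "\<dots> = pi / 2 * \<bar>x - y\<bar>" using integral_eq_1 by simp
  finally show ?thesis .
qed

lemma vsmooth_continuous: "continuous_on UNIV vsmooth"
  using smooth_normal_C1[OF continuous_cosine cosine_outside \<tau>(1)]
  by (metis DERIV_isCont continuous_at_imp_continuous_on less_imp_le)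

lemma vsmooth_even: "vsmooth (- x) = vsmooth x"
  by (rule smooth_normal_even) simp

lemma cos_measurable: "(\<lambda>z. cos (pi / 2 * z)) \<in> borel_measurable borel" by measurable

lemma integrable_gauss_cos: "integrable lborel (\<lambda>z. gauss z * cos (pi / 2 * z))"
  using integrable_weighted[OF cos_measurable, of 1 0] by simp

lemma cos_damping_bounds: "0.9997 \<le> cos_damping" "cos_damping \<le> 1"
proof -
  have m: "integrable lborel (\<lambda>z. gauss z * z ^ 2)" "(\<integral>z. gauss z * z ^ 2 \<partial>lborel) = \<tau>\<^sup>2"
    using integrable_normal_moment[OF \<tau>(1), of 0 2] integral_normal_moment_even[OF \<tau>(1), of 0 1]
    by (simp_all add: fact_numeral)
  have "(\<integral>z. gauss z - pi\<^sup>2 / 8 * (gauss z * z ^ 2) \<partial>lborel) \<le> cos_damping"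
    unfolding cos_damping_def
  proof (rule integral_mono)
    fix z
    have "1 - (pi / 2 * z)\<^sup>2 / 2 \<le> cos (pi / 2 * z)"
      by (rule cos_ge_quadratic)
    from mult_left_mono[OF this nonneg[of z]]
    show "gauss z - pi\<^sup>2 / 8 * (gauss z * z ^ 2) \<le> gauss z * cos (pi / 2 * z)"
      by (simp add: algebra_simps power_mult_distrib power_divide)
  qed (use integrable m integrable_gauss_cos in auto)
  moreover have "(\<integral>z. gauss z - pi\<^sup>2 / 8 * (gauss z * z ^ 2) \<partial>lborel) = 1 - pi\<^sup>2 / 8 * \<tau>\<^sup>2"
    using integrable m integral_eq_1 by simp
  moreover have "pi\<^sup>2 / 8 * \<tau>\<^sup>2 \<le> 1.3 * (2 / 10 ^ 4)"
  proof (rule mult_mono)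
    have "pi\<^sup>2 \<le> 3.2\<^sup>2" using pi_approx by (intro power_mono) auto
    then show "pi\<^sup>2 / 8 \<le> 1.3" by (simp add: power2_eq_square)
  qed (use \<tau> in auto)
  ultimately show "0.9997 \<le> cos_damping" by simp
  have "cos_damping \<le> (\<integral>z. gauss z \<partial>lborel)" unfolding cos_damping_def
    by (rule integral_mono) (use integrable integrable_gauss_cos nonneg mult_left_le[OF cos_le_one] in auto)
  then show "cos_damping \<le> 1" using integral_eq_1 by simp
qed

text \<open>Addition formula; the sine part integrates to zero against the even Gaussian.\<close>

lemma weighted_cos: "(\<integral>z. gauss z * cos (pi / 2 * (x - z)) \<partial>lborel) = damped_cos x"
proof -
  have sn: "integrable lborel (\<lambda>z. gauss z * sin (pi / 2 * z))"
    using integrable_weighted[of "\<lambda>z. sin (pi / 2 * z)" 1 0] by simp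
  have "(\<integral>z. gauss z * sin (pi / 2 * z) \<partial>lborel) = - (\<integral>z. gauss z * sin (pi / 2 * z) \<partial>lborel)"
    by (subst lborel_integral_real_affine[of "-1" _ 0]) (simp_all add: even)
  then have s0: "(\<integral>z. gauss z * sin (pi / 2 * z) \<partial>lborel) = 0" by simp
  have "(\<integral>z. gauss z * cos (pi / 2 * (x - z)) \<partial>lborel)
    = (\<integral>z. cos (pi / 2 * x) * (gauss z * cos (pi / 2 * z)) + sin (pi / 2 * x) * (gauss z * sin (pi / 2 * z)) \<partial>lborel)"
  proof (intro Bochner_Integration.integral_cong refl)
    fix z
    have "cos (pi / 2 * (x - z)) = cos (pi / 2 * x) * cos (pi / 2 * z) + sin (pi / 2 * x) * sin (pi / 2 * z)"
      by (simp only: right_diff_distrib cos_diff)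
    then show "gauss z * cos (pi / 2 * (x - z))
      = cos (pi / 2 * x) * (gauss z * cos (pi / 2 * z)) + sin (pi / 2 * x) * (gauss z * sin (pi / 2 * z))"
      by (simp only: distrib_left mult.left_commute)
  qed
  also have "\<dots> = cos (pi / 2 * x) * cos_damping"
    using integrable_gauss_cos sn s0 by (simp add: cos_damping_def)
  finally show ?thesis by simp
qed

text \<open>Carries the kinks of \<open>cosine\<close>. For \<open>\<bar>x\<bar> \<le> 0.945\<close>
  the value \<open>excess (x - z)\<close> vanishes unless \<open>\<bar>z\<bar>\<close> exceeds
  \<open>0.055\<close>, so its Gaussian average is a tail.\<close>

definition excess where "excess x = cosine x - cos (pi / 2 * x)"

lemma excess_bounds: "\<bar>x\<bar> \<le> 1 \<Longrightarrow> excess x = 0" "\<bar>excess x\<bar> \<le> 1" "\<bar>excess x - excess y\<bar> \<le> pi * \<bar>x - y\<bar>"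
proof -
  show z: "excess x = 0" if "\<bar>x\<bar> \<le> 1" for x using that by (simp add: excess_def cosine_eq_cos)
  show "\<bar>excess x\<bar> \<le> 1" using z[of x] cosine_outside[of x] by (cases "\<bar>x\<bar> \<le> 1") (auto simp: excess_def)
  show "\<bar>excess x - excess y\<bar> \<le> pi * \<bar>x - y\<bar>"
    using cosine_lipschitz[of x y] cos_half_pi_lipschitz[of x y]
      abs_triangle_ineq4[of "cosine x - cosine y" "cos (pi / 2 * x) - cos (pi / 2 * y)"]
    unfolding excess_def by (simp add: algebra_simps)
qed

lemma excess_measurable: "excess \<in> borel_measurable borel"
  unfolding excess_def[abs_def] using cosine_measurable cos_measurable by measurable

lemma vsmooth_minus_damped_cos: "vsmooth x - damped_cos x = (\<integral>z. gauss z * excess (x - z) \<partial>lborel)"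
  unfolding smooth_normal_alt weighted_cos[symmetric] excess_def
  using integrable_weighted[OF cosine_measurable cosine_abs, of x] integrable_weighted[OF cos_measurable, of 1 x]
  by (simp add: right_diff_distrib)

text \<open>The second bound applies the tail estimate to a difference of \<open>excess\<close>
  values, which is at most \<open>pi * \<bar>x - y\<bar>\<close>. This makes the smoothing error in
  the torque proportional to the angle.\<close>

lemma diff_bounds:
  assumes "\<bar>x\<bar> \<le> 0.945" "\<bar>y\<bar> \<le> 0.945"
  shows "\<bar>vsmooth x - damped_cos x\<bar> \<le> 0.00088" "\<bar>(vsmooth x - damped_cos x) - (vsmooth y - damped_cos y)\<bar> \<le> 0.00088 * (pi * \<bar>x - y\<bar>)"
proof -
  note i = integrable_weighted[OF excess_measurable excess_bounds(2)]
  show "\<bar>vsmooth x - damped_cos x\<bar> \<le> 0.00088"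
    unfolding vsmooth_minus_damped_cos using gaussian_tail[OF i, of 1 x] assms excess_bounds by force
  have "(vsmooth x - damped_cos x) - (vsmooth y - damped_cos y) = (\<integral>z. gauss z * (excess (x - z) - excess (y - z)) \<partial>lborel)"
    unfolding vsmooth_minus_damped_cos using i by (simp add: right_diff_distrib)
  also have "\<bar>\<dots>\<bar> \<le> 0.00088 * (pi * \<bar>x - y\<bar>)"
  proof (rule gaussian_tail)
    show "integrable lborel (\<lambda>z. gauss z * (excess (x - z) - excess (y - z)))"
      using i[of x] i[of y] by (simp add: right_diff_distrib)
    show "excess (x - z) - excess (y - z) = 0" if "\<bar>z\<bar> \<le> 0.055" for z
      using that assms excess_bounds(1)[of "x - z"] excess_bounds(1)[of "y - z"] by force
    show "\<bar>excess (x - z) - excess (y - z)\<bar> \<le> pi * \<bar>x - y\<bar>" for z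
      using excess_bounds(3)[of "x - z" "y - z"] by simp
  qed simp
  finally show "\<bar>(vsmooth x - damped_cos x) - (vsmooth y - damped_cos y)\<bar> \<le> 0.00088 * (pi * \<bar>x - y\<bar>)" .
qed

lemma damped_cos_bounds: "\<bar>damped_cos x\<bar> \<le> 1" "\<bar>damped_cos x - damped_cos y\<bar> \<le> pi / 2 * \<bar>x - y\<bar>"
proof -
  have "\<bar>damped_cos x\<bar> \<le> 1 * 1" unfolding abs_mult using cos_damping_bounds by (intro mult_mono) auto
  then show "\<bar>damped_cos x\<bar> \<le> 1" by simp
  have "\<bar>damped_cos x - damped_cos y\<bar> = cos_damping * \<bar>cos (pi / 2 * x) - cos (pi / 2 * y)\<bar>"
    using cos_damping_bounds by (simp add: abs_mult flip: right_diff_distrib)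
  also have "\<dots> \<le> 1 * (pi / 2 * \<bar>x - y\<bar>)"
    using cos_damping_bounds by (intro mult_mono cos_half_pi_lipschitz) auto
  finally show "\<bar>damped_cos x - damped_cos y\<bar> \<le> pi / 2 * \<bar>x - y\<bar>" by simp
qed

text \<open>Both factors of the integrand vary by at most \<open>pi / 2 * \<theta>\<close> along the
  rotation. The resulting upper slope limits the step size.\<close>

lemma torque_vsmooth_upper:
  assumes "0 \<le> \<theta>" "\<theta> \<le> 0.8"
  shows "\<bar>torque vsmooth \<theta>\<bar> \<le> 4 * (pi * \<theta>)"
  unfolding torque_def
proof (rule torque_variation_bound[where E = "\<lambda>x y. vsmooth x * vsmooth y"])
  show "continuous_on UNIV (\<lambda>(x, y). vsmooth x * vsmooth y)"
    unfolding split_beta by (intro continuous_intros continuous_on_compose2[OF vsmooth_continuous]) auto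
  fix y assume y: "\<bar>y\<bar> \<le> alpha"
  let ?p = "alpha * cos \<theta> + y * sin \<theta>" and ?q = "y * cos \<theta> - alpha * sin \<theta>"
  note D = rotation_displacement[OF assms y]
  have k: "\<bar>vsmooth a - vsmooth b\<bar> \<le> pi / 2 * \<theta>" if "\<bar>a - b\<bar> \<le> \<theta>" for a b
    using vsmooth_lipschitz[of a b] by (rule order_trans) (intro mult_left_mono that, simp)
  have "\<bar>vsmooth ?p * vsmooth ?q - vsmooth alpha * vsmooth y\<bar> \<le> \<bar>vsmooth ?p - vsmooth alpha\<bar> * \<bar>vsmooth ?q\<bar> + \<bar>vsmooth alpha\<bar> * \<bar>vsmooth ?q - vsmooth y\<bar>"
    by (rule product_difference)
  also have "\<dots> \<le> (pi / 2 * \<theta>) * 1 + 1 * (pi / 2 * \<theta>)"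
    using D assms by (intro add_mono mult_mono k vsmooth_bound) auto
  finally show "\<bar>vsmooth ?p * vsmooth ?q - vsmooth alpha * vsmooth y\<bar> \<le> pi * \<theta>" by simp
qed (simp add: vsmooth_even)

text \<open>Replacing \<open>vsmooth\<close> by \<open>damped_cos\<close> changes the product by two
  terms. Each varies by at most \<open>0.00088 * (1 + 1 / 2) * pi * \<theta>\<close>, and four times
  their sum is below \<open>0.0333 * \<theta>\<close>. The slope \<open>0.9994 * 0.0588\<close> of
  the damped cosine leaves \<open>0.025\<close>.\<close>

lemma torque_vsmooth_lower:
  assumes \<theta>: "0 \<le> \<theta>" "\<theta> \<le> pi / 7"
  shows "0.025 * \<theta> \<le> - torque vsmooth \<theta>"
proof -
  have \<theta>': "\<theta> \<le> 0.8" using \<theta> pi_approx by simp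
  let ?d = "\<lambda>x. vsmooth x - damped_cos x"
  have hc: "continuous_on UNIV (\<lambda>x. damped_cos x)" by (intro continuous_intros)
  have 1: "\<bar>torque vsmooth \<theta> - torque (\<lambda>x. damped_cos x) \<theta>\<bar> \<le> 4 * (0.00264 * (pi * \<theta>))"
    unfolding torque_integrand_diff[OF vsmooth_continuous hc]
  proof (rule torque_variation_bound[where E = "\<lambda>x y. vsmooth x * vsmooth y - damped_cos x * damped_cos y"])
    show "continuous_on UNIV (\<lambda>(x, y). vsmooth x * vsmooth y - damped_cos x * damped_cos y)"
      unfolding split_beta by (intro continuous_intros continuous_on_compose2[OF vsmooth_continuous]) auto
    fix y assume y: "\<bar>y\<bar> \<le> alpha"
    let ?p = "alpha * cos \<theta> + y * sin \<theta>" and ?q = "y * cos \<theta> - alpha * sin \<theta>"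
    note D = rotation_displacement[OF \<theta>(1) \<theta>' y]
    note R = rotation_range[OF \<theta> y]
    have ra: "\<bar>alpha\<bar> \<le> 0.945" "\<bar>y\<bar> \<le> 0.945" using y alpha_bounds by auto
    have e: "\<bar>?d a - ?d b\<bar> \<le> 0.00088 * (pi * \<theta>)" if "\<bar>a - b\<bar> \<le> \<theta>" "\<bar>a\<bar> \<le> 0.945" "\<bar>b\<bar> \<le> 0.945" for a b
    proof -
      have "0.00088 * (pi * \<bar>a - b\<bar>) \<le> 0.00088 * (pi * \<theta>)" using that by (intro mult_left_mono) auto
      then show ?thesis using diff_bounds(2)[OF that(2,3)] by linarith
    qed
    have l: "\<bar>vsmooth a - vsmooth b\<bar> \<le> pi / 2 * \<theta>" "\<bar>damped_cos a - damped_cos b\<bar> \<le> pi / 2 * \<theta>" if "\<bar>a - b\<bar> \<le> \<theta>" for a b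
      by (rule order_trans[OF vsmooth_lipschitz] order_trans[OF damped_cos_bounds(2)], intro mult_left_mono that, simp)+
    have eq: "vsmooth a * vsmooth b - damped_cos a * damped_cos b = ?d a * vsmooth b + damped_cos a * ?d b" for a b by (simp add: algebra_simps)
    have "\<bar>?d ?p * vsmooth ?q - ?d alpha * vsmooth y\<bar> \<le> \<bar>?d ?p - ?d alpha\<bar> * \<bar>vsmooth ?q\<bar> + \<bar>?d alpha\<bar> * \<bar>vsmooth ?q - vsmooth y\<bar>"
      by (rule product_difference)
    also have "\<dots> \<le> (0.00088 * (pi * \<theta>)) * 1 + 0.00088 * (pi / 2 * \<theta>)"
      using \<theta> by (intro add_mono mult_mono e D R ra vsmooth_bound diff_bounds(1)[OF ra] l) auto
    finally have 1: "\<bar>?d ?p * vsmooth ?q - ?d alpha * vsmooth y\<bar> \<le> 0.00132 * (pi * \<theta>)" by simp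
    have "\<bar>damped_cos ?p * ?d ?q - damped_cos alpha * ?d y\<bar> \<le> \<bar>damped_cos ?p - damped_cos alpha\<bar> * \<bar>?d ?q\<bar> + \<bar>damped_cos alpha\<bar> * \<bar>?d ?q - ?d y\<bar>"
      by (rule product_difference)
    also have "\<dots> \<le> (pi / 2 * \<theta>) * 0.00088 + 1 * (0.00088 * (pi * \<theta>))"
      using \<theta> by (intro add_mono mult_mono e D R ra damped_cos_bounds(1) diff_bounds(1)[OF R(2) R(2)] l) auto
    finally have 2: "\<bar>damped_cos ?p * ?d ?q - damped_cos alpha * ?d y\<bar> \<le> 0.00132 * (pi * \<theta>)" by simp
    show "\<bar>(vsmooth ?p * vsmooth ?q - damped_cos ?p * damped_cos ?q) - (vsmooth alpha * vsmooth y - damped_cos alpha * damped_cos y)\<bar> \<le> 0.00264 * (pi * \<theta>)"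
      unfolding eq using 1 2 by linarith
  qed (simp add: vsmooth_even)
  have 2: "torque (\<lambda>x. damped_cos x) \<theta> = cos_damping * cos_damping * torque (\<lambda>x. cos (pi / 2 * x)) \<theta>" by (rule torque_scale)
  have 3: "0.9994 * (0.0588 * \<theta>) \<le> cos_damping * cos_damping * (- torque (\<lambda>x. cos (pi / 2 * x)) \<theta>)"
  proof (rule mult_mono)
    have "0.9997 * 0.9997 \<le> cos_damping * cos_damping" using cos_damping_bounds by (intro mult_mono) auto
    then show "0.9994 \<le> cos_damping * cos_damping" by simp
  qed (use torque_cos_bound[OF \<theta>] \<theta> in auto)
  have 4: "4 * (0.00264 * (pi * \<theta>)) \<le> 0.0333 * \<theta>"
  proof -
    have "pi * \<theta> \<le> 3.15 * \<theta>" using pi_approx \<theta> by (intro mult_right_mono) auto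
    then show ?thesis using \<theta> by simp
  qed
  have "0.025 * \<theta> + 0.0333 * \<theta> \<le> 0.9994 * (0.0588 * \<theta>)" using \<theta> by simp
  with abs_le_D1[OF 1] 2 3 4 show ?thesis by linarith
qed

text \<open>With \<open>L * L = 4 / pi\<close> the upper slope is
  \<open>4 / pi * 4 * pi = 16\<close>. The error of \<open>u\<close> is controlled only in the sup
  norm, so its contribution \<open>4 * 4 * \<delta>\<close>, with \<open>3 * L * L \<le> 4\<close>,
  does not shrink with the angle.\<close>

lemma torque_rough:
  assumes u: "continuous_on UNIV u" and \<delta>: "0 \<le> \<delta>" "\<delta> \<le> 1"
    and ud: "\<And>s. \<bar>u s - sqrt (4 / pi) * cosine s\<bar> \<le> sqrt (4 / pi) * \<delta>"
    and k: "continuous_on UNIV (smooth gauss u)" and \<theta>: "0 \<le> \<theta>" "\<theta> \<le> pi / 7"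
  shows "0.025 * \<theta> - 16 * \<delta> \<le> - torque (smooth gauss u) \<theta>" "- torque (smooth gauss u) \<theta> \<le> 16 * \<theta> + 16 * \<delta>"
proof -
  define L where "L = sqrt (4 / pi)"
  have L: "0 < L" "L * L = 4 / pi" by (auto simp: L_def)
  have L2: "1 \<le> L * L" "L * L \<le> 4 / 3" unfolding L(2) using pi_approx by (auto simp: field_simps)
  let ?k = "smooth gauss u"
  let ?v = "\<lambda>x. L * vsmooth x"
  have um: "u \<in> borel_measurable borel" using u by (rule borel_measurable_continuous_onI)
  have ub: "\<bar>u x\<bar> \<le> 2 * L" for x
  proof -
    have "\<bar>u x\<bar> \<le> \<bar>u x - L * cosine x\<bar> + \<bar>L * cosine x\<bar>" by linarith
    also have "\<dots> \<le> L * \<delta> + L * 1"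
      using ud[of x] L cosine_abs[of x] by (intro add_mono) (auto simp: L_def[symmetric] abs_mult)
    also have "\<dots> \<le> L * 1 + L * 1" using L \<delta> by (intro add_mono mult_left_mono) auto
    finally show ?thesis by simp
  qed
  have kd: "\<bar>?k x - ?v x\<bar> \<le> L * \<delta>" for x
  proof -
    have "?k x - ?v x = smooth gauss (\<lambda>y. u y - L * cosine y) x"
    proof -
      have "smooth gauss (\<lambda>y. u y - L * cosine y) x = ?k x - smooth gauss (\<lambda>y. L * cosine y) x"
      proof (rule smooth_diff[OF um ub])
        show "(\<lambda>y. L * cosine y) \<in> borel_measurable borel" using cosine_measurable by measurable
        show "\<bar>L * cosine y\<bar> \<le> L" for y using L cosine_abs[of y] by (simp add: abs_mult)
      qed
      also have "smooth gauss (\<lambda>y. L * cosine y) x = L * vsmooth x"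
        by (simp add: smooth_def mult.left_commute)
      finally show ?thesis by simp
    qed
    also have "\<bar>\<dots>\<bar> \<le> L * \<delta>"
    proof (rule smooth_bounded)
      show "(\<lambda>y. u y - L * cosine y) \<in> borel_measurable borel" using cosine_measurable um by measurable
      show "\<bar>u y - L * cosine y\<bar> \<le> L * \<delta>" for y using ud by (simp add: L_def)
    qed
    finally show ?thesis .
  qed
  have vb: "\<bar>?v x\<bar> \<le> L" for x using L vsmooth_bound[of x] by (simp add: abs_mult)
  have kb: "\<bar>?k x\<bar> \<le> 2 * L" for x by (rule smooth_bounded[OF um ub])
  have vc: "continuous_on UNIV ?v" by (intro continuous_intros vsmooth_continuous)
  have "\<bar>torque ?k \<theta> - torque ?v \<theta>\<bar> \<le> 4 * (4 * \<delta>)"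
    unfolding torque_integrand_diff[OF k vc]
  proof (rule torque_integrand_bound)
    fix y
    let ?p = "alpha * cos \<theta> + y * sin \<theta>" and ?q = "y * cos \<theta> - alpha * sin \<theta>"
    have "\<bar>?k ?p * ?k ?q - ?v ?p * ?v ?q\<bar> \<le> \<bar>?k ?p - ?v ?p\<bar> * \<bar>?k ?q\<bar> + \<bar>?v ?p\<bar> * \<bar>?k ?q - ?v ?q\<bar>"
      by (rule product_difference)
    also have "\<dots> \<le> (L * \<delta>) * (2 * L) + L * (L * \<delta>)"
      using L \<delta> by (intro add_mono mult_mono kd kb vb) auto
    also have "\<dots> = 3 * (L * L) * \<delta>" by simp
    also have "\<dots> \<le> 4 * \<delta>" using L2 \<delta> by (intro mult_right_mono) auto
    finally show "\<bar>?k ?p * ?k ?q - ?v ?p * ?v ?q\<bar> \<le> 4 * \<delta>" .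
  qed (auto intro!: continuous_intros continuous_on_compose2[OF k] continuous_on_compose2[OF vsmooth_continuous])
  moreover have "torque ?v \<theta> = L * L * torque vsmooth \<theta>" by (rule torque_scale)
  moreover have "1 * (0.025 * \<theta>) \<le> L * L * (- torque vsmooth \<theta>)"
    using L2 torque_vsmooth_lower[OF \<theta>] \<theta> by (intro mult_mono) auto
  moreover have "L * L * (- torque vsmooth \<theta>) \<le> 4 / pi * (4 * (pi * \<theta>))"
    unfolding L(2) using torque_vsmooth_upper[of \<theta>] \<theta> pi_approx by (intro mult_left_mono) auto
  ultimately show "0.025 * \<theta> - 16 * \<delta> \<le> - torque (smooth gauss u) \<theta>" "- torque (smooth gauss u) \<theta> \<le> 16 * \<theta> + 16 * \<delta>"
    by (auto simp: abs_le_iff)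
qed

end

section \<open>Symmetries of the torque\<close>

lemma torque_minus:
  assumes "\<And>x. k (- x) = k x" shows "torque k (- \<theta>) = - torque k \<theta>"
proof -
  have "k (- (y * cos \<theta>) - alpha * sin \<theta>) = k (y * cos \<theta> + alpha * sin \<theta>)" for y
    using assms[of "y * cos \<theta> + alpha * sin \<theta>"] by simp
  then show ?thesis
    unfolding torque_def
    using Henstock_Kurzweil_Integration.integral_reflect_real[of alpha "- alpha"
      "\<lambda>y. y * (k (alpha * cos \<theta> + y * sin \<theta>) * k (y * cos \<theta> - alpha * sin \<theta>))"] by simp
qed

lemma quarter_turn_periodic:
  assumes "\<And>x. f (x + pi / 2) = f x"
  shows "f (x + pi / 2 * of_int j) = f x"
proof -
  have nat: "f (x + pi / 2 * of_nat i) = f x" for i x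
  proof (induction i)
    case (Suc i)
    then show ?case using assms[of "x + pi / 2 * of_nat i"] by (simp add: algebra_simps add_divide_distrib)
  qed simp
  show ?thesis
  proof (cases j)
    case (nonneg i) then show ?thesis using nat by simp
  next
    case (neg i)
    then have "(of_int j :: real) = - of_nat (Suc i)" by simp
    then have "pi / 2 * of_int j = - (pi / 2 * of_nat (Suc i))" by (simp only: mult_minus_right)
    then have "x + pi / 2 * of_int j + pi / 2 * of_nat (Suc i) = x" by linarith
    then show ?thesis using nat[of "x + pi / 2 * of_int j" "Suc i"] by (simp only:)
  qed
qed

text \<open>A quarter turn exchanges the two factors of the integrand up to the sign of an argument,
  which evenness absorbs.\<close>

lemma torque_periodic:
  assumes "\<And>x. k (- x) = k x" shows "torque k (\<theta> + pi / 2 * of_int j) = torque k \<theta>"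
proof (rule quarter_turn_periodic)
  fix \<theta>
  have "k (- (y * sin \<theta>) - alpha * cos \<theta>) = k (alpha * cos \<theta> + y * sin \<theta>)" for y
  proof -
    have "- (y * sin \<theta>) - alpha * cos \<theta> = - (alpha * cos \<theta> + y * sin \<theta>)" by simp
    then show ?thesis by (simp only: assms)
  qed
  then show "torque k (\<theta> + pi / 2) = torque k \<theta>"
    unfolding torque_def by (simp add: sin_add cos_add mult_ac)
qed

subsection \<open>Gradient descent\<close>

text \<open>For positive \<open>x\<close>, \<open>\<beta> * M \<le> 1\<close> limits overshooting
  past zero to the error \<open>\<beta> * e\<close>, so the new distance is governed by the lower
  slope \<open>m\<close>. Negative \<open>x\<close> follows by oddness.\<close>

lemma gd_step:
  fixes D :: "real \<Rightarrow> real"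
  assumes D: "\<And>\<theta>. 0 \<le> \<theta> \<Longrightarrow> \<theta> \<le> R \<Longrightarrow> m * \<theta> - e \<le> D \<theta> \<and> D \<theta> \<le> M * \<theta> + e"
    and odd: "\<And>\<theta>. D (- \<theta>) = - D \<theta>" and \<beta>: "0 < \<beta>" "\<beta> * M \<le> 1" "m \<le> M" "0 \<le> e"
    and x: "\<bar>x\<bar> \<le> R"
  shows "\<bar>x - \<beta> * D x\<bar> \<le> (1 - m * \<beta>) * \<bar>x\<bar> + \<beta> * e"
proof -
  have *: "\<bar>\<theta> - \<beta> * D \<theta>\<bar> \<le> (1 - m * \<beta>) * \<theta> + \<beta> * e" if t: "0 \<le> \<theta>" "\<theta> \<le> R" for \<theta>
  proof -
    have "\<beta> * (m * \<theta> - e) \<le> \<beta> * D \<theta>" "\<beta> * D \<theta> \<le> \<beta> * (M * \<theta> + e)"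
      using D[OF t] \<beta> by (auto intro!: mult_left_mono)
    moreover have "\<beta> * M * \<theta> \<le> 1 * \<theta>" using \<beta> t by (intro mult_right_mono) auto
    moreover have "\<beta> * m * \<theta> \<le> \<beta> * M * \<theta>" using \<beta> t by (intro mult_right_mono mult_left_mono) auto
    moreover have "0 \<le> \<beta> * e" using \<beta> by simp
    ultimately show ?thesis by (auto simp: abs_le_iff algebra_simps)
  qed
  show ?thesis
  proof (cases "0 \<le> x")
    case True then show ?thesis using *[of x] x by simp
  next
    case False
    then have "\<bar>- x - \<beta> * D (- x)\<bar> \<le> (1 - m * \<beta>) * (- x) + \<beta> * e" using *[of "- x"] x by simp
    moreover have "\<bar>- x - \<beta> * D (- x)\<bar> = \<bar>x - \<beta> * D x\<bar>" by (simp add: odd)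
    ultimately show ?thesis using False by simp
  qed
qed

text \<open>The error is written as \<open>m * e\<close> so that \<open>e\<close> is the fixed point
  of the linear recursion. \<open>e \<le> R\<close> keeps every iterate where the slope bounds
  hold.\<close>

lemma gd_sequence:
  fixes D :: "real \<Rightarrow> real"
  assumes D: "\<And>\<theta>. 0 \<le> \<theta> \<Longrightarrow> \<theta> \<le> R \<Longrightarrow> m * \<theta> - m * e \<le> D \<theta> \<and> D \<theta> \<le> M * \<theta> + m * e"
    and odd: "\<And>\<theta>. D (- \<theta>) = - D \<theta>" and \<beta>: "0 < \<beta>" "\<beta> * M \<le> 1" "0 < m" "m \<le> M" "0 \<le> e" "e \<le> R"
    and x: "\<bar>x 0\<bar> \<le> R" "\<And>k. x (Suc k) = x k - \<beta> * D (x k)"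
  shows "\<bar>x k\<bar> \<le> (1 - m * \<beta>) ^ k * R + e"
proof -
  have mb: "0 \<le> 1 - m * \<beta>" using \<beta> by (smt (verit) mult.commute mult_left_mono)
  have "\<bar>x k\<bar> \<le> R \<and> \<bar>x k\<bar> \<le> (1 - m * \<beta>) ^ k * R + e"
  proof (induction k)
    case (Suc k)
    then have xR: "\<bar>x k\<bar> \<le> R" by simp
    have "0 \<le> m * e" using \<beta> by simp
    from gd_step[OF D odd \<beta>(1,2,4) this xR]
    have s: "\<bar>x (Suc k)\<bar> \<le> (1 - m * \<beta>) * \<bar>x k\<bar> + \<beta> * (m * e)" using x(2) by simp
    have "(1 - m * \<beta>) * \<bar>x k\<bar> \<le> (1 - m * \<beta>) * R" using mb xR by (intro mult_left_mono)
    moreover have "\<beta> * m * e \<le> \<beta> * m * R" using \<beta> by (intro mult_left_mono) auto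
    ultimately have "\<bar>x (Suc k)\<bar> \<le> R" using s by (simp add: algebra_simps)
    moreover have "(1 - m * \<beta>) * \<bar>x k\<bar> \<le> (1 - m * \<beta>) * ((1 - m * \<beta>) ^ k * R + e)"
      using mb Suc by (intro mult_left_mono) auto
    then have "\<bar>x (Suc k)\<bar> \<le> (1 - m * \<beta>) ^ Suc k * R + e" using s by (simp add: algebra_simps)
    ultimately show ?case by simp
  qed (use x \<beta> in auto)
  then show ?thesis by simp
qed

text \<open>Replaces the remainder by distance to a lattice point, so that each copy of the true
  angle can be treated separately. The inner absolute value disappears because the lattice is
  symmetric.\<close>

lemma rmod_close_iff:
  assumes "0 < m"
  shows "min (rmod \<bar>x\<bar> m) (m - rmod \<bar>x\<bar> m) \<le> e \<longleftrightarrow> (\<exists>j::int. \<bar>x - m * of_int j\<bar> \<le> e)"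
proof -
  define f where "f = \<lfloor>\<bar>x\<bar> / m\<rfloor>"
  define d where "d = \<bar>x\<bar> - m * of_int f"
  have r: "rmod \<bar>x\<bar> m = d" by (simp add: rmod_def d_def f_def)
  have "of_int f \<le> \<bar>x\<bar> / m" "\<bar>x\<bar> / m < of_int f + 1" unfolding f_def by linarith+
  then have d: "0 \<le> d" "d < m" using assms by (auto simp: d_def field_simps)
  have "(\<exists>j::int. \<bar>x - m * of_int j\<bar> \<le> e) \<longleftrightarrow> (\<exists>j::int. \<bar>\<bar>x\<bar> - m * of_int j\<bar> \<le> e)"
  proof (cases "0 \<le> x")
    case False
    have "\<bar>\<bar>x\<bar> - m * of_int j\<bar> = \<bar>x - m * of_int (- j)\<bar>" for j using False by simp
    then show ?thesis by (metis minus_minus)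
  qed simp
  also have "\<dots> \<longleftrightarrow> d \<le> e \<or> m - d \<le> e"
  proof
    assume "d \<le> e \<or> m - d \<le> e"
    then show "\<exists>j::int. \<bar>\<bar>x\<bar> - m * of_int j\<bar> \<le> e"
    proof
      assume "d \<le> e" then show ?thesis using d by (intro exI[of _ f]) (simp add: d_def)
    next
      assume "m - d \<le> e" then show ?thesis using d by (intro exI[of _ "f + 1"]) (simp add: d_def algebra_simps)
    qed
  next
    assume "\<exists>j::int. \<bar>\<bar>x\<bar> - m * of_int j\<bar> \<le> e"
    then obtain j :: int where j: "\<bar>\<bar>x\<bar> - m * of_int j\<bar> \<le> e" by blast
    show "d \<le> e \<or> m - d \<le> e"
    proof (cases "j \<le> f")
      case True
      then have "m * of_int j \<le> m * of_int f" using assms by (intro mult_left_mono) auto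
      then show ?thesis using abs_le_D1[OF j] unfolding d_def by linarith
    next
      case False
      then have "(of_int (f + 1) :: real) \<le> of_int j" by (simp only: of_int_le_iff)
      then have "m * of_int (f + 1) \<le> m * of_int j" using assms by (intro mult_left_mono) auto
      then have "m - d \<le> - (\<bar>x\<bar> - m * of_int j)" by (simp add: d_def algebra_simps)
      then show ?thesis using abs_le_D2[OF j] by linarith
    qed
  qed
  finally show ?thesis unfolding r by (simp add: min_le_iff_disj)
qed

text \<open>Each pair of iterations gains \<open>1 - 2 / pi \<le> 1 / 2 \<le> exp (- 1 / 2)\<close>,
  which explains the 4. The first iteration and the rounding in \<open>div\<close> cost at most
  \<open>exp (1 / 2) \<le> 2\<close>.\<close>

lemma rough_error:
  assumes "0 < x" "x < 1" "real Tr \<ge> - 4 * ln x"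
  shows "(1 - 2 / pi) ^ ((Tr - 1) div 2) \<le> 2 * x"
proof -
  define m where "m = (Tr - 1) div 2"
  have "Tr \<le> 2 * m + 2" unfolding m_def by presburger
  then have "real Tr \<le> 2 * real m + 2" by (metis of_nat_le_iff of_nat_add of_nat_mult of_nat_numeral)
  then have m: "- ln x * 2 - 1 \<le> real m" using assms(3) by simp
  have "1 - 2 / pi \<le> 1 / 2" using pi_less_4 by (simp add: field_simps)
  also have "1 / 2 \<le> exp (- 1 / 2 :: real)" using exp_ge_add_one_self[of "- 1 / 2 :: real"] by simp
  finally have "(1 - 2 / pi) ^ m \<le> exp (- 1 / 2) ^ m"
    using pi_ge_two by (intro power_mono) auto
  also have "\<dots> = exp (- real m / 2)" by (simp add: exp_of_nat_mult[symmetric])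
  also have "\<dots> \<le> exp (1 / 2 + ln x)" using m by simp
  also have "\<dots> = exp (1 / 2) * x" using assms by (simp add: exp_add)
  also have "\<dots> \<le> 2 * x"
  proof -
    have "exp (1 / 2 :: real) = 1 / exp (- 1 / 2)" by (simp add: exp_minus field_simps)
    also have "\<dots> \<le> 2" using exp_ge_add_one_self[of "- 1 / 2 :: real"] by (simp add: field_simps)
    finally show ?thesis using assms by (intro mult_right_mono) auto
  qed
  finally show ?thesis unfolding m_def .
qed

lemma u_rough_facts:
  assumes "1 \<le> Tr"
  shows "1 < \<bar>x\<bar> \<Longrightarrow> u_rough Tr x = 0" "\<bar>u_rough Tr x\<bar> \<le> 5"
proof -
  let ?r = "(1 - 2 / pi) ^ ((Tr - 1) div 2)" and ?L = "sqrt (4 / pi)"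
  have r: "0 \<le> ?r" "?r \<le> 1" using pi_ge_two by (auto intro!: power_le_one zero_le_power)
  note A = u_rough_approx(3)[OF assms, of x]
  show "u_rough Tr x = 0" if "1 < \<bar>x\<bar>" using A cosine_outside[of x] that by simp
  have "4 / pi \<le> 1.2\<^sup>2" using pi_approx by (simp add: field_simps power2_eq_square)
  then have L: "0 \<le> ?L" "?L \<le> 1.2"
    using real_sqrt_le_mono[of "4 / pi" "1.2\<^sup>2"] by auto
  have c: "0 \<le> ?L * cosine x" using L cosine_nonneg by simp
  have c2: "?L * cosine x \<le> 1.2 * 1" using L by (intro mult_mono cosine_le_1 cosine_nonneg) auto
  have "?L * (3 * ?r) * cosine x \<le> 3 * (?L * cosine x)"
    using mult_right_mono[OF r(2), of "3 * (?L * cosine x)"] c by (simp add: mult_ac)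
  moreover have "1.2 * 1 \<le> (5 / 4 :: real)" by simp
  ultimately show "\<bar>u_rough Tr x\<bar> \<le> 5" using A c c2 by linarith
qed

lemma u_rough_deriv_loss:
  assumes "0 < \<sigma>" "1 \<le> Tr"
  defines "k \<equiv> smooth (normal_density 0 (sqrt 2 * \<sigma>)) (u_rough Tr)"
  shows "deriv (\<lambda>v. loss \<sigma> v (u_rough Tr)) \<nu> = - torque k (\<nu> - nu_nat)" "continuous_on UNIV k"
    "k (- x) = k x"
  unfolding k_def
  using deriv_loss[OF assms(1) u_rough_approx(1)[OF assms(2)] u_rough_facts(1)[OF assms(2)]
      u_rough_approx(2)[OF assms(2)] u_rough_facts(2)[OF assms(2)]]
    smooth_normal_even[of "u_rough Tr", OF u_rough_approx(2)[OF assms(2)]] by auto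

text \<open>Supplies measurability of the success event.\<close>

lemma continuous_nu_hat:
  assumes "0 < \<sigma>" "1 \<le> Tr"
  shows "continuous_on UNIV (nu_hat \<sigma> \<beta> Tr Tn)"
proof -
  define k where "k = smooth (normal_density 0 (sqrt 2 * \<sigma>)) (u_rough Tr)"
  have d: "deriv (\<lambda>v. loss \<sigma> v (u_rough Tr)) \<nu> = - torque k (\<nu> - nu_nat)" for \<nu>
    unfolding k_def by (rule u_rough_deriv_loss(1)[OF assms])
  have kc: "continuous_on UNIV k" unfolding k_def by (rule u_rough_deriv_loss(2)[OF assms])
  have "continuous_on UNIV (\<lambda>\<nu>0. gd_iter \<sigma> \<beta> (u_rough Tr) \<nu>0 j)" for j
  proof (induction j)
    case (Suc j)
    then show ?case
      by (auto simp: Let_def d intro!: continuous_intros continuous_on_compose2[OF continuous_torque[OF kc]])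
  qed (simp add: continuous_on_id)
  then show ?thesis unfolding nu_hat_def[abs_def] .
qed

text \<open>Half of \<open>3 * \<epsilon>\<close> is spent on the transient, where
  \<open>pi / 7 \<le> 1 / 2\<close> and \<open>40 = 1 / 0.025\<close>. The other half covers the
  floor \<open>640 * \<delta>\<close> with \<open>640 = 16 / 0.025\<close>, since \<open>\<delta>
  \<le> 6 * \<sigma>\<^sup>2 * \<epsilon> \<le> 6 / 10 ^ 4 * \<epsilon>\<close>. Periodicity of the
  torque reduces every \<open>j\<close> to the origin.\<close>

lemma gd_convergence:
  assumes \<sigma>: "0 < \<sigma>" "\<sigma>\<^sup>2 \<le> 1 / 10 ^ 4" and \<beta>: "0 < \<beta>" "\<beta> \<le> 1 / 16" and \<epsilon>: "0 < \<epsilon>" "\<epsilon> \<le> 1 / 768"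
    and Tr: "1 \<le> Tr" "real Tr \<ge> - 4 * ln (\<sigma>\<^sup>2 * \<epsilon>)" and Tn: "real Tn \<ge> - 40 * ln (3 * \<epsilon>) / \<beta>"
    and start: "\<bar>\<nu>0 - nu_nat - pi / 2 * of_int j\<bar> \<le> pi / 7"
  shows "\<bar>nu_hat \<sigma> \<beta> Tr Tn \<nu>0 - nu_nat - pi / 2 * of_int j\<bar> \<le> 3 * \<epsilon>"
proof -
  define \<tau> where "\<tau> = sqrt 2 * \<sigma>"
  interpret gaussian_width \<tau>
    by unfold_locales (use \<sigma> in \<open>auto simp: \<tau>_def power_mult_distrib\<close>)
  define \<delta> where "\<delta> = 3 * (1 - 2 / pi) ^ ((Tr - 1) div 2)"
  have x: "0 < \<sigma>\<^sup>2 * \<epsilon>" "\<sigma>\<^sup>2 * \<epsilon> \<le> 1 / 10 ^ 4 * \<epsilon>" using \<sigma> \<epsilon> by (auto intro!: mult_right_mono)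
  have "1 / 10 ^ 4 * \<epsilon> < 1" using \<epsilon> by simp
  with x(2) have x1: "\<sigma>\<^sup>2 * \<epsilon> < 1" by (rule le_less_trans)
  have "\<delta> \<le> 3 * (2 * (\<sigma>\<^sup>2 * \<epsilon>))"
    unfolding \<delta>_def by (intro mult_left_mono rough_error x x1 Tr) simp
  then have \<delta>: "\<delta> \<le> 6 / 10 ^ 4 * \<epsilon>" using x by simp
  have \<delta>0: "0 \<le> \<delta>" unfolding \<delta>_def using pi_ge_two by (auto intro!: zero_le_power)
  let ?u = "u_rough Tr"
  define k where "k = smooth (normal_density 0 \<tau>) ?u"
  note dl = u_rough_deriv_loss[OF \<sigma>(1) Tr(1), folded \<tau>_def, folded k_def]
  have ud: "\<bar>?u s - sqrt (4 / pi) * cosine s\<bar> \<le> sqrt (4 / pi) * \<delta>" for s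
  proof -
    have "sqrt (4 / pi) * \<delta> * cosine s \<le> sqrt (4 / pi) * \<delta> * 1"
      using \<delta>0 cosine_le_1 by (intro mult_left_mono) auto
    then show ?thesis using u_rough_approx(3)[OF Tr(1), of s] unfolding \<delta>_def by linarith
  qed
  define y where "y i = gd_iter \<sigma> \<beta> ?u \<nu>0 i - nu_nat - pi / 2 * of_int j" for i
  have "\<bar>y Tn\<bar> \<le> (1 - 0.025 * \<beta>) ^ Tn * (pi / 7) + 640 * \<delta>"
  proof (rule gd_sequence[where D = "\<lambda>\<theta>. - torque k \<theta>" and M = 16])
    fix \<theta> :: real assume t: "0 \<le> \<theta>" "\<theta> \<le> pi / 7"
    have d1: "\<delta> \<le> 1" using \<delta> \<epsilon> by simp
    show "0.025 * \<theta> - 0.025 * (640 * \<delta>) \<le> - torque k \<theta> \<and> - torque k \<theta> \<le> 16 * \<theta> + 0.025 * (640 * \<delta>)"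
      using torque_rough[OF u_rough_approx(1)[OF Tr(1)] \<delta>0 d1 ud _ t] dl(2) unfolding k_def by simp
  next
    show "640 * \<delta> \<le> pi / 7" using \<delta> \<epsilon> pi_ge_two by simp
    show "- torque k (- \<theta>) = - (- torque k \<theta>)" for \<theta> by (simp add: torque_minus[of k, OF dl(3)])
    show "\<bar>y 0\<bar> \<le> pi / 7" using start by (simp add: y_def)
    fix i
    have "torque k (gd_iter \<sigma> \<beta> ?u \<nu>0 i - nu_nat) = torque k (y i)"
      using torque_periodic[of k "y i" j, OF dl(3)] by (simp add: y_def)
    then show "y (Suc i) = y i - \<beta> * - torque k (y i)"
      by (simp add: y_def Let_def dl(1))
  qed (use \<beta> \<delta>0 in auto)
  moreover have "(1 - 0.025 * \<beta>) ^ Tn * (pi / 7) \<le> 3 * \<epsilon> * (1 / 2)"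
  proof (rule mult_mono)
    have "(1 - 0.025 * \<beta>) ^ Tn \<le> exp (- 0.025 * \<beta>) ^ Tn"
      using \<beta> exp_ge_add_one_self[of "- 0.025 * \<beta>"] by (intro power_mono) auto
    also have "\<dots> = exp (real Tn * (- 0.025 * \<beta>))" by (simp only: exp_of_nat_mult)
    also have "\<dots> \<le> exp (ln (3 * \<epsilon>))"
      using Tn \<beta> by (simp add: field_simps)
    also have "\<dots> = 3 * \<epsilon>" using \<epsilon> by simp
    finally show "(1 - 0.025 * \<beta>) ^ Tn \<le> 3 * \<epsilon>" .
  qed (use pi_approx \<epsilon> in auto)
  moreover have "640 * \<delta> \<le> 3 * \<epsilon> * (1 / 2)" using \<delta> \<epsilon> by simp
  ultimately show ?thesis by (simp add: y_def nu_hat_def)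
qed

text \<open>The intervals around \<open>pi / 4 + pi / 2 * j\<close> for \<open>j < 4\<close> stay
  inside \<open>{0..2 * pi}\<close> because \<open>pi / 7 < pi / 4\<close>, and for the same reason
  they are disjoint. Their total length is \<open>8 * pi / 7\<close>.\<close>

lemma measure_good_starts:
  assumes S: "S \<in> sets borel"
    and good: "\<And>\<nu> j. \<bar>\<nu> - nu_nat - pi / 2 * of_int j\<bar> \<le> pi / 7 \<Longrightarrow> \<nu> \<in> S"
  shows "4 / 7 \<le> measure (uniform_measure lborel {0..2 * pi}) S"
proof -
  define I where "I j = {pi / 4 + pi / 2 * real j - pi / 7..pi / 4 + pi / 2 * real j + pi / 7}" for j
  have IS: "I j \<subseteq> S" for j
  proof
    fix \<nu> assume "\<nu> \<in> I j"
    then have "\<bar>\<nu> - nu_nat - pi / 2 * of_int (int j)\<bar> \<le> pi / 7"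
      unfolding abs_le_iff by (auto simp: I_def nu_nat_def)
    then show "\<nu> \<in> S" by (rule good)
  qed
  have IA: "I j \<subseteq> {0..2 * pi}" if "j < 4" for j
  proof -
    have "real j \<le> 3" using that by simp
    then have "pi / 2 * real j \<le> pi / 2 * 3" by (intro mult_left_mono) auto
    moreover have "0 \<le> pi / 2 * real j" by simp
    ultimately show ?thesis using pi_gt_zero unfolding I_def by (auto, linarith+)
  qed
  have disj: "disjoint_family_on I {..<4}"
  proof (clarsimp simp: disjoint_family_on_def)
    fix i j :: nat assume "i \<noteq> j"
    have *: "I i \<inter> I j = {}" if "i < j" for i j
    proof -
      have "real i + 1 \<le> real j" using that by simp
      then have "pi / 2 * (real i + 1) \<le> pi / 2 * real j" by (intro mult_left_mono) auto
      then show ?thesis using pi_gt_zero unfolding I_def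
        by (auto simp: algebra_simps) (use pi_gt_zero in linarith)
    qed
    show "I i \<inter> I j = {}" using *[of i j] *[of j i] \<open>i \<noteq> j\<close> by (cases "i < j") auto
  qed
  have "measure lborel (\<Union>j\<in>{..<4}. I j) = (\<Sum>j\<in>{..<4::nat}. measure lborel (I j))"
    by (rule measure_finite_Union[OF _ _ disj]) (auto simp: I_def)
  also have "\<dots> = 8 * pi / 7" by (simp add: I_def)
  finally have U: "measure lborel (\<Union>j\<in>{..<4}. I j) = 8 * pi / 7" .
  have "measure lborel (\<Union>j\<in>{..<4}. I j) \<le> measure lborel ({0..2 * pi} \<inter> S)"
  proof (rule measure_mono_fmeasurable)
    show "(\<Union>j\<in>{..<4}. I j) \<subseteq> {0..2 * pi} \<inter> S" using IS IA by blast
    show "(\<Union>j\<in>{..<4}. I j) \<in> sets lborel" by (auto simp: I_def)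
    show "{0..2 * pi} \<inter> S \<in> fmeasurable lborel"
      using S by (intro fmeasurable_Int_fmeasurable fmeasurableI) auto
  qed
  then have "8 * pi / 7 \<le> measure lborel ({0..2 * pi} \<inter> S)" unfolding U .
  then have "8 * pi / 7 / (2 * pi) \<le> measure lborel ({0..2 * pi} \<inter> S) / (2 * pi)"
    by (intro divide_right_mono) auto
  also have "\<dots> = measure (uniform_measure lborel {0..2 * pi}) S"
    using S by (subst measure_uniform_measure) auto
  finally show ?thesis by simp
qed

subsection \<open>The power method near the template\<close>

text \<open>A class on which all inner products exist. It contains the template and the rough
  estimate, and the rotated squares lie in the unit disc, so \<open>Aop\<close> preserves
  it.\<close>

definition supported :: "(real \<Rightarrow> real) \<Rightarrow> bool" where
  "supported f \<longleftrightarrow> f \<in> borel_measurable borel \<and> (\<exists>B. \<forall>x. \<bar>f x\<bar> \<le> B * indicator {-1..1} x)"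

lemma supportedI: "f \<in> borel_measurable borel \<Longrightarrow> (\<And>x. \<bar>f x\<bar> \<le> B * indicator {-1..1} x) \<Longrightarrow> supported f"
  unfolding supported_def by blast

lemma supported_meas: "supported f \<Longrightarrow> f \<in> borel_measurable borel"
  unfolding supported_def by blast

lemma supported_unit:
  assumes "f \<in> borel_measurable borel" "\<And>x. \<bar>f x\<bar> \<le> 1" "\<And>x. f x \<noteq> 0 \<Longrightarrow> \<bar>x\<bar> \<le> 1"
  shows "supported f"
proof (rule supportedI[OF assms(1), of 1])
  show "\<bar>f x\<bar> \<le> 1 * indicator {-1..1} x" for x
    using assms(2,3)[of x] by (cases "f x = 0") (auto simp: indicator_def)
qed

lemma supported_mult:
  assumes "supported f" "supported g"
  shows "supported (\<lambda>x. f x * g x)"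
proof -
  from assms obtain A B where A: "\<And>x. \<bar>f x\<bar> \<le> A * indicator {-1..1} x" and B: "\<And>x. \<bar>g x\<bar> \<le> B * indicator {-1..1} x"
    by (auto simp: supported_def)
  show ?thesis
  proof (rule supportedI[of _ "A * B"])
    show "(\<lambda>x. f x * g x) \<in> borel_measurable borel"
      using supported_meas[OF assms(1)] supported_meas[OF assms(2)] by measurable
    fix x
    have "\<bar>f x\<bar> * \<bar>g x\<bar> \<le> (A * indicator {-1..1} x) * (B * indicator {-1..1} x)"
      by (intro mult_mono A B order_trans[OF abs_ge_zero A]) auto
    then show "\<bar>f x * g x\<bar> \<le> A * B * indicator {-1..1} x" by (auto simp: abs_mult indicator_def)
  qed
qed

lemma supported_integrable:
  assumes "supported f" shows "integrable lborel f"
proof -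
  from assms obtain B where B: "\<And>x. \<bar>f x\<bar> \<le> B * indicator {-1..1} x" by (auto simp: supported_def)
  show ?thesis
  proof (rule Bochner_Integration.integrable_bound)
    show "integrable lborel (\<lambda>x. B * indicator {-1..1::real} x)" by simp
    show "f \<in> borel_measurable lborel" using supported_meas[OF assms] by simp
    show "AE x in lborel. norm (f x) \<le> norm (B * indicator {-1..1} x)"
      using B by (intro AE_I2) (simp add: order_trans[OF _ abs_ge_self])
  qed
qed

lemma supported_scale: assumes "supported f" shows "supported (\<lambda>x. c * f x)"
proof -
  from assms obtain B where B: "\<And>x. \<bar>f x\<bar> \<le> B * indicator {-1..1} x" by (auto simp: supported_def)
  show ?thesis
  proof (rule supportedI[of _ "\<bar>c\<bar> * B"])
    show "(\<lambda>x. c * f x) \<in> borel_measurable borel" using supported_meas[OF assms] by measurable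
    show "\<bar>c * f x\<bar> \<le> \<bar>c\<bar> * B * indicator {-1..1} x" for x
      using mult_left_mono[OF B[of x], of "\<bar>c\<bar>"] by (simp add: abs_mult mult.assoc)
  qed
qed

lemma supported_add: assumes "supported f" "supported g" shows "supported (\<lambda>x. f x + g x)"
proof -
  from assms obtain A B where A: "\<And>x. \<bar>f x\<bar> \<le> A * indicator {-1..1} x" and B: "\<And>x. \<bar>g x\<bar> \<le> B * indicator {-1..1} x"
    by (auto simp: supported_def)
  show ?thesis
  proof (rule supportedI[of _ "A + B"])
    show "(\<lambda>x. f x + g x) \<in> borel_measurable borel"
      using supported_meas[OF assms(1)] supported_meas[OF assms(2)] by measurable
    show "\<bar>f x + g x\<bar> \<le> (A + B) * indicator {-1..1} x" for x
      using A[of x] B[of x] abs_triangle_ineq[of "f x" "g x"] by (simp add: distrib_right)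
  qed
qed

lemma supported_diff: assumes "supported f" "supported g" shows "supported (\<lambda>x. f x - g x)"
  using supported_add[OF assms(1) supported_scale[OF assms(2), of "-1"]] by simp

section \<open>Inner product and norm on bounded functions supported in
  \<open>[-1, 1]\<close>\<close>

lemma inner_commute: "inner_L2 f g = inner_L2 g f"
  by (simp add: inner_L2_def mult.commute)

lemma inner_add: "supported f \<Longrightarrow> supported g \<Longrightarrow> supported h \<Longrightarrow> inner_L2 h (\<lambda>x. f x + g x) = inner_L2 h f + inner_L2 h g"
  using supported_integrable[OF supported_mult, of h f] supported_integrable[OF supported_mult, of h g]
  by (simp add: inner_L2_def distrib_left)

lemma inner_scale: "inner_L2 h (\<lambda>x. c * f x) = c * inner_L2 h f"
  by (simp add: inner_L2_def mult.left_commute)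

lemma L2norm_sq: "(L2norm f)\<^sup>2 = inner_L2 f f"
  by (simp add: L2norm_def inner_L2_def power2_eq_square[symmetric])

lemma L2norm_nonneg: "0 \<le> L2norm f"
  by (simp add: L2norm_def)

lemma L2norm_add_sq:
  assumes "supported f" "supported g"
  shows "(L2norm (\<lambda>x. f x + c * g x))\<^sup>2 = (L2norm f)\<^sup>2 + 2 * c * inner_L2 f g + c\<^sup>2 * (L2norm g)\<^sup>2"
proof -
  note cg = supported_scale[OF assms(2), of c]
  have s: "inner_L2 (\<lambda>x. f x + c * g x) h = inner_L2 f h + c * inner_L2 g h" if "supported h" for h
    using inner_add[OF assms(1) cg that] inner_scale[of h c g]
    by (simp add: inner_commute[of _ h])
  show ?thesis
    unfolding L2norm_sq using s[OF supported_add[OF assms(1) cg]] s[OF assms(1)] s[OF assms(2)]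
    by (simp add: inner_commute[of f "\<lambda>x. f x + c * g x"] inner_commute[of g "\<lambda>x. f x + c * g x"]
          inner_commute[of g f] power2_eq_square algebra_simps)
qed

lemma cauchy_schwarz:
  assumes "supported f" "supported g"
  shows "\<bar>inner_L2 f g\<bar> \<le> L2norm f * L2norm g"
proof -
  let ?F = "L2norm f" and ?G = "L2norm g" and ?i = "inner_L2 f g"
  have *: "0 \<le> ?F\<^sup>2 + 2 * c * ?i + c\<^sup>2 * ?G\<^sup>2" for c
    using L2norm_add_sq[OF assms, of c] by (metis zero_le_power2)
  have "?i\<^sup>2 \<le> (?F * ?G)\<^sup>2"
  proof (cases "?G = 0")
    case True
    have "?i = 0"
    proof (rule ccontr)
      assume "?i \<noteq> 0"
      \<comment> \<open>With \<open>?G = 0\<close> the quadratic is affine in \<open>c\<close>, and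
        this choice gives it the value \<open>- 1\<close>.\<close>
      then show False using *[of "- (?F\<^sup>2 + 1) / (2 * ?i)"] True by (simp add: field_simps)
    qed
    then show ?thesis by simp
  next
    case False
    have "0 \<le> (?F\<^sup>2 + 2 * (- ?i / ?G\<^sup>2) * ?i + (- ?i / ?G\<^sup>2)\<^sup>2 * ?G\<^sup>2) * ?G\<^sup>2"
      using *[of "- ?i / ?G\<^sup>2"] by (intro mult_nonneg_nonneg) auto
    also have "\<dots> = (?F * ?G)\<^sup>2 - ?i\<^sup>2"
      using False by (simp add: field_simps power2_eq_square)
    finally show ?thesis by simp
  qed
  then have "\<bar>?i\<bar> \<le> \<bar>?F * ?G\<bar>" by (simp only: abs_le_square_iff)
  then show ?thesis by (simp add: L2norm_nonneg)
qed

lemma L2norm_triangle: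
  assumes "supported f" "supported g"
  shows "L2norm (\<lambda>x. f x + g x) \<le> L2norm f + L2norm g"
proof (rule power2_le_imp_le)
  have "inner_L2 f g \<le> L2norm f * L2norm g" using cauchy_schwarz[OF assms] by simp
  then show "(L2norm (\<lambda>x. f x + g x))\<^sup>2 \<le> (L2norm f + L2norm g)\<^sup>2"
    using L2norm_add_sq[OF assms, of 1] by (simp add: power2_sum)
qed (simp add: L2norm_nonneg)

lemma u_nat_supported: "supported u_nat"
  by (rule supportedI[of _ 1]) (use alpha_bounds in \<open>auto simp: u_nat_def indicator_def\<close>)

text \<open>The norm is the fourth root of 2. Its excess over 1 is the margin that keeps the power
  iteration in its basin.\<close>

lemma u_nat_norm: "(L2norm u_nat)\<^sup>2 = 2 * alpha" "1.189 \<le> L2norm u_nat"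
proof -
  have "inner_L2 u_nat u_nat = (\<integral>x. indicator {-alpha..alpha} x \<partial>lborel)"
    unfolding inner_L2_def u_nat_def by (intro Bochner_Integration.integral_cong) (auto simp: indicator_def)
  then show 1: "(L2norm u_nat)\<^sup>2 = 2 * alpha" using alpha_bounds(1) by (simp add: L2norm_sq)
  have "0.707 \<le> alpha"
    by (rule power2_le_imp_le) (use alpha_bounds(1,2) in \<open>auto simp: alpha_def power_divide power2_eq_square\<close>)
  then have "1.189\<^sup>2 \<le> (L2norm u_nat)\<^sup>2" unfolding 1 by (simp add: power2_eq_square)
  then show "1.189 \<le> L2norm u_nat" by (rule power2_le_imp_le) (rule L2norm_nonneg)
qed

section \<open>The template under a small rotation\<close>

definition kernel_diff :: "real \<Rightarrow> real \<times> real \<Rightarrow> real" where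
  "kernel_diff \<theta> p = X_nat (rot \<theta> p) - X_nat p"

definition strip :: "real \<Rightarrow> real \<Rightarrow> real" where
  "strip \<theta> = (\<lambda>x. indicator {alpha - \<theta>..alpha + \<theta>} x + indicator {- alpha - \<theta>..- alpha + \<theta>} x)"

lemma norm_X_nat: "X_nat p \<noteq> 0 \<Longrightarrow> norm p \<le> 1"
proof (cases p)
  case (Pair s t)
  assume "X_nat p \<noteq> 0"
  then have "\<bar>s\<bar> \<le> alpha" "\<bar>t\<bar> \<le> alpha" by (auto simp: Pair X_nat_def outer_def u_nat_def indicator_def split: if_splits)
  then have "s\<^sup>2 \<le> alpha\<^sup>2" "t\<^sup>2 \<le> alpha\<^sup>2" using alpha_bounds(1) by (auto simp: abs_le_square_iff[symmetric])
  then have "s\<^sup>2 + t\<^sup>2 \<le> 1" using alpha_bounds(2) by (simp add: power2_eq_square)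
  then show ?thesis by (simp add: Pair norm_Pair)
qed

lemma norm_rot_diff: "norm (rot \<theta> p - p) \<le> \<bar>\<theta>\<bar> * norm p"
proof (cases p)
  case (Pair s t)
  have "(cos \<theta> * s - sin \<theta> * t - s)\<^sup>2 + (sin \<theta> * s + cos \<theta> * t - t)\<^sup>2
      = ((sin \<theta>)\<^sup>2 + (cos \<theta>)\<^sup>2 + 1 - 2 * cos \<theta>) * (s\<^sup>2 + t\<^sup>2)" by algebra
  also have "\<dots> = (2 - 2 * cos \<theta>) * (s\<^sup>2 + t\<^sup>2)" by simp
  also have "\<dots> \<le> \<theta>\<^sup>2 * (s\<^sup>2 + t\<^sup>2)"
    using cos_ge_quadratic[of \<theta>] by (intro mult_right_mono) auto
  finally have "sqrt ((cos \<theta> * s - sin \<theta> * t - s)\<^sup>2 + (sin \<theta> * s + cos \<theta> * t - t)\<^sup>2) \<le> sqrt (\<theta>\<^sup>2 * (s\<^sup>2 + t\<^sup>2))"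
    by (rule real_sqrt_le_mono)
  then show ?thesis by (simp add: Pair rot_def norm_Pair real_sqrt_mult)
qed

lemma kernel_diff_support:
  assumes "kernel_diff \<theta> (s, t) \<noteq> 0"
  shows "norm (s, t) \<le> 1" "\<bar>s\<bar> \<le> 1" "\<bar>t\<bar> \<le> 1"
proof -
  have "X_nat (s, t) \<noteq> 0 \<or> X_nat (rot \<theta> (s, t)) \<noteq> 0" using assms by (auto simp: kernel_diff_def)
  then show n: "norm (s, t) \<le> 1" using norm_X_nat[of "(s, t)"] norm_X_nat[of "rot \<theta> (s, t)"] by auto
  then show "\<bar>s\<bar> \<le> 1" "\<bar>t\<bar> \<le> 1" using norm_fst_le[of s t] norm_snd_le[of t s] by auto
qed

text \<open>The square lies in the unit disc, so its points and those of its rotated copy move by at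
  most \<open>e\<close>. If exactly one of a point and its image is in the square, some coordinate
  crosses \<open>alpha\<close> in absolute value and hence lies within \<open>e\<close> of
  it.\<close>

lemma kernel_diff_bound:
  assumes "\<bar>\<theta>\<bar> \<le> e"
  shows "\<bar>kernel_diff \<theta> (s, t)\<bar> \<le> strip e s * indicator {-1..1} t + indicator {-1..1} s * strip e t"
    and "\<bar>kernel_diff \<theta> (s, t)\<bar> \<le> 1"
proof -
  have X01: "X_nat p = 0 \<or> X_nat p = 1" for p by (simp add: X_nat_indicator indicator_def)
  show "\<bar>kernel_diff \<theta> (s, t)\<bar> \<le> 1"
    using X01[of "(s, t)"] X01[of "rot \<theta> (s, t)"] by (auto simp: kernel_diff_def)
  show "\<bar>kernel_diff \<theta> (s, t)\<bar> \<le> strip e s * indicator {-1..1} t + indicator {-1..1} s * strip e t"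
  proof (cases "kernel_diff \<theta> (s, t) = 0")
    case True
    then show ?thesis by (simp add: strip_def)
  next
    case False
    obtain s' t' where r: "rot \<theta> (s, t) = (s', t')" by (cases "rot \<theta> (s, t)")
    note n = kernel_diff_support(1)[OF False] and st = kernel_diff_support(2,3)[OF False]
    have "norm (rot \<theta> (s, t) - (s, t)) \<le> e"
      using norm_rot_diff[of \<theta> "(s, t)"] mult_left_le[OF n, of "\<bar>\<theta>\<bar>"] assms by linarith
    then have d: "\<bar>s' - s\<bar> \<le> e" "\<bar>t' - t\<bar> \<le> e"
      unfolding r using norm_fst_le[of "s' - s" "t' - t"] norm_snd_le[of "t' - t" "s' - s"] by auto
    have X: "X_nat (a, b) = (if \<bar>a\<bar> \<le> alpha \<and> \<bar>b\<bar> \<le> alpha then 1 else 0)" for a b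
      by (auto simp: X_nat_def outer_def u_nat_def indicator_def)
    have "(\<bar>s\<bar> \<le> alpha \<and> \<bar>t\<bar> \<le> alpha) \<noteq> (\<bar>s'\<bar> \<le> alpha \<and> \<bar>t'\<bar> \<le> alpha)"
      using False unfolding kernel_diff_def r X by (auto split: if_splits)
    then have ne: "(\<bar>s\<bar> \<le> alpha \<and> alpha < \<bar>s'\<bar>) \<or> (\<bar>t\<bar> \<le> alpha \<and> alpha < \<bar>t'\<bar>)
      \<or> (alpha < \<bar>s\<bar> \<and> \<bar>s'\<bar> \<le> alpha) \<or> (alpha < \<bar>t\<bar> \<and> \<bar>t'\<bar> \<le> alpha)"
      by (auto simp: not_le)
    have b: "\<bar>s'\<bar> \<le> \<bar>s\<bar> + e" "\<bar>s\<bar> \<le> \<bar>s'\<bar> + e" "\<bar>t'\<bar> \<le> \<bar>t\<bar> + e" "\<bar>t\<bar> \<le> \<bar>t'\<bar> + e"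
      using d by linarith+
    have or: "\<bar>\<bar>s\<bar> - alpha\<bar> \<le> e \<or> \<bar>\<bar>t\<bar> - alpha\<bar> \<le> e"
      unfolding abs_le_iff[of "\<bar>s\<bar> - alpha"] abs_le_iff[of "\<bar>t\<bar> - alpha"] using ne b assms abs_ge_zero[of \<theta>]
      by (elim disjE conjE) (auto simp: abs_if split: if_splits)
    have S: "1 \<le> strip e a" if "\<bar>\<bar>a\<bar> - alpha\<bar> \<le> e" for a
      using that by (cases "0 \<le> a") (auto simp: strip_def indicator_def)
    have S0: "0 \<le> strip e a" for a by (simp add: strip_def)
    have "1 \<le> strip e s + strip e t" using or S[of s] S[of t] S0[of s] S0[of t] by linarith
    moreover have "indicator {-1..1} s = (1::real)" "indicator {-1..1} t = (1::real)" using st by (auto simp: indicator_def abs_le_iff)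
    moreover have "\<bar>kernel_diff \<theta> (s, t)\<bar> \<le> 1" by fact
    ultimately show ?thesis by simp
  qed
qed

lemma strip_integral:
  assumes "0 \<le> e" shows "integrable lborel (strip e)" "(\<integral>x. strip e x \<partial>lborel) = 4 * e"
  using assms by (auto simp: strip_def)

lemma kernel_diff_meas [measurable]: "kernel_diff \<theta> \<in> borel_measurable borel"
  unfolding kernel_diff_def[abs_def] by measurable

text \<open>Hilbert--Schmidt bound: Cauchy--Schwarz in each slice, then integrate the slice lengths.\<close>

lemma kernel_operator_bound:
  fixes K :: "real \<Rightarrow> real \<Rightarrow> real"
  assumes K[measurable]: "case_prod K \<in> borel_measurable (borel \<Otimes>\<^sub>M borel)"
    and K1: "\<And>s t. \<bar>K s t\<bar> \<le> 1"
    and Ks: "\<And>s t. \<bar>K s t\<bar> \<le> strip e s * indicator {-1..1} t + indicator {-1..1} s * strip e t"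
    and supp: "\<And>s t. K s t \<noteq> 0 \<Longrightarrow> \<bar>s\<bar> \<le> 1 \<and> \<bar>t\<bar> \<le> 1"
    and e: "0 \<le> e" and w: "supported w"
  defines "R \<equiv> (\<lambda>s. \<integral>t. K s t * w t \<partial>lborel)"
  shows "supported R" "L2norm R \<le> 4 * sqrt e * L2norm w"
proof -
  have wm[measurable]: "w \<in> borel_measurable borel" by (rule supported_meas[OF w])
  have Kadm: "supported (K s)" for s
    using measurable_Pair2[OF K, of s] K1 supp by (intro supported_unit) auto
  have Rm: "R \<in> borel_measurable borel" unfolding R_def by measurable
  \<comment> \<open>The strip bound integrated over \<open>t\<close>; it bounds the square of the
    slice norm because \<open>\<bar>K s t\<bar> \<le> 1\<close>. Its integral over \<open>s\<close>
    is \<open>16 * e\<close>.\<close>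
  let ?l = "\<lambda>s. 2 * strip e s + 4 * e * indicator {-1..1} s"
  have Ksq: "(L2norm (K s))\<^sup>2 \<le> ?l s" for s
  proof -
    have "(\<integral>t. K s t * K s t \<partial>lborel) \<le> (\<integral>t. strip e s * indicator {-1..1} t + indicator {-1..1} s * strip e t \<partial>lborel)"
    proof (rule integral_mono)
      show "integrable lborel (\<lambda>t. K s t * K s t)" by (intro supported_integrable supported_mult Kadm)
      show "integrable lborel (\<lambda>t. strip e s * indicator {-1..1} t + indicator {-1..1} s * strip e t)"
        using strip_integral[OF e] by auto
      fix t
      have "K s t * K s t \<le> \<bar>K s t\<bar>"
        using mult_left_le[OF K1[of s t], of "\<bar>K s t\<bar>"] by (simp flip: abs_mult)
      then show "K s t * K s t \<le> strip e s * indicator {-1..1} t + indicator {-1..1} s * strip e t"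
        using Ks[of s t] by linarith
    qed
    also have "\<dots> = ?l s" using strip_integral[OF e] by simp
    finally show ?thesis by (simp add: L2norm_sq inner_L2_def)
  qed
  have R_le: "\<bar>R s\<bar> \<le> L2norm (K s) * L2norm w" for s
    using cauchy_schwarz[OF Kadm w, of s] by (simp add: inner_L2_def R_def)
  have K2: "L2norm (K s) \<le> 2" for s
  proof (rule power2_le_imp_le)
    have "(\<integral>t. K s t * K s t \<partial>lborel) \<le> (\<integral>t. 1 * indicator {-1..1::real} t \<partial>lborel)"
    proof (rule integral_mono)
      show "integrable lborel (\<lambda>t. K s t * K s t)" by (intro supported_integrable supported_mult Kadm)
      fix t
      have "K s t * K s t \<le> 1" using K1[of s t] by (simp add: abs_square_le_1 flip: power2_eq_square)
      then show "K s t * K s t \<le> 1 * indicator {-1..1} t"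
        using supp[of s t] by (cases "K s t = 0") (auto simp: indicator_def)
    qed simp
    then show "(L2norm (K s))\<^sup>2 \<le> 2\<^sup>2" by (simp add: L2norm_sq inner_L2_def)
  qed simp
  show Radm: "supported R"
  proof (rule supportedI[OF Rm, of "2 * L2norm w"])
    fix s
    show "\<bar>R s\<bar> \<le> 2 * L2norm w * indicator {-1..1} s"
    proof (cases "\<bar>s\<bar> \<le> 1")
      case True
      then show ?thesis
        using order_trans[OF R_le mult_right_mono[OF K2 L2norm_nonneg]] by (auto simp: indicator_def)
    next
      case False
      then have "K s t = 0" for t using supp by blast
      then have "R s = 0" by (simp add: R_def)
      then show ?thesis by (simp add: L2norm_nonneg)
    qed
  qed
  show "L2norm R \<le> 4 * sqrt e * L2norm w"
  proof (rule power2_le_imp_le)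
    have "(\<integral>s. R s * R s \<partial>lborel) \<le> (\<integral>s. (L2norm w)\<^sup>2 * ?l s \<partial>lborel)"
    proof (rule integral_mono)
      show "integrable lborel (\<lambda>s. R s * R s)" by (intro supported_integrable supported_mult Radm)
      show "integrable lborel (\<lambda>s. (L2norm w)\<^sup>2 * ?l s)" using strip_integral[OF e] by auto
      fix s
      have "R s * R s = \<bar>R s\<bar>\<^sup>2" by (simp add: power2_eq_square)
      also have "\<dots> \<le> (L2norm (K s) * L2norm w)\<^sup>2" by (intro power_mono R_le) simp
      also have "\<dots> \<le> (L2norm w)\<^sup>2 * ?l s"
        using mult_left_mono[OF Ksq[of s], of "(L2norm w)\<^sup>2"] by (simp add: power_mult_distrib mult.commute)
      finally show "R s * R s \<le> (L2norm w)\<^sup>2 * ?l s" .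
    qed
    also have "\<dots> = (L2norm w)\<^sup>2 * (16 * e)" using strip_integral[OF e] by simp
    finally show "(L2norm R)\<^sup>2 \<le> (4 * sqrt e * L2norm w)\<^sup>2"
      using e by (simp add: L2norm_sq[of R] inner_L2_def power_mult_distrib mult_ac)
  qed (use e in \<open>simp add: L2norm_nonneg\<close>)
qed

lemma X_nat_rot_periodic: "X_nat (rot (\<theta> + pi / 2 * of_int j) p) = X_nat (rot \<theta> p)"
proof (rule quarter_turn_periodic)
  fix \<theta>
  have u: "u_nat (- x) = u_nat x" for x by (auto simp: u_nat_def indicator_def)
  have "X_nat (rot (pi / 2) q) = X_nat q" for q
    by (cases q) (simp add: rot_def X_nat_def outer_def u mult.commute)
  then show "X_nat (rot (\<theta> + pi / 2) p) = X_nat (rot \<theta> p)"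
    using rot_add[of "pi / 2" \<theta> p] by (metis add.commute)
qed

text \<open>Modulo quarter turns the kernel is \<open>outer u_nat\<close> plus
  \<open>kernel_diff\<close>. Operator and adjoint leave one residual each, and \<open>r\<close> is
  their mean.\<close>

lemma Aop_decomposition:
  assumes \<nu>: "\<bar>\<nu> - nu_nat - pi / 2 * of_int j\<bar> \<le> e" and w: "supported w"
  obtains r where "supported r" "L2norm r \<le> 4 * sqrt e * L2norm w"
    "Aop \<nu> w = (\<lambda>s. 2 * (inner_L2 u_nat w * u_nat s + r s))"
proof -
  define \<theta> where "\<theta> = \<nu> - nu_nat - pi / 2 * of_int j"
  have e: "0 \<le> e" "\<bar>\<theta>\<bar> \<le> e" using \<nu> by (auto simp: \<theta>_def)
  have X: "X_nat (rot (\<nu> - nu_nat) (s, t)) = u_nat s * u_nat t + kernel_diff \<theta> (s, t)" for s t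
    using X_nat_rot_periodic[of \<theta> j "(s, t)"] by (simp add: \<theta>_def kernel_diff_def X_nat_def outer_def)
  let ?K1 = "\<lambda>s t. kernel_diff \<theta> (s, t)" and ?K2 = "\<lambda>s t. kernel_diff \<theta> (t, s)"
  define R1 where "R1 = (\<lambda>s. \<integral>t. ?K1 s t * w t \<partial>lborel)"
  define R2 where "R2 = (\<lambda>s. \<integral>t. ?K2 s t * w t \<partial>lborel)"
  have kd: "kernel_diff \<theta> \<in> borel_measurable (borel \<Otimes>\<^sub>M borel)"
    using kernel_diff_meas[of \<theta>] by (simp add: borel_prod)
  note kd[measurable]
  have b: "\<bar>?K2 s t\<bar> \<le> strip e s * indicator {-1..1} t + indicator {-1..1} s * strip e t" for s t
    using kernel_diff_bound(1)[OF e(2), of t s] by (simp add: mult.commute add.commute)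
  have "case_prod ?K1 \<in> borel_measurable (borel \<Otimes>\<^sub>M borel)" by measurable
  from kernel_operator_bound[OF this kernel_diff_bound(2,1)[OF e(2)] _ e(1) w]
  have 1: "supported R1" "L2norm R1 \<le> 4 * sqrt e * L2norm w"
    unfolding R1_def using kernel_diff_support by blast+
  have "case_prod ?K2 \<in> borel_measurable (borel \<Otimes>\<^sub>M borel)" by measurable
  from kernel_operator_bound[OF this kernel_diff_bound(2)[OF e(2)] b _ e(1) w]
  have 2: "supported R2" "L2norm R2 \<le> 4 * sqrt e * L2norm w"
    unfolding R2_def using kernel_diff_support by blast+
  have Kadm: "supported (?K1 s)" "supported (?K2 s)" for s
  proof -
    have m1: "?K1 s \<in> borel_measurable borel" and m2: "?K2 s \<in> borel_measurable borel" by measurable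
    show "supported (?K1 s)"
      by (rule supported_unit[OF m1 kernel_diff_bound(2)[OF e(2)]]) (rule kernel_diff_support(3))
    show "supported (?K2 s)"
      by (rule supported_unit[OF m2 kernel_diff_bound(2)[OF e(2)]]) (rule kernel_diff_support(2))
  qed
  have Vw: "integrable lborel (\<lambda>t. u_nat t * w t)" by (intro supported_integrable supported_mult u_nat_supported w)
  have T: "(\<integral>t. (u_nat s * u_nat t + K t) * w t \<partial>lborel) = inner_L2 u_nat w * u_nat s + (\<integral>t. K t * w t \<partial>lborel)"
    if "supported K" for K s
  proof -
    have "(\<integral>t. (u_nat s * u_nat t + K t) * w t \<partial>lborel) = (\<integral>t. u_nat s * (u_nat t * w t) + K t * w t \<partial>lborel)"
      by (simp add: distrib_right mult.assoc)
    also have "\<dots> = u_nat s * inner_L2 u_nat w + (\<integral>t. K t * w t \<partial>lborel)"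
      using Vw supported_integrable[OF supported_mult[OF that w]] by (simp add: inner_L2_def)
    finally show ?thesis by (simp add: mult.commute)
  qed
  have A: "Aop \<nu> w s = 2 * (inner_L2 u_nat w * u_nat s + (1 / 2 * R1 s + 1 / 2 * R2 s))" for s
  proof -
    have "Top (\<lambda>x. X_nat (rot (\<nu> - nu_nat) x)) w s = inner_L2 u_nat w * u_nat s + R1 s"
      unfolding Top_def X R1_def by (rule T[OF Kadm(1)])
    moreover have "Top_adj (\<lambda>x. X_nat (rot (\<nu> - nu_nat) x)) w s = inner_L2 u_nat w * u_nat s + R2 s"
      unfolding Top_adj_def X R2_def using T[OF Kadm(2), of s s] by (simp add: mult.commute[of "u_nat s"])
    ultimately show ?thesis by (simp add: Aop_def Let_def algebra_simps)
  qed
  show ?thesis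
  proof (rule that)
    show "supported (\<lambda>s. 1 / 2 * R1 s + 1 / 2 * R2 s)" by (intro supported_add supported_scale 1 2)
    have "L2norm (\<lambda>s. 1 / 2 * R1 s + 1 / 2 * R2 s) \<le> 1 / 2 * L2norm R1 + 1 / 2 * L2norm R2"
      using L2norm_triangle[OF supported_scale[OF 1(1)] supported_scale[OF 2(1)], of "1/2" "1/2"]
      unfolding L2norm_scale by simp
    then show "L2norm (\<lambda>s. 1 / 2 * R1 s + 1 / 2 * R2 s) \<le> 4 * sqrt e * L2norm w" using 1 2 by simp
    show "Aop \<nu> w = (\<lambda>s. 2 * (inner_L2 u_nat w * u_nat s + (1 / 2 * R1 s + 1 / 2 * R2 s)))" using A by blast
  qed
qed

section \<open>Power iteration with a perturbed rank-one operator\<close>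

abbreviation tnorm where "tnorm \<equiv> L2norm u_nat"

text \<open>The correlation condition makes the residual at most \<open>\<eta>\<close> times the
  coefficient of \<open>u_nat\<close>. Normalisation at most doubles this relative error, so the new
  distance depends on \<open>\<eta>\<close> alone and not on the distance of
  \<open>w\<close>.\<close>

lemma power_step:
  assumes w: "supported w" "0 < L2norm w" "L2norm w \<le> inner_L2 u_nat w"
    and r: "supported r" "L2norm r \<le> \<eta> * L2norm w" and A: "Aw = (\<lambda>s. 2 * (inner_L2 u_nat w * u_nat s + r s))"
    and \<eta>: "\<eta> \<le> 1 / 4"
  defines "w' \<equiv> (\<lambda>s. Aw s / L2norm Aw)"
  shows "supported w'" "L2norm w' = 1" "L2norm (\<lambda>s. w' s - u_nat s / tnorm) \<le> 2 * \<eta> / tnorm"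
proof -
  define a where "a = inner_L2 u_nat w"
  have a: "0 < a" using w by (simp add: a_def)
  have m: "1 \<le> tnorm" using u_nat_norm(2) by simp
  define y where "y = (\<lambda>s. a * u_nat s + r s)"
  have y: "supported y" unfolding y_def by (intro supported_add supported_scale u_nat_supported r)
  define N where "N = L2norm y"
  have \<eta>0: "0 \<le> \<eta>" using order_trans[OF L2norm_nonneg r(2)] w(2) by (simp add: zero_le_mult_iff)
  have ra: "L2norm r \<le> \<eta> * a" using r(2) mult_left_mono[OF w(3) \<eta>0] by (simp add: a_def)
  have x: "L2norm (\<lambda>s. a * u_nat s) = a * tnorm" using a by (simp add: L2norm_scale)
  have N1: "N \<le> a * tnorm + L2norm r"
    unfolding N_def y_def x[symmetric] by (intro L2norm_triangle supported_scale u_nat_supported r)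
  have N2: "a * tnorm \<le> N + L2norm r"
  proof -
    have "L2norm (\<lambda>s. y s + - 1 * r s) \<le> N + L2norm (\<lambda>s. - 1 * r s)"
      unfolding N_def by (intro L2norm_triangle y supported_scale r)
    then show ?thesis unfolding L2norm_scale by (simp add: y_def x)
  qed
  have am: "0 < a * tnorm" "a \<le> a * tnorm" using a m by auto
  have "\<eta> * a \<le> 1 / 4 * a" using \<eta> a by (intro mult_right_mono) auto
  then have N: "0 < N" using N2 ra am a by linarith
  have LA: "L2norm Aw = 2 * N"
    unfolding A N_def y_def a_def L2norm_scale by simp
  have "w' = (\<lambda>s. 2 * y s / (2 * N))" unfolding w'_def LA unfolding A y_def a_def ..
  then have w': "w' = (\<lambda>s. 1 / N * y s)" by simp
  show "supported w'" unfolding w' by (intro supported_scale y)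
  show "L2norm w' = 1" unfolding w' L2norm_scale using N by (simp add: N_def)
  have "(\<lambda>s. w' s - u_nat s / tnorm) = (\<lambda>s. (1 / N - 1 / (a * tnorm)) * y s + 1 / (a * tnorm) * r s)"
  proof
    fix s
    have "u_nat s / tnorm = 1 / (a * tnorm) * (y s - r s)" using a by (simp add: y_def)
    then show "w' s - u_nat s / tnorm = (1 / N - 1 / (a * tnorm)) * y s + 1 / (a * tnorm) * r s"
      unfolding w' by (simp only: left_diff_distrib right_diff_distrib)
  qed
  then have "L2norm (\<lambda>s. w' s - u_nat s / tnorm) \<le> \<bar>1 / N - 1 / (a * tnorm)\<bar> * N + \<bar>1 / (a * tnorm)\<bar> * L2norm r"
    using L2norm_triangle[OF supported_scale[OF y, of "1 / N - 1 / (a * tnorm)"] supported_scale[OF r(1), of "1 / (a * tnorm)"]]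
    by (simp only: L2norm_scale N_def)
  also have "\<bar>1 / N - 1 / (a * tnorm)\<bar> * N = \<bar>a * tnorm - N\<bar> / (a * tnorm)"
  proof -
    have "1 / N - 1 / (a * tnorm) = (a * tnorm - N) / (N * (a * tnorm))" using N a m by (auto simp: divide_simps)
    then have "\<bar>1 / N - 1 / (a * tnorm)\<bar> = \<bar>a * tnorm - N\<bar> / (N * (a * tnorm))" using N a m by (simp only: abs_divide) (simp add: abs_mult)
    then show ?thesis using N by simp
  qed
  also have "\<dots> \<le> L2norm r / (a * tnorm)"
    using N1 N2 am by (intro divide_right_mono) auto
  also have "\<bar>1 / (a * tnorm)\<bar> * L2norm r = L2norm r / (a * tnorm)" using am by simp
  also have "L2norm r / (a * tnorm) + L2norm r / (a * tnorm) \<le> \<eta> * a / (a * tnorm) + \<eta> * a / (a * tnorm)"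
    using ra am by (intro add_mono divide_right_mono) auto
  also have "\<dots> = 2 * \<eta> / tnorm" using a by (simp add: field_simps)
  finally show "L2norm (\<lambda>s. w' s - u_nat s / tnorm) \<le> 2 * \<eta> / tnorm" by simp
qed

text \<open>Closes the induction. For unit vectors at distance \<open>D\<close> the correlation is
  \<open>tnorm * (1 - D\<^sup>2 / 2)\<close>, and the loss is at most
  \<open>\<eta> / 2 \<le> 1 / 8\<close>, which \<open>tnorm \<ge> 1.189\<close> can afford.\<close>

lemma near_template:
  assumes w: "supported w" "L2norm w = 1" and d: "L2norm (\<lambda>s. w s - u_nat s / tnorm) \<le> 2 * \<eta> / tnorm" "0 \<le> \<eta>" "\<eta> \<le> 1 / 4"
  shows "1 \<le> inner_L2 u_nat w" "tnorm\<^sup>2 - \<eta> \<le> (inner_L2 u_nat w)\<^sup>2" "(inner_L2 u_nat w)\<^sup>2 \<le> tnorm\<^sup>2"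
proof -
  define D where "D = L2norm (\<lambda>s. w s - u_nat s / tnorm)"
  let ?a = "inner_L2 u_nat w"
  have m: "1.189 \<le> tnorm" using u_nat_norm(2) .
  then have m0: "0 < tnorm" by simp
  have "D\<^sup>2 = 1 + 2 * (- 1 / tnorm) * inner_L2 w u_nat + (- 1 / tnorm)\<^sup>2 * tnorm\<^sup>2"
    using L2norm_add_sq[OF w(1) u_nat_supported, of "- 1 / tnorm"] by (simp add: D_def w)
  also have "\<dots> = 2 - 2 * ?a / tnorm" using m0 by (simp add: inner_commute[of w] power_divide)
  finally have a: "?a = tnorm * (1 - D\<^sup>2 / 2)" using m0 by (simp add: field_simps)
  have D0: "0 \<le> D" by (simp add: D_def L2norm_nonneg)
  have "D * tnorm \<le> 2 * \<eta>" using d(1) m0 by (simp add: D_def field_simps)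
  then have "(D * tnorm)\<^sup>2 \<le> (2 * \<eta>)\<^sup>2" using D0 m0 by (intro power_mono) auto
  moreover have "(2 * \<eta>)\<^sup>2 \<le> \<eta>" using mult_right_mono[OF d(3,2)] by (simp add: power2_eq_square)
  ultimately have Dm: "D\<^sup>2 * tnorm\<^sup>2 \<le> \<eta>" by (simp add: power_mult_distrib)
  have "D\<^sup>2 * tnorm * 1 \<le> D\<^sup>2 * tnorm * tnorm" using m m0 by (intro mult_left_mono) auto
  then have "D\<^sup>2 * tnorm \<le> \<eta>" using Dm by (simp add: power2_eq_square mult.assoc)
  then have "tnorm - 1 / 8 \<le> ?a" using d(3) unfolding a by (simp add: algebra_simps)
  then show "1 \<le> ?a" using m by simp
  have "?a\<^sup>2 = tnorm\<^sup>2 - D\<^sup>2 * tnorm\<^sup>2 + tnorm\<^sup>2 * (D\<^sup>2 / 2)\<^sup>2" unfolding a by (simp add: power2_eq_square algebra_simps)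
  then show "tnorm\<^sup>2 - \<eta> \<le> ?a\<^sup>2" using Dm by (smt (verit) mult_nonneg_nonneg zero_le_power2)
  have "\<bar>?a\<bar> \<le> tnorm * 1" using cauchy_schwarz[OF u_nat_supported w(1)] w(2) by simp
  then show "?a\<^sup>2 \<le> tnorm\<^sup>2" using m0 by (simp add: abs_le_square_iff[symmetric])
qed

text \<open>The Rayleigh quotient is within \<open>2 * \<eta>\<close> of
  \<open>tnorm\<^sup>2\<close>, so the scale is off by at most
  \<open>2 * \<eta> / 1.189 \<le> 1.7 * \<eta>\<close>. The direction adds
  \<open>2 * \<eta>\<close>, and \<open>3.7 * 4 = 14.8\<close>.\<close>

lemma power_method_near_template:
  assumes w0: "supported w0" "0 < L2norm w0" "L2norm w0 \<le> inner_L2 u_nat w0"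
    and \<nu>: "\<bar>\<nu> - nu_nat - pi / 2 * of_int j\<bar> \<le> e" and e: "4 * sqrt e \<le> 1 / 4" and n: "1 \<le> n"
  shows "L2norm (\<lambda>s. Pm n w0 \<nu> s - u_nat s) \<le> 14.8 * sqrt e"
proof -
  define \<eta> where "\<eta> = 4 * sqrt e"
  have e0: "0 \<le> e" using \<nu> by linarith
  have \<eta>: "0 \<le> \<eta>" "\<eta> \<le> 1 / 4" using e e0 by (auto simp: \<eta>_def)
  have m: "1.189 \<le> tnorm" using u_nat_norm(2) .
  then have m0: "0 < tnorm" by simp
  let ?w = "\<lambda>i. power_iter i w0 \<nu>"
  have step: "supported (?w (Suc i)) \<and> L2norm (?w (Suc i)) = 1 \<and> L2norm (\<lambda>s. ?w (Suc i) s - u_nat s / tnorm) \<le> 2 * \<eta> / tnorm"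
    if h: "supported (?w i)" "0 < L2norm (?w i)" "L2norm (?w i) \<le> inner_L2 u_nat (?w i)" for i
  proof -
    obtain r where r: "supported r" "L2norm r \<le> \<eta> * L2norm (?w i)"
      "Aop \<nu> (?w i) = (\<lambda>s. 2 * (inner_L2 u_nat (?w i) * u_nat s + r s))"
      using Aop_decomposition[OF \<nu> h(1)] unfolding \<eta>_def by blast
    have eq: "?w (Suc i) = (\<lambda>s. Aop \<nu> (?w i) s / L2norm (Aop \<nu> (?w i)))" by (simp add: Let_def)
    show ?thesis using power_step[OF h r \<eta>(2)] unfolding eq by blast
  qed
  have inv: "supported (?w (Suc i)) \<and> L2norm (?w (Suc i)) = 1 \<and> L2norm (\<lambda>s. ?w (Suc i) s - u_nat s / tnorm) \<le> 2 * \<eta> / tnorm" for i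
  proof (induction i)
    case 0
    show ?case by (rule step) (use w0 in auto)
  next
    case (Suc i)
    then show ?case using near_template(1)[OF _ _ _ \<eta>] by (intro step) (auto simp del: power_iter.simps)
  qed
  define w where "w = ?w n"
  have w: "supported w" "L2norm w = 1" "L2norm (\<lambda>s. w s - u_nat s / tnorm) \<le> 2 * \<eta> / tnorm"
    using inv[of "n - 1"] n unfolding w_def by (simp_all del: power_iter.simps)
  obtain r where r: "supported r" "L2norm r \<le> \<eta>"
    "Aop \<nu> w = (\<lambda>s. 2 * (inner_L2 u_nat w * u_nat s + r s))"
    using Aop_decomposition[OF \<nu> w(1)] w(2) unfolding \<eta>_def by (metis mult.right_neutral)
  let ?a = "inner_L2 u_nat w"
  note nt = near_template[OF w(1,2,3) \<eta>]
  define mu where "mu = 1 / 2 * inner_L2 w (Aop \<nu> w)"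
  have mu: "mu = ?a\<^sup>2 + inner_L2 w r"
    unfolding mu_def r(3) inner_scale
    using inner_add[OF supported_scale[OF u_nat_supported, of ?a] r(1) w(1)] inner_scale[of w ?a u_nat]
    by (simp add: inner_commute[of w u_nat] power2_eq_square)
  have wr: "\<bar>inner_L2 w r\<bar> \<le> \<eta>" using cauchy_schwarz[OF w(1) r(1)] r(2) w(2) by simp
  have mu2: "\<bar>mu - tnorm\<^sup>2\<bar> \<le> 2 * \<eta>" using wr nt(2,3) \<eta> unfolding mu by linarith
  have m2: "1 \<le> tnorm\<^sup>2" using m by (simp add: one_le_power)
  have mu0: "0 \<le> mu" using mu2 \<eta> m2 by linarith
  have "\<bar>sqrt mu - tnorm\<bar> * tnorm \<le> \<bar>sqrt mu - tnorm\<bar> * (sqrt mu + tnorm)"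
    using mu0 by (intro mult_left_mono) auto
  also have "\<dots> = \<bar>(sqrt mu - tnorm) * (sqrt mu + tnorm)\<bar>" using mu0 m0 by (simp add: abs_mult)
  also have "\<dots> = \<bar>mu - tnorm\<^sup>2\<bar>" using mu0 by (simp add: algebra_simps power2_eq_square)
  finally have s1: "\<bar>sqrt mu - tnorm\<bar> * tnorm \<le> 2 * \<eta>" using mu2 by linarith
  have s2: "\<bar>sqrt mu - tnorm\<bar> \<le> 1.7 * \<eta>"
  proof -
    have "\<bar>sqrt mu - tnorm\<bar> * 1.189 \<le> 2 * \<eta>" using s1 mult_left_mono[OF m, of "\<bar>sqrt mu - tnorm\<bar>"] by linarith
    then show ?thesis using \<eta> by simp
  qed
  have P: "Pm n w0 \<nu> = (\<lambda>s. sqrt mu * w s)" by (simp add: Pm_def Let_def w_def mu_def)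
  have "(\<lambda>s. Pm n w0 \<nu> s - u_nat s) = (\<lambda>s. (sqrt mu - tnorm) * w s + tnorm * (w s - u_nat s / tnorm))"
    unfolding P using m0 by (auto simp: algebra_simps)
  moreover have "supported (\<lambda>s. w s - u_nat s / tnorm)"
    using supported_diff[OF w(1) supported_scale[OF u_nat_supported, of "1 / tnorm"]] by simp
  ultimately have "L2norm (\<lambda>s. Pm n w0 \<nu> s - u_nat s) \<le> \<bar>sqrt mu - tnorm\<bar> * L2norm w + \<bar>tnorm\<bar> * L2norm (\<lambda>s. w s - u_nat s / tnorm)"
    using L2norm_triangle[OF supported_scale[OF w(1), of "sqrt mu - tnorm"] supported_scale, of "\<lambda>s. w s - u_nat s / tnorm" tnorm]
    by (simp only: L2norm_scale)
  also have "\<dots> \<le> 1.7 * \<eta> + tnorm * (2 * \<eta> / tnorm)"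
    using s2 w(2) mult_left_mono[OF w(3), of tnorm] m0 by (intro add_mono) auto
  also have "\<dots> = 14.8 * sqrt e" using m0 by (simp add: \<eta>_def)
  finally show ?thesis .
qed

text \<open>The inner product of \<open>u_nat\<close> with the unit vector \<open>cosine\<close>
  exceeds \<open>1.12\<close>. This outweighs the relative error, since
  \<open>1.03 / 0.97 < 1.12\<close>.\<close>

lemma u_rough_start:
  assumes Tr: "1 \<le> Tr" and r: "(1 - 2 / pi) ^ ((Tr - 1) div 2) \<le> 1 / 100"
  shows "supported (u_rough Tr)" "0 < L2norm (u_rough Tr)" "L2norm (u_rough Tr) \<le> inner_L2 u_nat (u_rough Tr)"
proof -
  define \<delta> where "\<delta> = 3 * (1 - 2 / pi) ^ ((Tr - 1) div 2)"
  define L where "L = sqrt (4 / pi)"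
  have L: "0 < L" by (simp add: L_def)
  have \<delta>: "\<delta> \<le> 3 / 100" using r by (simp add: \<delta>_def)
  note c = u_rough_approx(1)[OF Tr]
  have ap: "\<bar>u_rough Tr s - L * cosine s\<bar> \<le> L * \<delta> * cosine s" for s
    using u_rough_approx(3)[OF Tr, of s] by (simp add: L_def \<delta>_def)
  have lo: "(1 - \<delta>) * L * cosine s \<le> u_rough Tr s" for s
    using abs_le_D2[OF ap[of s]] by (simp add: algebra_simps)
  have hi: "u_rough Tr s \<le> (1 + \<delta>) * L * cosine s" for s
    using abs_le_D1[OF ap[of s]] by (simp add: algebra_simps)
  have p: "0 < (1 - \<delta>) * L" using L \<delta> by simp
  note N = L2norm_cosine_bounds[OF c lo hi less_imp_le[OF p]]
  show "0 < L2norm (u_rough Tr)" using p N(1) by linarith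
  show a: "supported (u_rough Tr)"
  proof (rule supportedI[of _ 5])
    show "u_rough Tr \<in> borel_measurable borel" using c by (rule borel_measurable_continuous_onI)
    show "\<bar>u_rough Tr x\<bar> \<le> 5 * indicator {-1..1} x" for x
      using u_rough_facts[OF Tr, of x] by (cases "\<bar>x\<bar> \<le> 1") (auto simp: indicator_def)
  qed
  have si: "set_integrable lborel {- alpha..alpha} cosine"
    by (rule borel_integrable_atLeastAtMost'[OF continuous_cosine])
  have iu: "integrable lborel (\<lambda>x. u_nat x * cosine x)" "(\<integral>x. u_nat x * cosine x \<partial>lborel) = integral {- alpha..alpha} cosine"
    using si set_borel_integral_eq_integral(2)[OF si] unfolding set_integrable_def set_lebesgue_integral_def
    by (simp_all add: u_nat_def)
  have "(\<integral>x. (1 - \<delta>) * L * (u_nat x * cosine x) \<partial>lborel) \<le> inner_L2 u_nat (u_rough Tr)"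
    unfolding inner_L2_def
  proof (rule integral_mono)
    show "integrable lborel (\<lambda>x. u_nat x * u_rough Tr x)" by (intro supported_integrable supported_mult u_nat_supported a)
    show "(1 - \<delta>) * L * (u_nat x * cosine x) \<le> u_nat x * u_rough Tr x" for x
      using lo[of x] by (simp add: u_nat_def indicator_def mult.assoc)
  qed (use iu in auto)
  then have i: "(1 - \<delta>) * L * (4 / pi * sin (pi / 2 * alpha)) \<le> inner_L2 u_nat (u_rough Tr)"
    using integral_cosine[of alpha] alpha_bounds by (simp add: iu)
  have "1.12 \<le> 4 / pi * sin (pi / 2 * alpha)"
  proof -
    let ?b = "pi / 2 * alpha"
    have b2: "?b\<^sup>2 = pi\<^sup>2 / 8" using alpha_bounds(2) by (simp add: power_mult_distrib power_divide power2_eq_square[of alpha])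
    have "?b * (1 - pi\<^sup>2 / 48) = ?b - ?b ^ 3 / 6"
    proof -
      have "?b ^ 3 = ?b * ?b\<^sup>2" by (simp only: power2_eq_square power3_eq_cube mult.assoc)
      then show ?thesis unfolding b2 by (simp add: algebra_simps)
    qed
    also have "\<dots> \<le> sin ?b" by (rule sin_ge_taylor3) (use alpha_bounds(1) in simp)
    finally have "4 / pi * (?b * (1 - pi\<^sup>2 / 48)) \<le> 4 / pi * sin ?b" by (intro mult_left_mono) auto
    moreover have "4 / pi * (?b * (1 - pi\<^sup>2 / 48)) = 2 * alpha * (1 - pi\<^sup>2 / 48)" by simp
    moreover have "1.414 * 0.793 \<le> 2 * alpha * (1 - pi\<^sup>2 / 48)"
    proof (rule mult_mono)
      show "1.414 \<le> 2 * alpha"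
        using power2_le_imp_le[of "1.414" "2 * alpha"] alpha_bounds(1,2) by (simp add: power2_eq_square)
      have "pi\<^sup>2 \<le> 3.15\<^sup>2" using pi_approx by (intro power_mono) auto
      then show "0.793 \<le> 1 - pi\<^sup>2 / 48" by (simp add: power2_eq_square)
    qed (use alpha_bounds(1) in auto)
    ultimately show ?thesis by simp
  qed
  then have "(1 - \<delta>) * L * 1.12 \<le> (1 - \<delta>) * L * (4 / pi * sin (pi / 2 * alpha))"
    using p by (intro mult_left_mono) auto
  moreover have "(1 + \<delta>) * L \<le> (1 - \<delta>) * L * 1.12"
  proof -
    have "1 + \<delta> \<le> (1 - \<delta>) * 1.12" using \<delta> by simp
    from mult_right_mono[OF this less_imp_le[OF L]] show ?thesis by (simp add: mult_ac)
  qed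
  ultimately show "L2norm (u_rough Tr) \<le> inner_L2 u_nat (u_rough Tr)" using N(2) i by linarith
qed

theorem mainTheorem2:
  "\<exists>c1 C1 C2 :: real. c1 > 0 \<and> C1 > 0 \<and> C2 > 0 \<and>
    (\<forall>(\<sigma>::real) (\<beta>::real) (\<epsilon>::real) (Tr::nat) (Tn::nat) (Tu::nat).
       \<sigma> > 0 \<longrightarrow> \<beta> > 0 \<longrightarrow> Tr \<ge> 1 \<longrightarrow> Tn \<ge> 1 \<longrightarrow> Tu \<ge> 1 \<longrightarrow>
       \<sigma>\<^sup>2 \<le> 10 powr (-4) \<longrightarrow> \<beta> \<le> c1 \<longrightarrow> 0 < \<epsilon> \<longrightarrow> \<epsilon> \<le> 1/768 \<longrightarrow>
       real Tr \<ge> - C1 * ln (\<sigma>\<^sup>2 * \<epsilon>) \<longrightarrow>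
       real Tn \<ge> - C2 * ln (3 * \<epsilon>) / \<beta> \<longrightarrow>
       Tu \<ge> 16 \<longrightarrow>
       measure (uniform_measure lborel {0..2*pi})
         {\<nu>0. let d = rmod \<bar>nu_hat \<sigma> \<beta> Tr Tn \<nu>0 - nu_nat\<bar> (pi/2) in
               min d (pi/2 - d) \<le> 3 * \<epsilon> \<and>
               L2norm (\<lambda>s. u_hat \<sigma> \<beta> Tr Tn Tu \<nu>0 s - u_nat s) \<le> 31 * sqrt \<epsilon>}
       \<ge> 4/7)"
\<comment> \<open>\<open>1/16\<close> is the reciprocal of the upper slope of the torque, 4 comes
  from \<open>rough_error\<close>, and 40 is the reciprocal of the lower slope
  \<open>0.025\<close>.\<close>
proof (rule exI[of _ "1/16"], rule exI[of _ 4], rule exI[of _ 40], intro conjI allI impI)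
  fix \<sigma> \<beta> \<epsilon> :: real and Tr Tn Tu :: nat
  assume \<sigma>: "\<sigma> > 0" "\<sigma>\<^sup>2 \<le> 10 powr (-4)" and \<beta>: "\<beta> > 0" "\<beta> \<le> 1/16"
    and T: "Tr \<ge> 1" "Tu \<ge> 1" and \<epsilon>: "0 < \<epsilon>" "\<epsilon> \<le> 1/768"
    and Tr: "real Tr \<ge> - 4 * ln (\<sigma>\<^sup>2 * \<epsilon>)" and Tn: "real Tn \<ge> - 40 * ln (3 * \<epsilon>) / \<beta>"
  have \<sigma>2: "\<sigma>\<^sup>2 \<le> 1 / 10 ^ 4" using \<sigma>(2) by (simp add: powr_minus_divide)
  let ?good = "\<lambda>\<nu>. \<exists>j::int. \<bar>nu_hat \<sigma> \<beta> Tr Tn \<nu> - nu_nat - pi / 2 * of_int j\<bar> \<le> 3 * \<epsilon>"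
  have x: "\<sigma>\<^sup>2 * \<epsilon> \<le> 1 / 10 ^ 4 * 1" using \<sigma>2 \<epsilon> by (intro mult_mono) auto
  have "(1 - 2 / pi) ^ ((Tr - 1) div 2) \<le> 2 * (\<sigma>\<^sup>2 * \<epsilon>)"
    using \<sigma>(1) \<epsilon>(1) x Tr by (intro rough_error) auto
  then have r: "(1 - 2 / pi) ^ ((Tr - 1) div 2) \<le> 1 / 100" using x by simp
  have near: "L2norm (\<lambda>s. u_hat \<sigma> \<beta> Tr Tn Tu \<nu> s - u_nat s) \<le> 31 * sqrt \<epsilon>" if g: "?good \<nu>" for \<nu>
  proof -
    obtain j :: int where j: "\<bar>nu_hat \<sigma> \<beta> Tr Tn \<nu> - nu_nat - pi / 2 * of_int j\<bar> \<le> 3 * \<epsilon>"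
      using g by blast
    have s3: "sqrt 3 \<le> 2" by (rule real_le_lsqrt) auto
    \<comment> \<open>Here \<open>1/768\<close> enters: it is \<open>1 / (3 * 16\<^sup>2)\<close>,
      exactly what makes \<open>4 * sqrt (3 * \<epsilon>) \<le> 1 / 4\<close>.\<close>
    have "sqrt (3 * \<epsilon>) \<le> sqrt ((1 / 16)\<^sup>2)" using \<epsilon> by (intro real_sqrt_le_mono) (simp add: power2_eq_square)
    then have "4 * sqrt (3 * \<epsilon>) \<le> 1 / 4" by simp
    from power_method_near_template[OF u_rough_start[OF T(1) r] j this T(2)]
    have "L2norm (\<lambda>s. u_hat \<sigma> \<beta> Tr Tn Tu \<nu> s - u_nat s) \<le> 14.8 * sqrt (3 * \<epsilon>)" by (simp add: u_hat_def)
    also have "\<dots> = 14.8 * sqrt 3 * sqrt \<epsilon>" by (simp add: real_sqrt_mult)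
    also have "\<dots> \<le> 31 * sqrt \<epsilon>" using s3 \<epsilon> by (intro mult_right_mono) auto
    finally show ?thesis .
  qed
  have "{\<nu>0. let d = rmod \<bar>nu_hat \<sigma> \<beta> Tr Tn \<nu>0 - nu_nat\<bar> (pi/2) in
      min d (pi/2 - d) \<le> 3 * \<epsilon> \<and> L2norm (\<lambda>s. u_hat \<sigma> \<beta> Tr Tn Tu \<nu>0 s - u_nat s) \<le> 31 * sqrt \<epsilon>} = {\<nu>0. ?good \<nu>0}"
    unfolding Let_def using near rmod_close_iff[of "pi / 2"] by auto
  moreover have "4 / 7 \<le> measure (uniform_measure lborel {0..2*pi}) {\<nu>0. ?good \<nu>0}"
  proof (rule measure_good_starts)
    have [measurable]: "nu_hat \<sigma> \<beta> Tr Tn \<in> borel_measurable borel"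
      using continuous_nu_hat[OF \<sigma>(1) T(1)] by (rule borel_measurable_continuous_onI)
    show "{\<nu>0. ?good \<nu>0} \<in> sets borel" by measurable
    show "\<nu> \<in> {\<nu>0. ?good \<nu>0}" if "\<bar>\<nu> - nu_nat - pi / 2 * of_int j\<bar> \<le> pi / 7" for \<nu> j
      using gd_convergence[OF \<sigma>(1) \<sigma>2 \<beta> \<epsilon> T(1) Tr Tn that] by blast
  qed
  ultimately show "4 / 7 \<le> measure (uniform_measure lborel {0..2*pi})
     {\<nu>0. let d = rmod \<bar>nu_hat \<sigma> \<beta> Tr Tn \<nu>0 - nu_nat\<bar> (pi/2) in
           min d (pi/2 - d) \<le> 3 * \<epsilon> \<and>
           L2norm (\<lambda>s. u_hat \<sigma> \<beta> Tr Tn Tu \<nu>0 s - u_nat s) \<le> 31 * sqrt \<epsilon>}" by simp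
qed auto

end
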